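(* Let ${\mathcal C}$ be a subcategory of $\mathbf{Unif}$. Then the following are equivalent: 1) ${\mathcal C}$ is closed under products and closed subspaces and is algebraic. 2) Either $\mathrm{Ob}\,{\mathcal C}=\{X\in \mathrm{Ob}\,\mathbf{Unif}\mid X\text{ is indiscrete}\}$, or ${\mathcal C}$ is an epireflective subcategory of $\{X\in \mathrm{Ob}\,\mathbf{Unif}\mid X\text{ is compact }T_2\}$. Moreover, none of the three properties in 1) (closedness under products, closedness under closed subspaces, being algebraic) can be omitted without invalidating the implication $1)\Rightarrow 2)$ (that is, for each of the three properties there is a subcategory of $\mathbf{Unif}$ having the other two properties but not of the form in 2)).
   Context: $\mathbf{Unif}$ is the category of all uniform spaces (no separation axiom) and uniformly continuous maps. Subcategories are always full and isomorphism closed, and are identified with the classes of their objects; they are regarded as concrete categories over $\mathbf{Set}$ via the underlying set functor $U$. Products (including the empty product) and closed subspaces are taken in $\mathbf{Unif}$. A subcategory is epireflective if it is reflective with all reflection arrows epimorphisms of the ambient category (here the ambient category is the full subcategory of compact $T_2$ uniform spaces). A concrete category $\langle{\mathcal C}, U:{\mathcal C}\to\mathbf{Set}\rangle$ is called algebraic if ${\mathcal C}$ has coequalizers, $U$ has a left adjoint, and $U$ preserves and reflects regular epimorphisms. *)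

theory Defs
  imports "HOL-Analysis.Analysis" "HOL-Library.Equipollence"
begin

section \<open>Size\<close>

text \<open>
  HOL has no proper classes, so "all sets" and "all uniform spaces" are taken relative to a
  universe: a type \<open>'u\<close> of strongly inaccessible cardinality.  A set over \<open>'u\<close> plays the role of
  a set when it is strictly smaller than the universe, and subsets of the type of all uniform
  structures over \<open>'u\<close> play the role of classes of uniform spaces.  Every small set, wherever it
  lives, is in bijection with a small set over \<open>'u\<close>.
\<close>

definition small :: "'u set \<Rightarrow> bool" where
  "small A \<longleftrightarrow> A \<prec> (UNIV :: 'u set)"

definition inaccessible_universe :: "'u itself \<Rightarrow> bool" where
  "inaccessible_universe _ \<longleftrightarrow>
     (UNIV :: nat set) \<prec> (UNIV :: 'u set) \<and>
     (\<forall>A :: 'u set. small A \<longrightarrow> Pow A \<prec> (UNIV :: 'u set)) \<and>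
     (\<forall>(I :: 'u set) (A :: 'u \<Rightarrow> 'u set).
        small I \<and> (\<forall>i\<in>I. small (A i)) \<longrightarrow> small (\<Union>i\<in>I. A i))"


section \<open>Uniform spaces\<close>

record 'a ustruct =
  points :: "'a set"
  entourages :: "('a \<times> 'a) set set"

definition unif_space :: "'a ustruct \<Rightarrow> bool" where
  "unif_space X \<longleftrightarrow>
     points X \<times> points X \<in> entourages X \<and>
     (\<forall>E\<in>entourages X. Id_on (points X) \<subseteq> E \<and> E \<subseteq> points X \<times> points X) \<and>
     (\<forall>E\<in>entourages X. \<forall>F. E \<subseteq> F \<and> F \<subseteq> points X \<times> points X \<longrightarrow> F \<in> entourages X) \<and>
     (\<forall>E\<in>entourages X. \<forall>F\<in>entourages X. E \<inter> F \<in> entourages X) \<and>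
     (\<forall>E\<in>entourages X. E\<inverse> \<in> entourages X) \<and>
     (\<forall>E\<in>entourages X. \<exists>F\<in>entourages X. F O F \<subseteq> E)"

text \<open>Maps between carrier sets are extensional, so equality of morphisms is equality in HOL.\<close>

definition umaps :: "'a ustruct \<Rightarrow> 'b ustruct \<Rightarrow> ('a \<Rightarrow> 'b) set" where
  "umaps X Y =
     {f \<in> points X \<rightarrow>\<^sub>E points Y.
        \<forall>E\<in>entourages Y. {(x, x') \<in> points X \<times> points X. (f x, f x') \<in> E} \<in> entourages X}"

definition uiso :: "'a ustruct \<Rightarrow> 'b ustruct \<Rightarrow> bool" where
  "uiso X Y \<longleftrightarrow>
     (\<exists>f\<in>umaps X Y. \<exists>g\<in>umaps Y X.
        (\<forall>x\<in>points X. g (f x) = x) \<and> (\<forall>y\<in>points Y. f (g y) = y))"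

definition utopology :: "'a ustruct \<Rightarrow> 'a topology" where
  "utopology X =
     topology (\<lambda>U. U \<subseteq> points X \<and> (\<forall>x\<in>U. \<exists>E\<in>entourages X. E `` {x} \<subseteq> U))"

lemma openin_utopology:
  assumes "unif_space X"
  shows "openin (utopology X) U \<longleftrightarrow>
    U \<subseteq> points X \<and> (\<forall>x\<in>U. \<exists>E\<in>entourages X. E `` {x} \<subseteq> U)"
proof -
  have "istopology (\<lambda>U. U \<subseteq> points X \<and> (\<forall>x\<in>U. \<exists>E\<in>entourages X. E `` {x} \<subseteq> U))"
    unfolding istopology_def
  proof (intro conjI allI impI)
    fix S T
    assume S: "S \<subseteq> points X \<and> (\<forall>x\<in>S. \<exists>E\<in>entourages X. E `` {x} \<subseteq> S)"
      and T: "T \<subseteq> points X \<and> (\<forall>x\<in>T. \<exists>E\<in>entourages X. E `` {x} \<subseteq> T)"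
    show "S \<inter> T \<subseteq> points X" using S by blast
    show "\<forall>x\<in>S \<inter> T. \<exists>E\<in>entourages X. E `` {x} \<subseteq> S \<inter> T"
    proof
      fix x assume "x \<in> S \<inter> T"
      then obtain E F where E: "E \<in> entourages X" "E `` {x} \<subseteq> S"
        and F: "F \<in> entourages X" "F `` {x} \<subseteq> T"
        using S T by blast
      have "E \<inter> F \<in> entourages X" using assms E F unfolding unif_space_def by blast
      moreover have "(E \<inter> F) `` {x} \<subseteq> S \<inter> T" using E F by blast
      ultimately show "\<exists>E\<in>entourages X. E `` {x} \<subseteq> S \<inter> T" by blast
    qed
  next
    fix \<K> :: "'a set set"
    assume K: "\<forall>K\<in>\<K>. K \<subseteq> points X \<and> (\<forall>x\<in>K. \<exists>E\<in>entourages X. E `` {x} \<subseteq> K)"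
    show "\<Union>\<K> \<subseteq> points X" using K by blast
    show "\<forall>x\<in>\<Union>\<K>. \<exists>E\<in>entourages X. E `` {x} \<subseteq> \<Union>\<K>"
      using K by (meson Union_upper UnionE subset_trans)
  qed
  then show ?thesis by (simp add: utopology_def topology_inverse')
qed

definition usubspace :: "'a ustruct \<Rightarrow> 'a set \<Rightarrow> 'a ustruct" where
  "usubspace X A = \<lparr>points = A, entourages = {E \<inter> (A \<times> A) | E. E \<in> entourages X}\<rparr>"

definition uproduct :: "'i set \<Rightarrow> ('i \<Rightarrow> 'a ustruct) \<Rightarrow> ('i \<Rightarrow> 'a) ustruct" where
  "uproduct I X =
     (let P = (\<Pi>\<^sub>E i\<in>I. points (X i)) in
      \<lparr>points = P,
       entourages = {E. E \<subseteq> P \<times> P \<and>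
         (\<exists>J F. finite J \<and> J \<subseteq> I \<and> (\<forall>j\<in>J. F j \<in> entourages (X j)) \<and>
            {(p, q) \<in> P \<times> P. \<forall>j\<in>J. (p j, q j) \<in> F j} \<subseteq> E)}\<rparr>)"

definition uindiscrete :: "'a ustruct \<Rightarrow> bool" where
  "uindiscrete X \<longleftrightarrow> entourages X = {points X \<times> points X}"


section \<open>Categories\<close>

text \<open>
  Morphisms do not carry their domain and codomain, so composition and the action of functors
  on morphisms take the objects involved as arguments: \<open>Comp \<C> X Y Z g f\<close> is the composite of
  \<open>f : X \<rightarrow> Y\<close> and \<open>g : Y \<rightarrow> Z\<close>.
\<close>

record ('o, 'm) cat =
  Ob :: "'o set"
  Hom :: "'o \<Rightarrow> 'o \<Rightarrow> 'm set"
  Ident :: "'o \<Rightarrow> 'm"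
  Comp :: "'o \<Rightarrow> 'o \<Rightarrow> 'o \<Rightarrow> 'm \<Rightarrow> 'm \<Rightarrow> 'm"

definition full_on :: "('o, 'm) cat \<Rightarrow> 'o set \<Rightarrow> ('o, 'm) cat" where
  "full_on \<C> D = \<C>\<lparr>Ob := D\<rparr>"

definition epi :: "('o, 'm) cat \<Rightarrow> 'o \<Rightarrow> 'o \<Rightarrow> 'm \<Rightarrow> bool" where
  "epi \<C> X Y e \<longleftrightarrow>
     e \<in> Hom \<C> X Y \<and>
     (\<forall>Z\<in>Ob \<C>. \<forall>g\<in>Hom \<C> Y Z. \<forall>h\<in>Hom \<C> Y Z.
        Comp \<C> X Y Z g e = Comp \<C> X Y Z h e \<longrightarrow> g = h)"

definition coequalizer ::
    "('o, 'm) cat \<Rightarrow> 'o \<Rightarrow> 'o \<Rightarrow> 'm \<Rightarrow> 'm \<Rightarrow> 'o \<Rightarrow> 'm \<Rightarrow> bool" where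
  "coequalizer \<C> X Y f g Q q \<longleftrightarrow>
     Q \<in> Ob \<C> \<and> q \<in> Hom \<C> Y Q \<and> Comp \<C> X Y Q q f = Comp \<C> X Y Q q g \<and>
     (\<forall>Z\<in>Ob \<C>. \<forall>h\<in>Hom \<C> Y Z. Comp \<C> X Y Z h f = Comp \<C> X Y Z h g \<longrightarrow>
        (\<exists>!k. k \<in> Hom \<C> Q Z \<and> Comp \<C> Y Q Z k q = h))"

definition has_coequalizers :: "('o, 'm) cat \<Rightarrow> bool" where
  "has_coequalizers \<C> \<longleftrightarrow>
     (\<forall>X\<in>Ob \<C>. \<forall>Y\<in>Ob \<C>. \<forall>f\<in>Hom \<C> X Y. \<forall>g\<in>Hom \<C> X Y. \<exists>Q q. coequalizer \<C> X Y f g Q q)"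

definition regular_epi :: "('o, 'm) cat \<Rightarrow> 'o \<Rightarrow> 'o \<Rightarrow> 'm \<Rightarrow> bool" where
  "regular_epi \<C> Y Q q \<longleftrightarrow>
     (\<exists>X\<in>Ob \<C>. \<exists>f\<in>Hom \<C> X Y. \<exists>g\<in>Hom \<C> X Y. coequalizer \<C> X Y f g Q q)"

definition reflection_arrow ::
    "('o, 'm) cat \<Rightarrow> 'o set \<Rightarrow> 'o \<Rightarrow> 'o \<Rightarrow> 'm \<Rightarrow> bool" where
  "reflection_arrow \<C> D X R r \<longleftrightarrow>
     R \<in> D \<and> r \<in> Hom \<C> X R \<and>
     (\<forall>Y\<in>D. \<forall>f\<in>Hom \<C> X Y. \<exists>!g. g \<in> Hom \<C> R Y \<and> Comp \<C> X R Y g r = f)"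

definition epireflective :: "('o, 'm) cat \<Rightarrow> 'o set \<Rightarrow> bool" where
  "epireflective \<C> D \<longleftrightarrow>
     D \<subseteq> Ob \<C> \<and>
     (\<forall>X\<in>Ob \<C>. \<exists>R r. reflection_arrow \<C> D X R r) \<and>
     (\<forall>X\<in>Ob \<C>. \<forall>R r. reflection_arrow \<C> D X R r \<longrightarrow> epi \<C> X R r)"


subsection \<open>Functors\<close>

record ('o, 'm, 'p, 'n) ftor =
  obmap :: "'o \<Rightarrow> 'p"
  homap :: "'o \<Rightarrow> 'o \<Rightarrow> 'm \<Rightarrow> 'n"

definition is_functor ::
    "('o, 'm) cat \<Rightarrow> ('p, 'n) cat \<Rightarrow> ('o, 'm, 'p, 'n) ftor \<Rightarrow> bool" where
  "is_functor \<A> \<B> F \<longleftrightarrow>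
     (\<forall>X\<in>Ob \<A>. obmap F X \<in> Ob \<B>) \<and>
     (\<forall>X\<in>Ob \<A>. \<forall>Y\<in>Ob \<A>. \<forall>f\<in>Hom \<A> X Y.
        homap F X Y f \<in> Hom \<B> (obmap F X) (obmap F Y)) \<and>
     (\<forall>X\<in>Ob \<A>. homap F X X (Ident \<A> X) = Ident \<B> (obmap F X)) \<and>
     (\<forall>X\<in>Ob \<A>. \<forall>Y\<in>Ob \<A>. \<forall>Z\<in>Ob \<A>. \<forall>f\<in>Hom \<A> X Y. \<forall>g\<in>Hom \<A> Y Z.
        homap F X Z (Comp \<A> X Y Z g f) =
        Comp \<B> (obmap F X) (obmap F Y) (obmap F Z) (homap F Y Z g) (homap F X Y f))"

text \<open>\<open>F\<close> is left adjoint to \<open>G : \<A> \<rightarrow> \<B>\<close>: a natural bijection between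
  \<open>\<A>(F X, Y)\<close> and \<open>\<B>(X, G Y)\<close>.\<close>

definition left_adjoint ::
    "('o, 'm) cat \<Rightarrow> ('p, 'n) cat \<Rightarrow> ('p, 'n, 'o, 'm) ftor \<Rightarrow> ('o, 'm, 'p, 'n) ftor \<Rightarrow> bool"
  where
  "left_adjoint \<A> \<B> F G \<longleftrightarrow>
     is_functor \<B> \<A> F \<and>
     (\<exists>\<Phi>.
       (\<forall>X\<in>Ob \<B>. \<forall>Y\<in>Ob \<A>.
          bij_betw (\<Phi> X Y) (Hom \<A> (obmap F X) Y) (Hom \<B> X (obmap G Y))) \<and>
       (\<forall>X\<in>Ob \<B>. \<forall>X'\<in>Ob \<B>. \<forall>Y\<in>Ob \<A>. \<forall>h\<in>Hom \<B> X' X. \<forall>f\<in>Hom \<A> (obmap F X) Y.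
          \<Phi> X' Y (Comp \<A> (obmap F X') (obmap F X) Y f (homap F X' X h)) =
          Comp \<B> X' X (obmap G Y) (\<Phi> X Y f) h) \<and>
       (\<forall>X\<in>Ob \<B>. \<forall>Y\<in>Ob \<A>. \<forall>Y'\<in>Ob \<A>. \<forall>k\<in>Hom \<A> Y Y'. \<forall>f\<in>Hom \<A> (obmap F X) Y.
          \<Phi> X Y' (Comp \<A> (obmap F X) Y Y' k f) =
          Comp \<B> X (obmap G Y) (obmap G Y') (homap G Y Y' k) (\<Phi> X Y f)))"

definition preserves_regular_epis ::
    "('o, 'm) cat \<Rightarrow> ('p, 'n) cat \<Rightarrow> ('o, 'm, 'p, 'n) ftor \<Rightarrow> bool" where
  "preserves_regular_epis \<A> \<B> G \<longleftrightarrow>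
     (\<forall>X\<in>Ob \<A>. \<forall>Y\<in>Ob \<A>. \<forall>f\<in>Hom \<A> X Y.
        regular_epi \<A> X Y f \<longrightarrow> regular_epi \<B> (obmap G X) (obmap G Y) (homap G X Y f))"

definition reflects_regular_epis ::
    "('o, 'm) cat \<Rightarrow> ('p, 'n) cat \<Rightarrow> ('o, 'm, 'p, 'n) ftor \<Rightarrow> bool" where
  "reflects_regular_epis \<A> \<B> G \<longleftrightarrow>
     (\<forall>X\<in>Ob \<A>. \<forall>Y\<in>Ob \<A>. \<forall>f\<in>Hom \<A> X Y.
        regular_epi \<B> (obmap G X) (obmap G Y) (homap G X Y f) \<longrightarrow> regular_epi \<A> X Y f)"


section \<open>Sets, uniform spaces, and full subcategories\<close>

definition SetCat :: "('u set, 'u \<Rightarrow> 'u) cat" where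
  "SetCat =
     \<lparr>Ob = {A. small A},
      Hom = (\<lambda>A B. A \<rightarrow>\<^sub>E B),
      Ident = (\<lambda>A. \<lambda>x\<in>A. x),
      Comp = (\<lambda>A B C g f. compose A g f)\<rparr>"

definition Unif :: "('u ustruct, 'u \<Rightarrow> 'u) cat" where
  "Unif =
     \<lparr>Ob = {X. unif_space X \<and> small (points X)},
      Hom = umaps,
      Ident = (\<lambda>X. \<lambda>x\<in>points X. x),
      Comp = (\<lambda>X Y Z g f. compose (points X) g f)\<rparr>"

definition forget :: "('u ustruct, 'u \<Rightarrow> 'u, 'u set, 'u \<Rightarrow> 'u) ftor" where
  "forget = \<lparr>obmap = points, homap = (\<lambda>X Y f. f)\<rparr>"

definition subcategory :: "'u ustruct set \<Rightarrow> bool" where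
  "subcategory C \<longleftrightarrow>
     C \<subseteq> Ob Unif \<and> (\<forall>X\<in>C. \<forall>Y\<in>Ob Unif. uiso X Y \<longrightarrow> Y \<in> C)"

definition algebraic_category :: "'u ustruct set \<Rightarrow> bool" where
  "algebraic_category C \<longleftrightarrow>
     has_coequalizers (full_on Unif C) \<and>
     (\<exists>F. left_adjoint (full_on Unif C) SetCat F forget) \<and>
     preserves_regular_epis (full_on Unif C) SetCat forget \<and>
     reflects_regular_epis (full_on Unif C) SetCat forget"

text \<open>The carrier of a product is not a set over \<open>'u\<close>, so closedness under products is
  expressed by an isomorphic copy; for isomorphism closed \<open>C\<close> the choice of the copy is
  irrelevant.  The case \<open>I = {}\<close> is included.\<close>

definition closed_under_products :: "'u ustruct set \<Rightarrow> bool" where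
  "closed_under_products C \<longleftrightarrow>
     (\<forall>(I :: 'u set) X. small I \<and> (\<forall>i\<in>I. X i \<in> C) \<longrightarrow> (\<exists>Y\<in>C. uiso (uproduct I X) Y))"

definition closed_under_closed_subspaces :: "'u ustruct set \<Rightarrow> bool" where
  "closed_under_closed_subspaces C \<longleftrightarrow>
     (\<forall>X\<in>C. \<forall>A. closedin (utopology X) A \<longrightarrow> usubspace X A \<in> C)"

definition indiscrete_spaces :: "'u ustruct set" where
  "indiscrete_spaces = {X \<in> Ob Unif. uindiscrete X}"

definition compact_T2_spaces :: "'u ustruct set" where
  "compact_T2_spaces =
     {X \<in> Ob Unif. compact_space (utopology X) \<and> Hausdorff_space (utopology X)}"

definition indiscrete_or_epireflective :: "'u ustruct set \<Rightarrow> bool" where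
  "indiscrete_or_epireflective C \<longleftrightarrow>
     C = indiscrete_spaces \<or> epireflective (full_on Unif compact_T2_spaces) C"

end

theory Submission
  imports Defs
begin

text \<open>
  Surjective morphisms of an algebraic category are regular epimorphisms, so a morphism \<open>h\<close> that is
  constant on the fibres of a surjective morphism \<open>p : G \<rightarrow> B\<close> factors through \<open>p\<close>.  Each half of the
  implication from 1) to 2) builds \<open>G\<close> and \<open>B\<close> inside products of a given space and refutes the
  continuity of the factor.

  If some space is not Hausdorff, the category contains an indiscrete \<open>N\<close> with at least two points.
  A space that is not indiscrete contains the sum \<open>A + B\<close> of two closed indiscrete classes;
  \<open>(A + B) \<times> N\<close> is mapped onto \<open>N\<close> such that the two summands have disjoint images, and the factor
  \<open>N \<rightarrow> A + B\<close> would be continuous but not constant.  All indiscrete spaces are then coequalizers of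
  maps between powers of \<open>N\<close>.

  If \<open>X\<close> is Hausdorff but not compact, choose an open cover \<open>\<U>\<close> without finite subcover and of minimal
  cardinality, and well-order it by its cardinal.  The initial segments of \<open>\<U>\<close> form a closed subspace
  \<open>B\<close> of \<open>{a, b}\<^sup>\<U>\<close>.  The pairs \<open>(S, y)\<close> with \<open>y \<notin> \<Union>S\<close> form a closed subset of \<open>B \<times> X\<close>; its fibre over
  \<open>S\<close> is empty exactly for \<open>S = \<U>\<close>.  Adding one point over \<open>\<U>\<close> as a separate summand gives a surjection
  onto \<open>B\<close>, and the factor would show that \<open>\<U>\<close> is isolated in \<open>B\<close>.

  Reflections, coequalizers and free objects of a category of Hausdorff spaces closed under products
  and closed subspaces all arise from one construction: the closure of the image in the product of
  all maps into spaces of bounded size.  Conversely, epimorphisms of compact Hausdorff spaces are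
  surjective by Urysohn's lemma, and an epimorphism with a left inverse is an isomorphism.
\<close>

section \<open>Small sets\<close>

text \<open>The factor of \<open>h\<close> through \<open>p\<close> always exists as a function;
  algebraicity contributes only its uniform continuity. Each construction therefore forces this
  function and makes it visibly discontinuous, while \<open>p\<close> and \<open>h\<close> are
  continuous for simple reasons: they map into an indiscrete space, or are restricted projections,
  or perturb one inside inseparability classes.

  Disjoint sums are not at hand, only products and closed subspaces, so the extra summand over the
  full segment is separated by a coordinate that serves as a label. Minimality of the cover ensures
  that every proper initial segment leaves a point uncovered; the infinite cardinal order makes the
  full segment a limit of proper ones.

  The literal product of spaces over \<open>'u\<close> has functions as points and is not a space
  over \<open>'u\<close>. Products are handled by cones on an arbitrary carrier, and index sets of
  any type are replaced by copies in \<open>'u\<close>.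

  The independence claims are witnessed by the discrete spaces (products fail), the one-point spaces
  (the empty subspace is missing) and all of \<open>Unif\<close> (not algebraic).\<close>

locale universe =
  fixes U :: "'u itself"
  assumes inaccessible: "inaccessible_universe TYPE('u)"
begin

lemma nat_lesspoll_universe: "(UNIV :: nat set) \<prec> (UNIV :: 'u set)"
  using inaccessible unfolding inaccessible_universe_def by blast

lemma infinite_universe: "infinite (UNIV :: 'u set)"
  using nat_lesspoll_universe infinite_le_lepoll lesspoll_imp_lepoll by blast

lemma finite_lesspoll_universe: "finite A \<Longrightarrow> A \<prec> (UNIV :: 'u set)"
  by (rule finite_lesspoll_infinite[OF infinite_universe])

text \<open>The bridge between types: index sets such as sets of pairs, of covers or of functions
  are moved into \<open>'u\<close>, where the definitions of smallness and of closure under products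
  apply.\<close>

lemma small_copy:
  assumes "A \<prec> (UNIV :: 'u set)"
  obtains f :: "'a \<Rightarrow> 'u" where "inj_on f A" "small (f ` A)"
proof -
  obtain f :: "'a \<Rightarrow> 'u" where f: "inj_on f A"
    using assms unfolding lesspoll_def lepoll_def by blast
  moreover have "small (f ` A)"
    unfolding small_def using f assms by simp
  ultimately show thesis using that by blast
qed

lemma Pow_lesspoll_universe:
  assumes "A \<prec> (UNIV :: 'u set)"
  shows "Pow A \<prec> (UNIV :: 'u set)"
proof -
  obtain f :: "'a \<Rightarrow> 'u" where f: "inj_on f A" "small (f ` A)"
    using small_copy[OF assms] .
  have "Pow (f ` A) \<prec> (UNIV :: 'u set)"
    using inaccessible f(2) unfolding inaccessible_universe_def by blast
  moreover have "Pow A \<lesssim> Pow (f ` A)"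
    unfolding lepoll_def using inj_on_image_Pow[OF f(1)] by (intro exI[of _ "image f"]) auto
  ultimately show ?thesis using lesspoll_trans1 by blast
qed

text \<open>The regularity clause of an inaccessible universe speaks only of unions of subsets of
  \<open>'u\<close>. All sets are therefore copied into \<open>'u\<close>, and an injection of
  \<open>'u\<close> \<times> \<open>'u\<close> into \<open>'u\<close> tags each summand with its
  index, so that the union is disjoint.\<close>

lemma Sigma_lesspoll_universe:
  assumes I: "I \<prec> (UNIV :: 'u set)" and X: "\<And>i. i \<in> I \<Longrightarrow> X i \<prec> (UNIV :: 'u set)"
  shows "Sigma I X \<prec> (UNIV :: 'u set)"
proof -
  obtain f :: "'a \<Rightarrow> 'u" where f: "inj_on f I" "small (f ` I)" using small_copy[OF I] .
  have "\<forall>i\<in>I. \<exists>g :: 'b \<Rightarrow> 'u. inj_on g (X i) \<and> small (g ` X i)"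
    using small_copy[OF X] by blast
  then obtain g :: "'a \<Rightarrow> 'b \<Rightarrow> 'u"
    where g: "\<And>i. i \<in> I \<Longrightarrow> inj_on (g i) (X i)" "\<And>i. i \<in> I \<Longrightarrow> small (g i ` X i)"
    unfolding bchoice_iff by blast
  have "(UNIV :: 'u set) \<times> (UNIV :: 'u set) \<lesssim> (UNIV :: 'u set)"
    using card_of_Times_same_infinite[OF infinite_universe] eqpoll_iff_card_of_ordIso
      eqpoll_imp_lepoll by blast
  then obtain p :: "'u \<times> 'u \<Rightarrow> 'u" where p: "inj p"
    unfolding lepoll_def by auto
  define S where "S = (\<lambda>u. (\<lambda>x. p (u, x)) ` (g (inv_into I f u) ` X (inv_into I f u)))"
  have "small (S u)" if "u \<in> f ` I" for u
  proof -
    have "inv_into I f u \<in> I" using that by (rule inv_into_into)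
    moreover have "inj_on (\<lambda>x. p (u, x)) T" for T
      by (rule inj_onI) (drule injD[OF p], simp)
    ultimately show ?thesis using g(2) unfolding S_def small_def
      by (meson image_lepoll lesspoll_trans1)
  qed
  then have "small (\<Union>u\<in>f ` I. S u)"
    using inaccessible f(2) unfolding inaccessible_universe_def by blast
  moreover have "Sigma I X \<lesssim> (\<Union>u\<in>f ` I. S u)"
    unfolding lepoll_def
  proof (intro exI[of _ "\<lambda>(i, x). p (f i, g i x)"] conjI)
    show "inj_on (\<lambda>(i, x). p (f i, g i x)) (Sigma I X)"
    proof (rule inj_onI, clarify)
      fix i x j y assume "i \<in> I" "x \<in> X i" "j \<in> I" "y \<in> X j" "p (f i, g i x) = p (f j, g j y)"
      from injD[OF p this(5)] have "f i = f j" "g i x = g j y" by simp_all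
      moreover from this(1) have "i = j" using inj_onD[OF f(1)] \<open>i \<in> I\<close> \<open>j \<in> I\<close> by blast
      ultimately show "i = j \<and> x = y"
        using inj_onD[OF g(1)] \<open>i \<in> I\<close> \<open>x \<in> X i\<close> \<open>y \<in> X j\<close> by blast
    qed
    show "(\<lambda>(i, x). p (f i, g i x)) ` Sigma I X \<subseteq> (\<Union>u\<in>f ` I. S u)"
      using f(1) unfolding S_def by auto
  qed
  ultimately show ?thesis unfolding small_def using lesspoll_trans1 by blast
qed

lemma Times_lesspoll_universe:
  assumes "A \<prec> (UNIV :: 'u set)" "B \<prec> (UNIV :: 'u set)"
  shows "A \<times> B \<prec> (UNIV :: 'u set)"
  using assms by (rule Sigma_lesspoll_universe)

text \<open>An extensional function is determined by its graph, a subset of the dependent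
  sum.\<close>

lemma PiE_lesspoll_universe:
  assumes I: "I \<prec> (UNIV :: 'u set)" and X: "\<And>i. i \<in> I \<Longrightarrow> X i \<prec> (UNIV :: 'u set)"
  shows "Pi\<^sub>E I X \<prec> (UNIV :: 'u set)"
proof -
  have "Pi\<^sub>E I X \<lesssim> Pow (Sigma I X)"
    unfolding lepoll_def
  proof (intro exI[of _ "\<lambda>f. {(i, f i) | i. i \<in> I}"] conjI)
    show "inj_on (\<lambda>f. {(i, f i) | i. i \<in> I}) (Pi\<^sub>E I X)"
    proof (rule inj_onI)
      fix f g assume fg: "f \<in> Pi\<^sub>E I X" "g \<in> Pi\<^sub>E I X" "{(i, f i) | i. i \<in> I} = {(i, g i) | i. i \<in> I}"
      have "f i = g i" if "i \<in> I" for i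
      proof -
        have "(i, f i) \<in> {(i, g i) | i. i \<in> I}" using that fg(3) by blast
        then show ?thesis by simp
      qed
      then show "f = g" using fg(1,2) by (meson PiE_ext)
    qed
  qed auto
  then show ?thesis
    using lesspoll_trans1 Pow_lesspoll_universe[OF Sigma_lesspoll_universe, of I X] I X by blast
qed

text \<open>A real number is determined by its Dedekind cut of rationals. The bound makes room for a
  copy of the unit interval over \<open>'u\<close>, the test object for Urysohn's lemma.\<close>

lemma real_lesspoll_universe: "(UNIV :: real set) \<prec> (UNIV :: 'u set)"
proof -
  have "inj (\<lambda>x :: real. {q :: rat. of_rat q < x})"
  proof (rule linorder_injI)
    fix x y :: real assume "x < y"
    then obtain q where "x < of_rat q" "of_rat q < y" using of_rat_dense by blast
    then show "{q. of_rat q < x} \<noteq> {q. of_rat q < y}" by (auto dest: less_asym)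
  qed
  then have "(UNIV :: real set) \<lesssim> Pow (UNIV :: rat set)" unfolding lepoll_def by auto
  moreover have "(UNIV :: rat set) \<lesssim> (UNIV :: nat set)"
    unfolding lepoll_def using countable_rat by (auto simp: countable_def)
  ultimately show ?thesis
    using lesspoll_trans1[OF _ Pow_lesspoll_universe] nat_lesspoll_universe
    by (meson lesspoll_trans1)
qed

end

section \<open>Uniform spaces\<close>

lemma entourage_UNIV: "unif_space X \<Longrightarrow> points X \<times> points X \<in> entourages X"
  by (simp add: unif_space_def)

lemma entourage_subset: "unif_space X \<Longrightarrow> E \<in> entourages X \<Longrightarrow> E \<subseteq> points X \<times> points X"
  by (simp add: unif_space_def)

lemma entourage_refl: "unif_space X \<Longrightarrow> E \<in> entourages X \<Longrightarrow> x \<in> points X \<Longrightarrow> (x, x) \<in> E"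
  unfolding unif_space_def by (elim conjE) (drule (1) bspec, auto)

lemma entourage_mono:
  assumes "unif_space X" "E \<in> entourages X" "E \<subseteq> F" "F \<subseteq> points X \<times> points X"
  shows "F \<in> entourages X"
proof -
  have "\<forall>E\<in>entourages X. \<forall>F. E \<subseteq> F \<and> F \<subseteq> points X \<times> points X \<longrightarrow> F \<in> entourages X"
    using assms(1) unfolding unif_space_def by (elim conjE)
  then show ?thesis using assms(2-4) by blast
qed

lemma entourage_Int:
  "unif_space X \<Longrightarrow> E \<in> entourages X \<Longrightarrow> F \<in> entourages X \<Longrightarrow> E \<inter> F \<in> entourages X"
  unfolding unif_space_def by (elim conjE) (drule (1) bspec)+

lemma entourage_converse: "unif_space X \<Longrightarrow> E \<in> entourages X \<Longrightarrow> E\<inverse> \<in> entourages X"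
  unfolding unif_space_def by (elim conjE) (drule (1) bspec)+

lemma entourage_half: "unif_space X \<Longrightarrow> E \<in> entourages X \<Longrightarrow> \<exists>F\<in>entourages X. F O F \<subseteq> E"
  unfolding unif_space_def by (elim conjE) (drule (1) bspec)+

lemma entourage_symmetric_half:
  assumes "unif_space X" "E \<in> entourages X"
  obtains F where "F \<in> entourages X" "F O F \<subseteq> E" "F\<inverse> \<subseteq> F"
proof -
  obtain G where G: "G \<in> entourages X" "G O G \<subseteq> E" using entourage_half[OF assms] by blast
  show thesis
  proof (rule that[of "G \<inter> G\<inverse>"])
    show "G \<inter> G\<inverse> \<in> entourages X"
      using assms(1) G(1) by (simp add: entourage_Int entourage_converse)
  qed (use G(2) in auto)
qed

lemma entourage_INT:
  assumes "unif_space X" "finite J" "\<And>j. j \<in> J \<Longrightarrow> F j \<in> entourages X"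
  shows "(points X \<times> points X) \<inter> (\<Inter>j\<in>J. F j) \<in> entourages X"
  using assms(2,3)
proof (induction J)
  case empty
  then show ?case using entourage_UNIV[OF assms(1)] by simp
next
  case (insert j J)
  then have "F j \<inter> ((points X \<times> points X) \<inter> (\<Inter>j\<in>J. F j)) \<in> entourages X"
    using entourage_Int[OF assms(1), of "F j"] by blast
  then show ?case by (simp add: Int_left_commute)
qed

section \<open>Uniformly continuous maps and isomorphisms\<close>

lemma umapsD:
  assumes "f \<in> umaps X Y"
  shows "f \<in> points X \<rightarrow>\<^sub>E points Y" "x \<in> points X \<Longrightarrow> f x \<in> points Y"
    "x \<notin> points X \<Longrightarrow> f x = undefined"
    "E \<in> entourages Y \<Longrightarrow> {(x, x') \<in> points X \<times> points X. (f x, f x') \<in> E} \<in> entourages X"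
  using assms unfolding umaps_def by auto

lemma umapsI:
  assumes "unif_space X" "f \<in> points X \<rightarrow>\<^sub>E points Y"
    "\<And>E. E \<in> entourages Y \<Longrightarrow>
      \<exists>D\<in>entourages X. \<forall>x\<in>points X. \<forall>x'\<in>points X. (x, x') \<in> D \<longrightarrow> (f x, f x') \<in> E"
  shows "f \<in> umaps X Y"
  unfolding umaps_def
proof (intro CollectI conjI assms(2) ballI)
  fix E assume "E \<in> entourages Y"
  from assms(3)[OF this] obtain D where
    D: "D \<in> entourages X" "\<forall>x\<in>points X. \<forall>x'\<in>points X. (x, x') \<in> D \<longrightarrow> (f x, f x') \<in> E" by blast
  show "{(x, x') \<in> points X \<times> points X. (f x, f x') \<in> E} \<in> entourages X"
    by (rule entourage_mono[OF assms(1) D(1)]) (use D(2) entourage_subset[OF assms(1) D(1)] in auto)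
qed

lemma umaps_compose:
  assumes "f \<in> umaps X Y" "g \<in> umaps Y Z"
  shows "compose (points X) g f \<in> umaps X Z"
  unfolding umaps_def
proof (intro CollectI conjI ballI)
  show "compose (points X) g f \<in> points X \<rightarrow>\<^sub>E points Z"
    using umapsD(2)[OF assms(1)] umapsD(2)[OF assms(2)] by (auto simp: compose_def)
  fix E assume "E \<in> entourages Z"
  then have "{(x, x') \<in> points X \<times> points X. (f x, f x') \<in>
      {(y, y') \<in> points Y \<times> points Y. (g y, g y') \<in> E}} \<in> entourages X"
    by (intro umapsD(4)[OF assms(1)] umapsD(4)[OF assms(2)])
  moreover have "{(x, x') \<in> points X \<times> points X. (f x, f x') \<in>
      {(y, y') \<in> points Y \<times> points Y. (g y, g y') \<in> E}} =
      {(x, x') \<in> points X \<times> points X. (compose (points X) g f x, compose (points X) g f x') \<in> E}"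
    using umapsD(2)[OF assms(1)] by (auto simp: compose_def)
  ultimately show "{(x, x') \<in> points X \<times> points X.
      (compose (points X) g f x, compose (points X) g f x') \<in> E} \<in> entourages X" by simp
qed

lemma umaps_id: "unif_space X \<Longrightarrow> (\<lambda>x\<in>points X. x) \<in> umaps X X"
  by (rule umapsI) auto

lemma umaps_const: "unif_space X \<Longrightarrow> unif_space Y \<Longrightarrow> y \<in> points Y \<Longrightarrow> (\<lambda>x\<in>points X. y) \<in> umaps X Y"
  by (rule umapsI) (auto intro!: bexI[OF _ entourage_UNIV] intro: entourage_refl)

lemma umaps_eqI:
  assumes "f \<in> umaps X Y" "g \<in> umaps X Z" "\<And>x. x \<in> points X \<Longrightarrow> f x = g x"
  shows "f = g"
proof
  fix x show "f x = g x"
    using assms(3)[of x] umapsD(3)[OF assms(1), of x] umapsD(3)[OF assms(2), of x]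
    by (cases "x \<in> points X") auto
qed

lemma uisoE:
  assumes "uiso X Y"
  obtains f g where "f \<in> umaps X Y" "g \<in> umaps Y X"
    "\<And>x. x \<in> points X \<Longrightarrow> g (f x) = x" "\<And>y. y \<in> points Y \<Longrightarrow> f (g y) = y"
  using assms unfolding uiso_def by blast

lemma uiso_sym: "uiso X Y \<Longrightarrow> uiso Y X"
  unfolding uiso_def by blast

section \<open>The induced topology\<close>

lemma topspace_utopology [simp]: "unif_space X \<Longrightarrow> topspace (utopology X) = points X"
proof (rule antisym)
  assume X: "unif_space X"
  show "topspace (utopology X) \<subseteq> points X"
    using openin_topspace[of "utopology X"] unfolding openin_utopology[OF X] by blast
  have "openin (utopology X) (points X)"
    unfolding openin_utopology[OF X] by (intro conjI ballI bexI[OF _ entourage_UNIV[OF X]]) auto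
  then show "points X \<subseteq> topspace (utopology X)" by (rule openin_subset)
qed

lemma open_nbhd_in_entourage:
  assumes X: "unif_space X" and "E \<in> entourages X" "x \<in> points X"
  obtains W where "openin (utopology X) W" "x \<in> W" "W \<subseteq> E `` {x}"
proof -
  define W where "W = {y \<in> points X. \<exists>D\<in>entourages X. D `` {y} \<subseteq> E `` {x}}"
  have "openin (utopology X) W"
    unfolding openin_utopology[OF X]
  proof (intro conjI ballI)
    fix y assume "y \<in> W"
    then obtain D where D: "D \<in> entourages X" "D `` {y} \<subseteq> E `` {x}" unfolding W_def by blast
    obtain F where F: "F \<in> entourages X" "F O F \<subseteq> D" using entourage_half[OF X D(1)] by blast
    have "F `` {y} \<subseteq> W"
      using F D entourage_subset[OF X F(1)] unfolding W_def by blast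
    then show "\<exists>E\<in>entourages X. E `` {y} \<subseteq> W" using F(1) by blast
  qed (auto simp: W_def)
  moreover have "x \<in> W" using assms unfolding W_def by blast
  moreover have "W \<subseteq> E `` {x}" using entourage_refl[OF X] unfolding W_def by blast
  ultimately show thesis using that by blast
qed

lemma umaps_imp_continuous:
  assumes X: "unif_space X" and Y: "unif_space Y" and f: "f \<in> umaps X Y"
  shows "continuous_map (utopology X) (utopology Y) f"
  unfolding continuous_map_def topspace_utopology[OF X] topspace_utopology[OF Y]
proof (intro conjI allI impI)
  fix W assume W: "openin (utopology Y) W"
  show "openin (utopology X) {x \<in> points X. f x \<in> W}"
    unfolding openin_utopology[OF X]
  proof (intro conjI ballI)
    fix x assume x: "x \<in> {x \<in> points X. f x \<in> W}"
    then obtain E where E: "E \<in> entourages Y" "E `` {f x} \<subseteq> W"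
      using W unfolding openin_utopology[OF Y] by blast
    show "\<exists>D\<in>entourages X. D `` {x} \<subseteq> {x \<in> points X. f x \<in> W}"
      by (rule bexI[OF _ umapsD(4)[OF f E(1)]]) (use E(2) in auto)
  qed auto
qed (use umapsD(2)[OF f] in auto)

text \<open>Heine-Cantor: each point \<open>x\<close> gets an entourage \<open>G x\<close> whose
  square is controlled by \<open>f\<close>, and finitely many neighbourhoods \<open>W t\<close>
  cover. If \<open>x\<close> lies in \<open>W t\<close> and \<open>x'\<close> is close to
  \<open>x\<close> in \<open>G t\<close>, then both are reached from \<open>t\<close> by
  \<open>G t O G t\<close>, so both values are \<open>F\<close>-close to \<open>f t\<close>.\<close>

lemma continuous_on_compact_imp_umaps:
  assumes X: "unif_space X" and Y: "unif_space Y" and comp: "compact_space (utopology X)"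
    and cont: "continuous_map (utopology X) (utopology Y) f" and ext: "f \<in> extensional (points X)"
  shows "f \<in> umaps X Y"
proof (rule umapsI[OF X])
  have fY: "f x \<in> points Y" if "x \<in> points X" for x
    using cont that X Y by (auto simp: continuous_map_def Pi_def)
  then show "f \<in> points X \<rightarrow>\<^sub>E points Y" using ext by (auto simp: PiE_def)
  fix E assume "E \<in> entourages Y"
  then obtain F where F: "F \<in> entourages Y" "F O F \<subseteq> E" "F\<inverse> \<subseteq> F"
    using entourage_symmetric_half[OF Y] by blast
  have "\<exists>G W. G \<in> entourages X \<and> openin (utopology X) W \<and> x \<in> W \<and> W \<subseteq> G `` {x} \<and>
      (\<forall>y. (x, y) \<in> G O G \<longrightarrow> (f x, f y) \<in> F)" if x: "x \<in> points X" for x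
  proof -
    obtain V where V: "openin (utopology Y) V" "f x \<in> V" "V \<subseteq> F `` {f x}"
      using open_nbhd_in_entourage[OF Y F(1) fY[OF x]] by blast
    have "openin (utopology X) {x \<in> points X. f x \<in> V}"
      using openin_continuous_map_preimage[OF cont V(1)] X by simp
    then obtain D where D: "D \<in> entourages X" "D `` {x} \<subseteq> {x \<in> points X. f x \<in> V}"
      using x V(2) unfolding openin_utopology[OF X] by blast
    obtain G where G: "G \<in> entourages X" "G O G \<subseteq> D" using entourage_half[OF X D(1)] by blast
    obtain W where W: "openin (utopology X) W" "x \<in> W" "W \<subseteq> G `` {x}"
      using open_nbhd_in_entourage[OF X G(1) x] by blast
    have "(f x, f y) \<in> F" if "(x, y) \<in> G O G" for y
      using that D(2) G(2) V(3) by blast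
    then show ?thesis using G(1) W by blast
  qed
  then obtain G W where GW: "\<And>x. x \<in> points X \<Longrightarrow> G x \<in> entourages X"
    "\<And>x. x \<in> points X \<Longrightarrow> openin (utopology X) (W x)" "\<And>x. x \<in> points X \<Longrightarrow> x \<in> W x"
    "\<And>x. x \<in> points X \<Longrightarrow> W x \<subseteq> G x `` {x}"
    "\<And>x y. x \<in> points X \<Longrightarrow> (x, y) \<in> G x O G x \<Longrightarrow> (f x, f y) \<in> F"
    by metis
  have "(\<forall>V\<in>W ` points X. openin (utopology X) V) \<and> points X \<subseteq> \<Union>(W ` points X)"
    by (intro conjI ballI subsetI) (use GW(2,3) in blast)+
  then have "\<exists>\<F>. finite \<F> \<and> \<F> \<subseteq> W ` points X \<and> points X \<subseteq> \<Union>\<F>"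
    using comp unfolding compact_space_alt topspace_utopology[OF X] 
    by (elim allE[of _ "W ` points X"] impE)
  then obtain \<F> where "finite \<F> \<and> \<F> \<subseteq> W ` points X \<and> points X \<subseteq> \<Union>\<F>" by (rule exE)
  then have \<F>: "finite \<F>" "\<F> \<subseteq> W ` points X" "points X \<subseteq> \<Union>\<F>" by simp_all
  obtain T where T: "T \<subseteq> points X" "finite T" "\<F> = W ` T"
    using finite_subset_image[OF \<F>(1,2)] by blast
  define D where "D = (points X \<times> points X) \<inter> (\<Inter>t\<in>T. G t)"
  have "D \<in> entourages X"
    unfolding D_def using T GW(1) by (intro entourage_INT[OF X]) auto
  moreover have "(f x, f x') \<in> E" if x: "x \<in> points X" "(x, x') \<in> D" for x x'
  proof -
    obtain t where t: "t \<in> T" "x \<in> W t" using T(3) \<F>(3) x(1) by blast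
    then have tx: "(t, x) \<in> G t" using GW(4) T(1) by blast
    moreover have "(x, x') \<in> G t" using x(2) t(1) unfolding D_def by blast
    moreover have "(t, t) \<in> G t" using t(1) T(1) GW(1) entourage_refl[OF X] by blast
    ultimately have "(f t, f x) \<in> F" "(f t, f x') \<in> F"
      using GW(5)[of t] t(1) T(1) by blast+
    then show ?thesis using F(2,3) by blast
  qed
  ultimately show "\<exists>D\<in>entourages X. \<forall>x\<in>points X. \<forall>x'\<in>points X. (x, x') \<in> D \<longrightarrow> (f x, f x') \<in> E"
    by blast
qed

lemma Hausdorff_utopology_iff:
  assumes X: "unif_space X"
  shows "Hausdorff_space (utopology X) \<longleftrightarrow>
    (\<forall>x\<in>points X. \<forall>y\<in>points X. x \<noteq> y \<longrightarrow> (\<exists>E\<in>entourages X. (x, y) \<notin> E))"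
proof
  assume H: "Hausdorff_space (utopology X)"
  show "\<forall>x\<in>points X. \<forall>y\<in>points X. x \<noteq> y \<longrightarrow> (\<exists>E\<in>entourages X. (x, y) \<notin> E)"
  proof (intro ballI impI)
    fix x y assume "x \<in> points X" "y \<in> points X" "x \<noteq> y"
    then obtain V W where "openin (utopology X) V" "x \<in> V" "y \<in> W" "disjnt V W"
      using H unfolding Hausdorff_space_def topspace_utopology[OF X] by blast
    then show "\<exists>E\<in>entourages X. (x, y) \<notin> E"
      unfolding openin_utopology[OF X] disjnt_def by blast
  qed
next
  assume sep: "\<forall>x\<in>points X. \<forall>y\<in>points X. x \<noteq> y \<longrightarrow> (\<exists>E\<in>entourages X. (x, y) \<notin> E)"
  show "Hausdorff_space (utopology X)"
    unfolding Hausdorff_space_def topspace_utopology[OF X]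
  proof (intro allI impI, elim conjE)
    fix x y assume xy: "x \<in> points X" "y \<in> points X" "x \<noteq> y"
    then obtain E where E: "E \<in> entourages X" "(x, y) \<notin> E" using sep by blast
    obtain F where F: "F \<in> entourages X" "F O F \<subseteq> E" "F\<inverse> \<subseteq> F"
      using entourage_symmetric_half[OF X E(1)] by blast
    obtain V where V: "openin (utopology X) V" "x \<in> V" "V \<subseteq> F `` {x}"
      using open_nbhd_in_entourage[OF X F(1) xy(1)] by blast
    obtain W where W: "openin (utopology X) W" "y \<in> W" "W \<subseteq> F `` {y}"
      using open_nbhd_in_entourage[OF X F(1) xy(2)] by blast
    have "disjnt V W" using V(3) W(3) F(2,3) E(2) unfolding disjnt_def by blast
    then show "\<exists>U V. openin (utopology X) U \<and> openin (utopology X) V \<and> x \<in> U \<and> y \<in> V \<and> disjnt U V"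
      using V W by blast
  qed
qed

section \<open>Subspaces\<close>

lemma points_usubspace [simp]: "points (usubspace X A) = A"
  by (simp add: usubspace_def)

lemma entourages_usubspace: "entourages (usubspace X A) = {E \<inter> (A \<times> A) | E. E \<in> entourages X}"
  by (simp add: usubspace_def)

lemma unif_space_usubspace:
  assumes X: "unif_space X" and A: "A \<subseteq> points X"
  shows "unif_space (usubspace X A)"
  unfolding unif_space_def points_usubspace
proof (intro conjI ballI allI impI)
  let ?E = "entourages (usubspace X A)"
  have "A \<times> A = (points X \<times> points X) \<inter> (A \<times> A)" using A by blast
  then show "A \<times> A \<in> ?E" using entourage_UNIV[OF X] unfolding entourages_usubspace by blast
  fix E assume "E \<in> ?E"
  then obtain E0 where E0: "E0 \<in> entourages X" "E = E0 \<inter> (A \<times> A)"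
    unfolding entourages_usubspace by blast
  show "Id_on A \<subseteq> E" using E0 entourage_refl[OF X] A by auto
  show "E \<subseteq> A \<times> A" using E0 by blast
  have "E\<inverse> = E0\<inverse> \<inter> (A \<times> A)" using E0(2) by blast
  then show "E\<inverse> \<in> ?E" using entourage_converse[OF X E0(1)] unfolding entourages_usubspace by blast
  show "\<exists>F\<in>?E. F O F \<subseteq> E"
  proof -
    obtain F where F: "F \<in> entourages X" "F O F \<subseteq> E0" using entourage_half[OF X E0(1)] by blast
    then have "F \<inter> (A \<times> A) \<in> ?E" unfolding entourages_usubspace by blast
    moreover have "(F \<inter> (A \<times> A)) O (F \<inter> (A \<times> A)) \<subseteq> E" using F(2) E0(2) by blast
    ultimately show ?thesis by blast
  qed
  fix F
  { assume "F \<in> ?E"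
    then obtain F0 where "F0 \<in> entourages X" "F = F0 \<inter> (A \<times> A)"
      unfolding entourages_usubspace by blast
    then have "E0 \<inter> F0 \<in> entourages X" "E \<inter> F = (E0 \<inter> F0) \<inter> (A \<times> A)"
      using E0 entourage_Int[OF X] by blast+
    then show "E \<inter> F \<in> ?E" unfolding entourages_usubspace by blast }
  { assume F: "E \<subseteq> F \<and> F \<subseteq> A \<times> A"
    then have "E0 \<union> F \<in> entourages X"
      using A entourage_subset[OF X E0(1)] by (intro entourage_mono[OF X E0(1)]) auto
    moreover have "F = (E0 \<union> F) \<inter> (A \<times> A)" using F E0(2) by blast
    ultimately show "F \<in> ?E" unfolding entourages_usubspace by blast }
qed

lemma utopology_usubspace:
  assumes X: "unif_space X" and A: "A \<subseteq> points X"
  shows "utopology (usubspace X A) = subtopology (utopology X) A"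
proof (rule topology_eq[THEN iffD2], intro allI iffI)
  note XA = unif_space_usubspace[OF X A]
  fix V
  { assume V: "openin (utopology (usubspace X A)) V"
    have "\<exists>W. openin (utopology X) W \<and> x \<in> W \<and> W \<inter> A \<subseteq> V" if x: "x \<in> V" for x
    proof -
      from V x obtain E where E: "E \<in> entourages X" "(E \<inter> (A \<times> A)) `` {x} \<subseteq> V" "x \<in> A"
        unfolding openin_utopology[OF XA] entourages_usubspace points_usubspace by blast
      obtain W where "openin (utopology X) W" "x \<in> W" "W \<subseteq> E `` {x}"
        using open_nbhd_in_entourage[OF X E(1), of x] E(3) A by blast
      then show ?thesis using E by blast
    qed
    then obtain W where W: "\<And>x. x \<in> V \<Longrightarrow> openin (utopology X) (W x)" "\<And>x. x \<in> V \<Longrightarrow> x \<in> W x"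
      "\<And>x. x \<in> V \<Longrightarrow> W x \<inter> A \<subseteq> V" by metis
    have "V \<subseteq> A" using openin_subset[OF V] XA by simp
    then have "V = (\<Union>x\<in>V. W x) \<inter> A" using W(2,3) by blast
    moreover have "openin (utopology X) (\<Union>x\<in>V. W x)" using W(1) by blast
    ultimately show "openin (subtopology (utopology X) A) V" unfolding openin_subtopology by blast }
  { assume "openin (subtopology (utopology X) A) V"
    then obtain W where W: "openin (utopology X) W" "V = W \<inter> A" unfolding openin_subtopology by blast
    show "openin (utopology (usubspace X A)) V"
      unfolding openin_utopology[OF XA]
    proof (intro conjI ballI)
      fix x assume "x \<in> V"
      then obtain E where E: "E \<in> entourages X" "E `` {x} \<subseteq> W"
        using W unfolding openin_utopology[OF X] by blast
      have "E \<inter> (A \<times> A) \<in> entourages (usubspace X A)"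
        using E(1) unfolding entourages_usubspace by blast
      moreover have "(E \<inter> (A \<times> A)) `` {x} \<subseteq> V" using E(2) W(2) by blast
      ultimately show "\<exists>E\<in>entourages (usubspace X A). E `` {x} \<subseteq> V" by blast
    qed (use W(2) in auto) }
qed

lemma umaps_usubspace_incl:
  assumes X: "unif_space X" and A: "A \<subseteq> points X"
  shows "(\<lambda>x\<in>A. x) \<in> umaps (usubspace X A) X"
proof (rule umapsI[OF unif_space_usubspace[OF X A]])
  fix E assume "E \<in> entourages X"
  then have "E \<inter> (A \<times> A) \<in> entourages (usubspace X A)" unfolding entourages_usubspace by blast
  then show "\<exists>D\<in>entourages (usubspace X A). \<forall>x\<in>points (usubspace X A). \<forall>x'\<in>points (usubspace X A).
     (x, x') \<in> D \<longrightarrow> ((\<lambda>x\<in>A. x) x, (\<lambda>x\<in>A. x) x') \<in> E"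
    by (rule bexI[rotated]) simp
qed (use A in auto)

lemma umaps_restrict:
  assumes X: "unif_space X" and A: "A \<subseteq> points X" and f: "f \<in> umaps X Y"
  shows "restrict f A \<in> umaps (usubspace X A) Y"
proof -
  have "compose A f (\<lambda>x\<in>A. x) = restrict f A" by (auto simp: compose_def)
  then show ?thesis using umaps_compose[OF umaps_usubspace_incl[OF X A] f] by simp
qed

lemma umaps_usubspace_codomain:
  assumes X: "unif_space X" and A: "A \<subseteq> points X" and f: "f \<in> umaps Z X" "f ` points Z \<subseteq> A"
  shows "f \<in> umaps Z (usubspace X A)"
  unfolding umaps_def
proof (intro CollectI conjI ballI)
  show "f \<in> points Z \<rightarrow>\<^sub>E points (usubspace X A)" using umapsD(1)[OF f(1)] f(2) by auto
  fix E assume "E \<in> entourages (usubspace X A)"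
  then obtain D where D: "D \<in> entourages X" "E = D \<inter> (A \<times> A)" unfolding entourages_usubspace by blast
  have "{(x, x') \<in> points Z \<times> points Z. (f x, f x') \<in> E} =
      {(x, x') \<in> points Z \<times> points Z. (f x, f x') \<in> D}" using D(2) f(2) by auto
  then show "{(x, x') \<in> points Z \<times> points Z. (f x, f x') \<in> E} \<in> entourages Z"
    using umapsD(4)[OF f(1) D(1)] by simp
qed

lemma umaps_eq_on_closure:
  assumes X: "unif_space X" and Y: "unif_space Y" "Hausdorff_space (utopology Y)"
    and f: "f \<in> umaps X Y" "g \<in> umaps X Y"
    and dense: "utopology X closure_of S = points X" and eq: "\<And>x. x \<in> S \<Longrightarrow> f x = g x"
  shows "f = g"
proof (rule umaps_eqI[OF f])
  fix x assume "x \<in> points X"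
  then have "x \<in> utopology X closure_of S" using dense by simp
  then show "f x = g x"
    using Y(2) umaps_imp_continuous[OF X Y(1) f(1)] umaps_imp_continuous[OF X Y(1) f(2)] eq
    by (rule forall_in_closure_of_eq)
qed

text \<open>A continuous surjection from a compact space to a Hausdorff space is a quotient map, so
  \<open>k\<close> is continuous; its domain is compact as an image, and Heine-Cantor upgrades
  continuity to uniform continuity. This is what makes surjections of compact Hausdorff spaces
  regular epimorphisms.\<close>

lemma umaps_factor_compact_surj:
  assumes X: "unif_space X" "compact_space (utopology X)"
    and Y: "unif_space Y" "Hausdorff_space (utopology Y)" and Z: "unif_space Z"
    and p: "p \<in> umaps X Y" "p ` points X = points Y"
    and k: "k \<in> extensional (points Y)" "compose (points X) k p \<in> umaps X Z"
  shows "k \<in> umaps Y Z"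
proof (rule continuous_on_compact_imp_umaps[OF Y(1) Z _ _ k(1)])
  note cp = umaps_imp_continuous[OF X(1) Y(1) p(1)]
  have q: "quotient_map (utopology X) (utopology Y) p"
    using continuous_imp_quotient_map[OF cp X(2) Y(2)] p(2) X(1) Y(1) by simp
  have "continuous_map (utopology X) (utopology Z) (k \<circ> p)"
    using continuous_map_eq[OF umaps_imp_continuous[OF X(1) Z k(2)], of "k \<circ> p"] X(1)
    by (simp add: compose_def)
  then show "continuous_map (utopology Y) (utopology Z) k"
    using continuous_compose_quotient_map_eq[OF q] by blast
  have "compactin (utopology Y) (p ` topspace (utopology X))"
    using image_compactin[OF _ cp] X(2) unfolding compact_space_def by blast
  then show "compact_space (utopology Y)"
    using p(2) X(1) Y(1) unfolding compact_space_def by simp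
qed

lemma utopology_homeomorphic:
  assumes "unif_space X" "unif_space Y" "uiso X Y"
  shows "utopology X homeomorphic_space utopology Y"
proof -
  obtain f g where fg: "f \<in> umaps X Y" "g \<in> umaps Y X"
    "\<And>x. x \<in> points X \<Longrightarrow> g (f x) = x" "\<And>y. y \<in> points Y \<Longrightarrow> f (g y) = y"
    using uisoE[OF assms(3)] by blast
  then show ?thesis
    using umaps_imp_continuous[OF assms(1,2) fg(1)] umaps_imp_continuous[OF assms(2,1) fg(2)] assms(1,2)
    unfolding homeomorphic_space_def homeomorphic_maps_def by auto
qed

section \<open>Initial structures and products\<close>

text \<open>The second clause says that the preimages of entourages generate the uniformity of
  \<open>P\<close>; the opposite inclusion is the uniform continuity in the first clause. Source and
  targets may live over different types.\<close>

definition initial_source ::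
    "'i set \<Rightarrow> ('i \<Rightarrow> 'b ustruct) \<Rightarrow> 'a ustruct \<Rightarrow> ('i \<Rightarrow> 'a \<Rightarrow> 'b) \<Rightarrow> bool" where
  "initial_source I X P \<pi> \<longleftrightarrow>
     (\<forall>i\<in>I. \<pi> i \<in> umaps P (X i)) \<and>
     (\<forall>E\<in>entourages P. \<exists>J F. finite J \<and> J \<subseteq> I \<and> (\<forall>j\<in>J. F j \<in> entourages (X j)) \<and>
        {(p, q) \<in> points P \<times> points P. \<forall>j\<in>J. (\<pi> j p, \<pi> j q) \<in> F j} \<subseteq> E)"

text \<open>One construction for two purposes: with coordinate projections it is the product, and
  with a single injective map it transports a structure to another carrier.\<close>

definition initial_structure ::
    "'a set \<Rightarrow> 'i set \<Rightarrow> ('i \<Rightarrow> 'b ustruct) \<Rightarrow> ('i \<Rightarrow> 'a \<Rightarrow> 'b) \<Rightarrow> 'a ustruct" where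
  "initial_structure S I X \<pi> =
     \<lparr>points = S,
      entourages = {E. E \<subseteq> S \<times> S \<and>
        (\<exists>J F. finite J \<and> J \<subseteq> I \<and> (\<forall>j\<in>J. F j \<in> entourages (X j)) \<and>
           {(p, q) \<in> S \<times> S. \<forall>j\<in>J. (\<pi> j p, \<pi> j q) \<in> F j} \<subseteq> E)}\<rparr>"

lemma points_initial_structure [simp]: "points (initial_structure S I X \<pi>) = S"
  by (simp add: initial_structure_def)

lemma entourages_initial_structure:
  "E \<in> entourages (initial_structure S I X \<pi>) \<longleftrightarrow> E \<subseteq> S \<times> S \<and>
     (\<exists>J F. finite J \<and> J \<subseteq> I \<and> (\<forall>j\<in>J. F j \<in> entourages (X j)) \<and>
        {(p, q) \<in> S \<times> S. \<forall>j\<in>J. (\<pi> j p, \<pi> j q) \<in> F j} \<subseteq> E)"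
  by (simp add: initial_structure_def)

lemma initial_structure_basic:
  assumes "E \<subseteq> S \<times> S" "finite J" "J \<subseteq> I" "\<And>j. j \<in> J \<Longrightarrow> F j \<in> entourages (X j)"
    "\<And>p q. p \<in> S \<Longrightarrow> q \<in> S \<Longrightarrow> (\<And>j. j \<in> J \<Longrightarrow> (\<pi> j p, \<pi> j q) \<in> F j) \<Longrightarrow> (p, q) \<in> E"
  shows "E \<in> entourages (initial_structure S I X \<pi>)"
  unfolding entourages_initial_structure
  using assms by (intro conjI exI[of _ J] exI[of _ F]) auto

lemma initial_structure_basicE:
  assumes "E \<in> entourages (initial_structure S I X \<pi>)"
  obtains J F where "finite J" "J \<subseteq> I" "\<And>j. j \<in> J \<Longrightarrow> F j \<in> entourages (X j)"
    "\<And>p q. p \<in> S \<Longrightarrow> q \<in> S \<Longrightarrow> (\<And>j. j \<in> J \<Longrightarrow> (\<pi> j p, \<pi> j q) \<in> F j) \<Longrightarrow> (p, q) \<in> E"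
  using assms unfolding entourages_initial_structure
proof (elim conjE exE)
  fix J F
  assume "finite J" "J \<subseteq> I" "\<forall>j\<in>J. F j \<in> entourages (X j)"
    "{(p, q) \<in> S \<times> S. \<forall>j\<in>J. (\<pi> j p, \<pi> j q) \<in> F j} \<subseteq> E"
  then show thesis by (intro that[of J F]) auto
qed

lemma unif_space_initial_structure:
  assumes X: "\<And>i. i \<in> I \<Longrightarrow> unif_space (X i)" and \<pi>: "\<And>i. i \<in> I \<Longrightarrow> \<pi> i \<in> S \<rightarrow> points (X i)"
  shows "unif_space (initial_structure S I X \<pi>)"
  unfolding unif_space_def points_initial_structure
proof (intro conjI ballI allI impI)
  let ?E = "entourages (initial_structure S I X \<pi>)"
  show "S \<times> S \<in> ?E" by (rule initial_structure_basic[where J = "{}"]) auto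
  fix E assume E: "E \<in> ?E"
  then show ES: "E \<subseteq> S \<times> S" by (simp add: entourages_initial_structure)
  obtain J F where JF: "finite J" "J \<subseteq> I" "\<And>j. j \<in> J \<Longrightarrow> F j \<in> entourages (X j)"
    "\<And>p q. p \<in> S \<Longrightarrow> q \<in> S \<Longrightarrow> (\<And>j. j \<in> J \<Longrightarrow> (\<pi> j p, \<pi> j q) \<in> F j) \<Longrightarrow> (p, q) \<in> E"
    using initial_structure_basicE[OF E] by blast
  have \<pi>J: "\<pi> j p \<in> points (X j)" if "j \<in> J" "p \<in> S" for j p using \<pi> JF(2) that by blast
  have XJ: "unif_space (X j)" if "j \<in> J" for j using X JF(2) that by blast
  show "Id_on S \<subseteq> E"
    using JF(4) entourage_refl[OF XJ JF(3) \<pi>J] by (auto simp: Id_on_def)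
  show "E\<inverse> \<in> ?E"
  proof (rule initial_structure_basic[where J = J and F = "\<lambda>j. (F j)\<inverse>"])
    show "(F j)\<inverse> \<in> entourages (X j)" if "j \<in> J" for j
      using entourage_converse[OF XJ JF(3)] that by blast
  qed (use ES JF in auto)
  show "\<exists>F\<in>?E. F O F \<subseteq> E"
  proof -
    have "\<exists>G. G \<in> entourages (X j) \<and> G O G \<subseteq> F j" if "j \<in> J" for j
      using entourage_half[OF XJ JF(3)] that by blast
    then obtain G where G: "\<And>j. j \<in> J \<Longrightarrow> G j \<in> entourages (X j)" "\<And>j. j \<in> J \<Longrightarrow> G j O G j \<subseteq> F j"
      by metis
    let ?D = "{(p, q) \<in> S \<times> S. \<forall>j\<in>J. (\<pi> j p, \<pi> j q) \<in> G j}"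
    have "?D \<in> ?E"
      by (rule initial_structure_basic[where J = J and F = G]) (use JF G in auto)
    moreover have "?D O ?D \<subseteq> E"
    proof clarify
      fix p q r assume "p \<in> S" "q \<in> S" "r \<in> S"
        "\<forall>j\<in>J. (\<pi> j p, \<pi> j q) \<in> G j" "\<forall>j\<in>J. (\<pi> j q, \<pi> j r) \<in> G j"
      then show "(p, r) \<in> E" using G(2) by (intro JF(4)) blast+
    qed
    ultimately show ?thesis by blast
  qed
  fix F'
  { assume F': "E \<subseteq> F' \<and> F' \<subseteq> S \<times> S"
    show "F' \<in> ?E"
      by (rule initial_structure_basic[where J = J and F = F]) (use F' JF in auto) }
  { assume F': "F' \<in> ?E"
    obtain K G where KG: "finite K" "K \<subseteq> I" "\<And>j. j \<in> K \<Longrightarrow> G j \<in> entourages (X j)"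
      "\<And>p q. p \<in> S \<Longrightarrow> q \<in> S \<Longrightarrow> (\<And>j. j \<in> K \<Longrightarrow> (\<pi> j p, \<pi> j q) \<in> G j) \<Longrightarrow> (p, q) \<in> F'"
      using initial_structure_basicE[OF F'] by blast
    \<comment> \<open>The two basic entourages constrain different finite index sets. On their union
      each is padded with the full entourage, so that one family describes the intersection.\<close>
    let ?H = "\<lambda>j. (if j \<in> J then F j else points (X j) \<times> points (X j)) \<inter>
      (if j \<in> K then G j else points (X j) \<times> points (X j))"
    show "E \<inter> F' \<in> ?E"
    proof (rule initial_structure_basic[where J = "J \<union> K" and F = ?H])
      fix j assume j: "j \<in> J \<union> K"
      then have "unif_space (X j)" using X JF(2) KG(2) by blast
      then show "?H j \<in> entourages (X j)"
        using JF(3) KG(3) entourage_UNIV by (intro entourage_Int) auto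
    next
      fix p q assume pq: "p \<in> S" "q \<in> S" "\<And>j. j \<in> J \<union> K \<Longrightarrow> (\<pi> j p, \<pi> j q) \<in> ?H j"
      have "(p, q) \<in> E"
        by (rule JF(4)[OF pq(1,2)]) (use pq(3) in \<open>force split: if_splits\<close>)
      moreover have "(p, q) \<in> F'"
        by (rule KG(4)[OF pq(1,2)]) (use pq(3) in \<open>force split: if_splits\<close>)
      ultimately show "(p, q) \<in> E \<inter> F'" by blast
    qed (use ES JF KG in auto) }
qed

lemma initial_source_initial_structure:
  assumes X: "\<And>i. i \<in> I \<Longrightarrow> unif_space (X i)" and \<pi>: "\<And>i. i \<in> I \<Longrightarrow> \<pi> i \<in> S \<rightarrow> points (X i)"
  shows "initial_source I X (initial_structure S I X \<pi>) (\<lambda>i. restrict (\<pi> i) S)"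
  unfolding initial_source_def
proof (intro conjI ballI)
  fix i assume i: "i \<in> I"
  show "restrict (\<pi> i) S \<in> umaps (initial_structure S I X \<pi>) (X i)"
    unfolding umaps_def points_initial_structure
  proof (intro CollectI conjI ballI)
    show "restrict (\<pi> i) S \<in> S \<rightarrow>\<^sub>E points (X i)" using \<pi>[OF i] by auto
    fix E assume "E \<in> entourages (X i)"
    then show "{(x, x') \<in> S \<times> S. (restrict (\<pi> i) S x, restrict (\<pi> i) S x') \<in> E}
        \<in> entourages (initial_structure S I X \<pi>)"
      using i by (intro initial_structure_basic[where J = "{i}" and F = "\<lambda>_. E"]) auto
  qed
next
  fix E assume E: "E \<in> entourages (initial_structure S I X \<pi>)"
  obtain J F where JF: "finite J" "J \<subseteq> I" "\<And>j. j \<in> J \<Longrightarrow> F j \<in> entourages (X j)"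
    "\<And>p q. p \<in> S \<Longrightarrow> q \<in> S \<Longrightarrow> (\<And>j. j \<in> J \<Longrightarrow> (\<pi> j p, \<pi> j q) \<in> F j) \<Longrightarrow> (p, q) \<in> E"
    using initial_structure_basicE[OF E] by blast
  show "\<exists>J F. finite J \<and> J \<subseteq> I \<and> (\<forall>j\<in>J. F j \<in> entourages (X j)) \<and>
      {(p, q) \<in> points (initial_structure S I X \<pi>) \<times> points (initial_structure S I X \<pi>).
        \<forall>j\<in>J. (restrict (\<pi> j) S p, restrict (\<pi> j) S q) \<in> F j} \<subseteq> E"
    using JF by (intro exI[of _ J] exI[of _ F]) auto
qed

lemma umaps_into_initial_source:
  assumes Z: "unif_space Z" and P: "initial_source I X P \<pi>"
    and f: "f \<in> points Z \<rightarrow>\<^sub>E points P"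
    and comp: "\<And>i. i \<in> I \<Longrightarrow> compose (points Z) (\<pi> i) f \<in> umaps Z (X i)"
  shows "f \<in> umaps Z P"
proof (rule umapsI[OF Z f])
  fix E assume "E \<in> entourages P"
  then obtain J F where JF: "finite J" "J \<subseteq> I" "\<forall>j\<in>J. F j \<in> entourages (X j)"
    "{(p, q) \<in> points P \<times> points P. \<forall>j\<in>J. (\<pi> j p, \<pi> j q) \<in> F j} \<subseteq> E"
    using P unfolding initial_source_def by blast
  define D where "D j = {(z, z') \<in> points Z \<times> points Z. (compose (points Z) (\<pi> j) f z,
      compose (points Z) (\<pi> j) f z') \<in> F j}" for j
  have "(points Z \<times> points Z) \<inter> (\<Inter>j\<in>J. D j) \<in> entourages Z"
  proof (rule entourage_INT[OF Z JF(1)])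
    fix j assume "j \<in> J"
    then show "D j \<in> entourages Z"
      unfolding D_def using comp JF(2,3) by (intro umapsD(4)) auto
  qed
  moreover have "(f z, f z') \<in> E"
    if z: "z \<in> points Z" "z' \<in> points Z" "(z, z') \<in> (points Z \<times> points Z) \<inter> (\<Inter>j\<in>J. D j)" for z z'
  proof -
    have "\<forall>j\<in>J. (\<pi> j (f z), \<pi> j (f z')) \<in> F j"
      using z unfolding D_def by (auto simp: compose_def)
    moreover have "f z \<in> points P" "f z' \<in> points P" using f z(1,2) by auto
    ultimately show ?thesis using JF(4) by blast
  qed
  ultimately show "\<exists>D\<in>entourages Z. \<forall>z\<in>points Z. \<forall>z'\<in>points Z. (z, z') \<in> D \<longrightarrow> (f z, f z') \<in> E"
    by blast
qed

text \<open>The universal cone of a product with its carrier left open, so that the vertex can be a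
  space over \<open>'u\<close>. The second clause identifies the points of \<open>P\<close> with the
  tuples; only the values of \<open>x\<close> on \<open>I\<close> matter.\<close>

definition product_cone ::
    "'i set \<Rightarrow> ('i \<Rightarrow> 'b ustruct) \<Rightarrow> 'a ustruct \<Rightarrow> ('i \<Rightarrow> 'a \<Rightarrow> 'b) \<Rightarrow> bool" where
  "product_cone I X P \<pi> \<longleftrightarrow> initial_source I X P \<pi> \<and>
     (\<forall>x. (\<forall>i\<in>I. x i \<in> points (X i)) \<longrightarrow> (\<exists>!p. p \<in> points P \<and> (\<forall>i\<in>I. \<pi> i p = x i)))"

lemma product_cone_proj:
  "product_cone I X P \<pi> \<Longrightarrow> i \<in> I \<Longrightarrow> \<pi> i \<in> umaps P (X i)"
  unfolding product_cone_def initial_source_def by blast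

lemma product_cone_ex1:
  "product_cone I X P \<pi> \<Longrightarrow> \<forall>i\<in>I. x i \<in> points (X i) \<Longrightarrow>
    \<exists>!p. p \<in> points P \<and> (\<forall>i\<in>I. \<pi> i p = x i)"
  unfolding product_cone_def by simp

lemma product_cone_point:
  assumes "product_cone I X P \<pi>" "\<And>i. i \<in> I \<Longrightarrow> x i \<in> points (X i)"
  obtains p where "p \<in> points P" "\<And>i. i \<in> I \<Longrightarrow> \<pi> i p = x i"
  using product_cone_ex1[OF assms(1), of x] assms(2) by blast

lemma product_cone_eqI:
  assumes P: "product_cone I X P \<pi>" and "p \<in> points P" "q \<in> points P"
    and "\<And>i. i \<in> I \<Longrightarrow> \<pi> i p = \<pi> i q"
  shows "p = q"
proof -
  have "\<forall>i\<in>I. \<pi> i q \<in> points (X i)" 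
    using umapsD(2)[OF product_cone_proj[OF P] assms(3)] by blast
  then have "\<exists>!p. p \<in> points P \<and> (\<forall>i\<in>I. \<pi> i p = \<pi> i q)"
    using product_cone_ex1[OF P, of "\<lambda>i. \<pi> i q"] by simp
  then show ?thesis using assms(2-4) by blast
qed

lemma product_cone_tuple:
  assumes P: "product_cone I X P \<pi>" and Z: "unif_space Z"
    and g: "\<And>i. i \<in> I \<Longrightarrow> g i \<in> umaps Z (X i)"
  obtains f where "f \<in> umaps Z P" "\<And>i z. i \<in> I \<Longrightarrow> z \<in> points Z \<Longrightarrow> \<pi> i (f z) = g i z"
proof -
  have "\<exists>p. p \<in> points P \<and> (\<forall>i\<in>I. \<pi> i p = g i z)" if z: "z \<in> points Z" for z
  proof -
    obtain p where "p \<in> points P" "\<And>i. i \<in> I \<Longrightarrow> \<pi> i p = g i z"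
      using product_cone_point[OF P, of "\<lambda>i. g i z"] umapsD(2)[OF g z] by blast
    then show ?thesis by blast
  qed
  then obtain f0 where f0: "\<And>z. z \<in> points Z \<Longrightarrow> f0 z \<in> points P"
    "\<And>z i. z \<in> points Z \<Longrightarrow> i \<in> I \<Longrightarrow> \<pi> i (f0 z) = g i z" by metis
  let ?f = "restrict f0 (points Z)"
  have "?f \<in> umaps Z P"
  proof (rule umaps_into_initial_source[OF Z])
    show "initial_source I X P \<pi>" using P unfolding product_cone_def by blast
    fix i assume i: "i \<in> I"
    have "compose (points Z) (\<pi> i) ?f = g i"
      using f0(2)[OF _ i] umapsD(3)[OF g[OF i]] by (auto simp: compose_def)
    then show "compose (points Z) (\<pi> i) ?f \<in> umaps Z (X i)" using g[OF i] by simp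
  qed (use f0 in auto)
  then show thesis using that[of ?f] f0(2) by simp
qed

lemma uproduct_eq_initial_structure:
  "uproduct I X = initial_structure (\<Pi>\<^sub>E i\<in>I. points (X i)) I X (\<lambda>i p. p i)"
  by (simp add: uproduct_def initial_structure_def Let_def)

lemma unif_space_uproduct:
  "(\<And>i. i \<in> I \<Longrightarrow> unif_space (X i)) \<Longrightarrow> unif_space (uproduct I X)"
  unfolding uproduct_eq_initial_structure by (rule unif_space_initial_structure) auto

text \<open>The cone consists of the coordinate projections composed with the isomorphism from
  \<open>P\<close> to the literal product.\<close>

lemma product_cone_if_uiso_uproduct:
  assumes X: "\<And>i. i \<in> I \<Longrightarrow> unif_space (X i)" and P: "unif_space P" "uiso (uproduct I X) P"
  obtains \<pi> where "product_cone I X P \<pi>"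
proof -
  let ?S = "\<Pi>\<^sub>E i\<in>I. points (X i)"
  have src: "initial_source I X (uproduct I X) (\<lambda>i. \<lambda>p\<in>?S. p i)"
    unfolding uproduct_eq_initial_structure
    using initial_source_initial_structure[of I X "\<lambda>i p. p i" ?S] X by auto
  have pts [simp]: "points (uproduct I X) = ?S" by (simp add: uproduct_eq_initial_structure)
  obtain f g where fg: "f \<in> umaps (uproduct I X) P" "g \<in> umaps P (uproduct I X)"
    "\<And>x. x \<in> ?S \<Longrightarrow> g (f x) = x" "\<And>y. y \<in> points P \<Longrightarrow> f (g y) = y"
    using uisoE[OF P(2)] pts by metis
  have gS: "g p \<in> ?S" if "p \<in> points P" for p using umapsD(2)[OF fg(2) that] by simp
  have fS: "f x \<in> points P" if "x \<in> ?S" for x using umapsD(2)[OF fg(1)] that by simp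
  define \<pi> where "\<pi> i = compose (points P) (\<lambda>p\<in>?S. p i) g" for i
  have \<pi>: "\<pi> i p = g p i" if "p \<in> points P" for i p
    using gS[OF that] that by (simp add: \<pi>_def compose_def)
  have "product_cone I X P \<pi>"
    unfolding product_cone_def initial_source_def
  proof (intro conjI ballI allI impI)
    show "\<pi> i \<in> umaps P (X i)" if "i \<in> I" for i
      unfolding \<pi>_def using src that fg(2) by (auto simp: initial_source_def intro: umaps_compose)
  next
    fix E assume E: "E \<in> entourages P"
    define D where "D = {(x, x') \<in> ?S \<times> ?S. (f x, f x') \<in> E}"
    have "D \<in> entourages (initial_structure ?S I X (\<lambda>i p. p i))"
      using umapsD(4)[OF fg(1) E] unfolding D_def by (simp add: uproduct_eq_initial_structure)
    then obtain J F where JF: "finite J" "J \<subseteq> I" "\<forall>j\<in>J. F j \<in> entourages (X j)"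
      "{(p, q) \<in> ?S \<times> ?S. \<forall>j\<in>J. (p j, q j) \<in> F j} \<subseteq> D"
      unfolding entourages_initial_structure by (elim conjE exE)
    have "(p, q) \<in> E" if pq: "p \<in> points P" "q \<in> points P" "\<forall>j\<in>J. (\<pi> j p, \<pi> j q) \<in> F j" for p q
    proof -
      have "(g p, g q) \<in> D"
        using gS[OF pq(1)] gS[OF pq(2)] pq by (intro subsetD[OF JF(4)]) (simp add: \<pi>)
      then show ?thesis using fg(4) pq(1,2) unfolding D_def by simp
    qed
    then show "\<exists>J F. finite J \<and> J \<subseteq> I \<and> (\<forall>j\<in>J. F j \<in> entourages (X j)) \<and>
        {(p, q) \<in> points P \<times> points P. \<forall>j\<in>J. (\<pi> j p, \<pi> j q) \<in> F j} \<subseteq> E"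
      using JF(1-3) by (intro exI[of _ J] exI[of _ F]) auto
  next
    fix x assume "\<forall>i\<in>I. x i \<in> points (X i)"
    then have x: "restrict x I \<in> ?S" by auto
    show "\<exists>!p. p \<in> points P \<and> (\<forall>i\<in>I. \<pi> i p = x i)"
    proof (rule ex1I[of _ "f (restrict x I)"])
      show "f (restrict x I) \<in> points P \<and> (\<forall>i\<in>I. \<pi> i (f (restrict x I)) = x i)"
        using fS[OF x] fg(3)[OF x] \<pi> by simp
      fix p assume p: "p \<in> points P \<and> (\<forall>i\<in>I. \<pi> i p = x i)"
      have "g p = restrict x I"
        by (rule PiE_ext[OF gS x]) (use p \<pi> in auto)
      then show "p = f (restrict x I)" using fg(4) p by metis
    qed
  qed
  then show thesis by (rule that)
qed

lemma ustruct_copy: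
  assumes X: "unif_space X" and f: "inj_on f (points X)"
  obtains Y g where "unif_space Y" "points Y = f ` points X"
    "restrict f (points X) \<in> umaps X Y" "g \<in> umaps Y X"
    "\<And>x. x \<in> points X \<Longrightarrow> g (f x) = x" "\<And>y. y \<in> points Y \<Longrightarrow> f (g y) = y" "uiso X Y"
proof -
  let ?g = "inv_into (points X) f" and ?S = "f ` points X"
  \<comment> \<open>The structure is initial for the single map \<open>?g\<close>, the inverse of
    \<open>f\<close>, which makes \<open>?g\<close> and \<open>f\<close> mutually inverse
    isomorphisms.\<close>
  let ?Y = "initial_structure ?S {()} (\<lambda>_. X) (\<lambda>_. ?g)"
  have gS: "?g \<in> ?S \<rightarrow> points X" by (auto intro: inv_into_into)
  have gf: "?g (f x) = x" if "x \<in> points X" for x using f that by simp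
  have src: "initial_source {()} (\<lambda>_. X) ?Y (\<lambda>_. restrict ?g ?S)"
    by (rule initial_source_initial_structure) (use X gS in auto)
  have Y: "unif_space ?Y" by (rule unif_space_initial_structure) (use X gS in auto)
  have g: "restrict ?g ?S \<in> umaps ?Y X" using src unfolding initial_source_def by simp
  have fm: "restrict f (points X) \<in> umaps X ?Y"
  proof (rule umaps_into_initial_source[OF X src])
    have "compose (points X) (restrict ?g ?S) (restrict f (points X)) = (\<lambda>x\<in>points X. x)"
      using gf by (auto simp: compose_def fun_eq_iff)
    then show "compose (points X) (restrict ?g ?S) (restrict f (points X)) \<in> umaps X X"
      using umaps_id[OF X] by simp
  qed auto
  have "uiso X ?Y"
    unfolding uiso_def
    by (intro bexI[OF _ fm] bexI[OF _ g]) (auto simp: gf f_inv_into_f inv_into_into)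
  then show thesis
    by (rule that[OF Y _ fm g, rotated -1]) (auto simp: gf f_inv_into_f)
qed

text \<open>Lets a product indexed by a copy in \<open>'u\<close> serve for the original index
  set.\<close>

lemma product_cone_reindex:
  assumes h: "bij_betw h I K" and P: "product_cone K X P \<pi>"
  shows "product_cone I (\<lambda>i. X (h i)) P (\<lambda>i. \<pi> (h i))"
  unfolding product_cone_def initial_source_def
proof (intro conjI ballI allI impI)
  have hI: "h i \<in> K" if "i \<in> I" for i using h that by (auto simp: bij_betw_def)
  let ?k = "inv_into I h"
  have kh: "?k (h i) = i" if "i \<in> I" for i using h that by (auto simp: bij_betw_def)
  have hk: "h (?k j) = j" "?k j \<in> I" if "j \<in> K" for j
    using h that by (auto simp: bij_betw_def f_inv_into_f inv_into_into)
  show "\<pi> (h i) \<in> umaps P (X (h i))" if "i \<in> I" for i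
    using product_cone_proj[OF P hI[OF that]] .
  { fix E assume "E \<in> entourages P"
    then obtain J F where JF: "finite J" "J \<subseteq> K" "\<forall>j\<in>J. F j \<in> entourages (X j)"
      "{(p, q) \<in> points P \<times> points P. \<forall>j\<in>J. (\<pi> j p, \<pi> j q) \<in> F j} \<subseteq> E"
      using P unfolding product_cone_def initial_source_def by blast
    show "\<exists>J F. finite J \<and> J \<subseteq> I \<and> (\<forall>j\<in>J. F j \<in> entourages (X (h j))) \<and>
        {(p, q) \<in> points P \<times> points P. \<forall>j\<in>J. (\<pi> (h j) p, \<pi> (h j) q) \<in> F j} \<subseteq> E"
    proof (intro exI[of _ "?k ` J"] exI[of _ "\<lambda>i. F (h i)"] conjI)
      show "?k ` J \<subseteq> I" using hk(2) JF(2) by blast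
      show "\<forall>j\<in>?k ` J. F (h j) \<in> entourages (X (h j))" using hk(1) JF(2,3) by auto
      have "\<forall>j\<in>J. (\<pi> j p, \<pi> j q) \<in> F j"
        if "\<forall>j\<in>?k ` J. (\<pi> (h j) p, \<pi> (h j) q) \<in> F (h j)" for p q
        using that by (simp add: hk(1) subsetD[OF JF(2)])
      then show "{(p, q) \<in> points P \<times> points P. \<forall>j\<in>?k ` J. (\<pi> (h j) p, \<pi> (h j) q) \<in> F (h j)} \<subseteq> E"
        using JF(4) by auto
    qed (use JF(1) in simp) }
  { fix x assume x: "\<forall>i\<in>I. x i \<in> points (X (h i))"
    have "\<forall>j\<in>K. x (?k j) \<in> points (X j)"
    proof
      fix j assume "j \<in> K"
      then show "x (?k j) \<in> points (X j)" using bspec[OF x hk(2)] hk(1) by simp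
    qed
    then have "\<exists>!p. p \<in> points P \<and> (\<forall>j\<in>K. \<pi> j p = x (?k j))"
      using product_cone_ex1[OF P, of "\<lambda>j. x (?k j)"] by simp
    moreover have "(\<forall>j\<in>K. \<pi> j p = x (?k j)) \<longleftrightarrow> (\<forall>i\<in>I. \<pi> (h i) p = x i)" for p
    proof (intro iffI ballI)
      fix i assume "\<forall>j\<in>K. \<pi> j p = x (?k j)" "i \<in> I"
      then show "\<pi> (h i) p = x i" using hI[of i] kh[of i] by simp
    next
      fix j assume "\<forall>i\<in>I. \<pi> (h i) p = x i" "j \<in> K"
      then show "\<pi> j p = x (?k j)" using hk[of j] by force
    qed
    ultimately show "\<exists>!p. p \<in> points P \<and> (\<forall>i\<in>I. \<pi> (h i) p = x i)" by simp }
qed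

text \<open>Tychonoff's theorem gives compactness of the product topology. The map \<open>t\<close>
  that sends a tuple to the point with these coordinates is continuous and onto \<open>P\<close>, so
  \<open>P\<close> is compact as an image.\<close>

lemma compact_product_cone:
  assumes P: "product_cone I X P \<pi>" "unif_space P" and X: "\<And>i. i \<in> I \<Longrightarrow> unif_space (X i)"
    and comp: "\<And>i. i \<in> I \<Longrightarrow> compact_space (utopology (X i))"
  shows "compact_space (utopology P)"
proof -
  let ?T = "product_topology (\<lambda>i. utopology (X i)) I"
  have T: "topspace ?T = (\<Pi>\<^sub>E i\<in>I. points (X i))" using X by (auto cong: PiE_cong)
  have "\<exists>p. p \<in> points P \<and> (\<forall>i\<in>I. \<pi> i p = x i)" if "x \<in> topspace ?T" for x
  proof -
    have "\<forall>i\<in>I. x i \<in> points (X i)" using that unfolding T by auto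
    then show ?thesis using product_cone_point[OF P(1), of x] by metis
  qed
  then obtain t where t: "\<And>x. x \<in> topspace ?T \<Longrightarrow> t x \<in> points P"
    "\<And>x i. x \<in> topspace ?T \<Longrightarrow> i \<in> I \<Longrightarrow> \<pi> i (t x) = x i" by metis
  have "continuous_map ?T (utopology P) t"
    unfolding continuous_map_def topspace_utopology[OF P(2)]
  proof (intro conjI allI impI)
    fix V assume V: "openin (utopology P) V"
    have "\<exists>W. openin ?T W \<and> x \<in> W \<and> W \<subseteq> {x \<in> topspace ?T. t x \<in> V}"
      if x: "x \<in> topspace ?T" "t x \<in> V" for x
    proof -
      obtain E where E: "E \<in> entourages P" "E `` {t x} \<subseteq> V"
        using V x(2) unfolding openin_utopology[OF P(2)] by blast
      then obtain J F where JF: "finite J" "J \<subseteq> I" "\<forall>j\<in>J. F j \<in> entourages (X j)"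
        "{(p, q) \<in> points P \<times> points P. \<forall>j\<in>J. (\<pi> j p, \<pi> j q) \<in> F j} \<subseteq> E"
        using P(1) unfolding product_cone_def initial_source_def by blast
      have "\<exists>W. openin (utopology (X j)) W \<and> x j \<in> W \<and> W \<subseteq> F j `` {x j}" if j: "j \<in> J" for j
      proof -
        have "x j \<in> points (X j)" using x(1) j JF(2) unfolding T by auto
        moreover have "unif_space (X j)" "F j \<in> entourages (X j)" using X JF(2,3) j by auto
        ultimately obtain W where "openin (utopology (X j)) W" "x j \<in> W" "W \<subseteq> F j `` {x j}"
          using open_nbhd_in_entourage by metis
        then show ?thesis by blast
      qed
      then obtain W where W: "\<And>j. j \<in> J \<Longrightarrow> openin (utopology (X j)) (W j)"
        "\<And>j. j \<in> J \<Longrightarrow> x j \<in> W j" "\<And>j. j \<in> J \<Longrightarrow> W j \<subseteq> F j `` {x j}" by metis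
      let ?B = "Pi\<^sub>E I (\<lambda>i. if i \<in> J then W i else topspace (utopology (X i)))"
      have "openin ?T ?B"
        unfolding openin_PiE_gen
        using W(1) JF(1) by (auto intro: finite_subset[OF _ JF(1)])
      moreover have "x \<in> ?B" using x(1) W(2) by (auto simp: PiE_iff)
      moreover have "t y \<in> V" if y: "y \<in> topspace ?T" "y \<in> ?B" for y
      proof -
        have "(\<pi> j (t x), \<pi> j (t y)) \<in> F j" if j: "j \<in> J" for j
        proof -
          have jI: "j \<in> I" using j JF(2) by blast
          then have "y j \<in> W j" using y(2) j by (auto simp: PiE_iff)
          then show ?thesis using W(3)[OF j] t(2)[OF x(1) jI] t(2)[OF y(1) jI] by auto
        qed
        then have "(t x, t y) \<in> E" using JF(4) t(1) x(1) y(1) by blast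
        then show ?thesis using E(2) by blast
      qed
      moreover have "?B \<subseteq> topspace ?T" using openin_subset[OF \<open>openin ?T ?B\<close>] .
      ultimately show ?thesis by (intro exI[of _ ?B]) blast
    qed
    then show "openin ?T {x \<in> topspace ?T. t x \<in> V}"
      by (subst openin_subopen) blast
  qed (use t(1) in blast)
  moreover have "compact_space ?T"
    unfolding compact_space_product_topology using comp by blast
  ultimately have "compactin (utopology P) (t ` topspace ?T)"
    using image_compactin unfolding compact_space_def by blast
  moreover have "t ` topspace ?T = points P"
  proof
    show "points P \<subseteq> t ` topspace ?T"
    proof
      fix p assume p: "p \<in> points P"
      have x: "(\<lambda>i\<in>I. \<pi> i p) \<in> topspace ?T"
        unfolding T using umapsD(2)[OF product_cone_proj[OF P(1)] p] by auto
      have "t (\<lambda>i\<in>I. \<pi> i p) = p"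
        by (rule product_cone_eqI[OF P(1) t(1)[OF x] p]) (simp add: t(2)[OF x])
      then show "p \<in> t ` topspace ?T" using x by (metis image_eqI)
    qed
  qed (use t(1) in blast)
  ultimately show ?thesis unfolding compact_space_def using P(2) by simp
qed

lemma Hausdorff_product_cone:
  assumes P: "product_cone I X P \<pi>" "unif_space P" and X: "\<And>i. i \<in> I \<Longrightarrow> unif_space (X i)"
    and H: "\<And>i. i \<in> I \<Longrightarrow> Hausdorff_space (utopology (X i))"
  shows "Hausdorff_space (utopology P)"
  unfolding Hausdorff_utopology_iff[OF P(2)]
proof (intro ballI impI)
  fix p q assume pq: "p \<in> points P" "q \<in> points P" "p \<noteq> q"
  then obtain i where i: "i \<in> I" "\<pi> i p \<noteq> \<pi> i q" using product_cone_eqI[OF P(1)] by blast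
  note pr = product_cone_proj[OF P(1) i(1)]
  obtain E where E: "E \<in> entourages (X i)" "(\<pi> i p, \<pi> i q) \<notin> E"
    using H[OF i(1)] i(2) umapsD(2)[OF pr pq(1)] umapsD(2)[OF pr pq(2)]
    unfolding Hausdorff_utopology_iff[OF X[OF i(1)]] by blast
  show "\<exists>E\<in>entourages P. (p, q) \<notin> E"
    by (rule bexI[OF _ umapsD(4)[OF pr E(1)]]) (use E(2) in auto)
qed

section \<open>Full subcategories\<close>

lemma Ob_full_on [simp]: "Ob (full_on \<C> D) = D"
  and Hom_full_on [simp]: "Hom (full_on \<C> D) = Hom \<C>"
  and Ident_full_on [simp]: "Ident (full_on \<C> D) = Ident \<C>"
  and Comp_full_on [simp]: "Comp (full_on \<C> D) = Comp \<C>"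
  by (simp_all add: full_on_def)

lemma coequalizer_factor:
  assumes "coequalizer \<C> X Y f g Q q" "Z \<in> Ob \<C>" "h \<in> Hom \<C> Y Z"
    "Comp \<C> X Y Z h f = Comp \<C> X Y Z h g"
  shows "\<exists>!k. k \<in> Hom \<C> Q Z \<and> Comp \<C> Y Q Z k q = h"
  using assms unfolding coequalizer_def by simp

lemma Ob_Unif: "X \<in> Ob Unif \<longleftrightarrow> unif_space X \<and> small (points X)"
  and Hom_Unif [simp]: "Hom Unif = umaps"
  and Ident_Unif [simp]: "Ident Unif X = (\<lambda>x\<in>points X. x)"
  and Comp_Unif [simp]: "Comp Unif X Y Z g f = compose (points X) g f"
  by (simp_all add: Unif_def)

lemma coequalizer_Unif_iff:
  "coequalizer (full_on Unif C) X Y f g Q q \<longleftrightarrow>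
    Q \<in> C \<and> q \<in> umaps Y Q \<and> compose (points X) q f = compose (points X) q g \<and>
    (\<forall>Z\<in>C. \<forall>h\<in>umaps Y Z. compose (points X) h f = compose (points X) h g \<longrightarrow>
      (\<exists>!k. k \<in> umaps Q Z \<and> compose (points Y) k q = h))"
  by (simp add: coequalizer_def)

lemma Ob_SetCat [simp]: "A \<in> Ob SetCat \<longleftrightarrow> small A"
  and Hom_SetCat [simp]: "Hom SetCat A B = A \<rightarrow>\<^sub>E B"
  and Ident_SetCat [simp]: "Ident SetCat A = (\<lambda>x\<in>A. x)"
  and Comp_SetCat [simp]: "Comp SetCat A B D g f = compose A g f"
  by (simp_all add: SetCat_def)

lemma obmap_forget [simp]: "obmap forget X = points X"
  and homap_forget [simp]: "homap forget X Y f = f"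
  by (simp_all add: forget_def)

lemma subcategoryD:
  assumes "subcategory C" "X \<in> C"
  shows "unif_space X" "small (points X)"
    "unif_space Y \<Longrightarrow> small (points Y) \<Longrightarrow> uiso X Y \<Longrightarrow> Y \<in> C"
proof -
  have "X \<in> Ob Unif" using assms unfolding subcategory_def by blast
  then show "unif_space X" "small (points X)" by (simp_all add: Ob_Unif)
  show "unif_space Y \<Longrightarrow> small (points Y) \<Longrightarrow> uiso X Y \<Longrightarrow> Y \<in> C"
    using assms unfolding subcategory_def Ob_Unif[symmetric] by (simp add: Ob_Unif)
qed

lemma small_subset: "small A \<Longrightarrow> B \<subseteq> A \<Longrightarrow> small B"
  unfolding small_def using subset_imp_lepoll lesspoll_trans1 by blast

lemma closed_subspace_in:
  assumes "closed_under_closed_subspaces C" "X \<in> C" "closedin (utopology X) A"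
  shows "usubspace X A \<in> C"
  using assms unfolding closed_under_closed_subspaces_def by blast

text \<open>A point is recovered from the family of subsets of \<open>A\<close> whose images have it
  in their closure. If \<open>V\<close> and \<open>V'\<close> are disjoint neighbourhoods of two
  points, the preimage of \<open>V\<close> belongs to the family of the first point but not to that
  of the second. This bound keeps the family of test maps in \<open>universal_arrow\<close>
  small.\<close>

lemma dense_image_lepoll:
  assumes Y: "unif_space Y" "Hausdorff_space (utopology Y)"
    and dense: "utopology Y closure_of (f ` A) = points Y"
  shows "points Y \<lesssim> Pow (Pow A)"
  unfolding lepoll_def
proof (intro exI conjI)
  let ?\<phi> = "\<lambda>y. {B. B \<subseteq> A \<and> y \<in> utopology Y closure_of (f ` B)}"
  show "?\<phi> ` points Y \<subseteq> Pow (Pow A)" by blast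
  show "inj_on ?\<phi> (points Y)"
  proof (rule inj_onI, rule ccontr)
    fix y y' assume y: "y \<in> points Y" "y' \<in> points Y" "?\<phi> y = ?\<phi> y'" "y \<noteq> y'"
    obtain V V' where V: "openin (utopology Y) V" "openin (utopology Y) V'" "y \<in> V" "y' \<in> V'"
      "disjnt V V'"
      using Y(2) y(1,2,4) unfolding Hausdorff_space_def topspace_utopology[OF Y(1)] by blast
    let ?B = "{a \<in> A. f a \<in> V}"
    have "y \<in> utopology Y closure_of (f ` ?B)"
      unfolding in_closure_of topspace_utopology[OF Y(1)]
    proof (intro conjI allI impI y(1), elim conjE)
      fix W assume W: "y \<in> W" "openin (utopology Y) W"
      have "y \<in> utopology Y closure_of (f ` A)" using dense y(1) by simp
      moreover have "openin (utopology Y) (W \<inter> V)" "y \<in> W \<inter> V" using W V by auto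
      ultimately show "\<exists>z. z \<in> f ` ?B \<and> z \<in> W" unfolding in_closure_of by blast
    qed
    then have "?B \<in> ?\<phi> y" by blast
    then have "y' \<in> utopology Y closure_of (f ` ?B)" unfolding y(3) by blast
    then show False using V(2,4,5) unfolding in_closure_of disjnt_def by blast
  qed
qed

text \<open>Regarded as an endomorphism of \<open>Q\<close>, the map \<open>k\<close> fixes
  \<open>q\<close> and hence is the identity; but all its values lie in the image of
  \<open>q\<close>.\<close>

lemma surj_umap_if_universal:
  assumes Q: "unif_space Q" and q: "q \<in> umaps Y Q"
    and k: "k \<in> umaps Q (usubspace Q (q ` points Y))"
      "compose (points Y) k q = q"
    and uniq: "\<And>k. k \<in> umaps Q Q \<Longrightarrow> compose (points Y) k q = q \<Longrightarrow> k = (\<lambda>x\<in>points Q. x)"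
  shows "q ` points Y = points Q"
proof
  show sub: "q ` points Y \<subseteq> points Q" using umapsD(2)[OF q] by blast
  have kR: "k x \<in> q ` points Y" if "x \<in> points Q" for x using umapsD(2)[OF k(1) that] by simp
  have eq: "compose (points Q) (\<lambda>x\<in>q ` points Y. x) k = k"
    using kR umapsD(3)[OF k(1)] by (auto simp: compose_def fun_eq_iff)
  have "k \<in> umaps Q Q"
    using umaps_compose[OF k(1) umaps_usubspace_incl[OF Q sub]] unfolding eq .
  then have "k = (\<lambda>x\<in>points Q. x)" using uniq k(2) by blast
  then show "points Q \<subseteq> q ` points Y" using kR by fastforce
qed

context universe begin

lemma small_PowPow: "small (A :: 'u set) \<Longrightarrow> Pow (Pow A) \<prec> (UNIV :: 'u set)"
  unfolding small_def by (intro Pow_lesspoll_universe)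

text \<open>Closure under products is stated for index sets over \<open>'u\<close>; the index set is
  copied there and the cone is reindexed back.\<close>

lemma product_cone_in:
  assumes C: "subcategory C" "closed_under_products C"
    and I: "I \<prec> (UNIV :: 'u set)" and X: "\<And>i. i \<in> I \<Longrightarrow> X i \<in> (C :: 'u ustruct set)"
  obtains P \<pi> where "P \<in> C" "product_cone I X P \<pi>"
proof -
  obtain h :: "'a \<Rightarrow> 'u" where h: "inj_on h I" "small (h ` I)" using small_copy[OF I] .
  let ?X = "\<lambda>u. X (inv_into I h u)"
  have X': "?X u \<in> C" if "u \<in> h ` I" for u using X inv_into_into[OF that] by blast
  then obtain P where P: "P \<in> C" "uiso (uproduct (h ` I) ?X) P"
    using C(2)[unfolded closed_under_products_def, rule_format, of "h ` I" ?X] h(2) by auto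
  obtain \<pi> where "product_cone (h ` I) ?X P \<pi>"
  proof (rule product_cone_if_uiso_uproduct[OF _ _ P(2)])
    show "unif_space (?X u)" if "u \<in> h ` I" for u using subcategoryD(1)[OF C(1) X'[OF that]] .
    show "unif_space P" using subcategoryD(1)[OF C(1) P(1)] .
  qed
  then have "product_cone I (\<lambda>i. ?X (h i)) P (\<lambda>i. \<pi> (h i))"
    by (rule product_cone_reindex[rotated]) (use h(1) in \<open>simp add: bij_betw_def\<close>)
  moreover have "product_cone I (\<lambda>i. ?X (h i)) P (\<lambda>i. \<pi> (h i)) \<longleftrightarrow> product_cone I X P (\<lambda>i. \<pi> (h i))"
    unfolding product_cone_def initial_source_def using h(1)
    by (intro conj_cong ball_cong all_cong1 ex_cong1 imp_cong refl) (auto simp: subset_iff)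
  ultimately show thesis using P(1) that by blast
qed

lemma binary_product_in:
  assumes C: "subcategory C" "closed_under_products C" and XY: "X \<in> C" "Y \<in> (C :: 'u ustruct set)"
  obtains P p q where "P \<in> C" "p \<in> umaps P X" "q \<in> umaps P Y"
    "\<And>x y. x \<in> points X \<Longrightarrow> y \<in> points Y \<Longrightarrow> \<exists>z\<in>points P. p z = x \<and> q z = y"
proof -
  let ?F = "\<lambda>b :: bool. if b then X else Y"
  have "(UNIV :: bool set) \<prec> (UNIV :: 'u set)" by (rule finite_lesspoll_universe) simp
  moreover have "?F b \<in> C" for b using XY by simp
  ultimately obtain P \<pi> where P: "P \<in> C" "product_cone UNIV ?F P \<pi>"
    using product_cone_in[OF C, of UNIV ?F] by blast
  show thesis
  proof (rule that[OF P(1), of "\<pi> True" "\<pi> False"])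
    show "\<pi> True \<in> umaps P X" "\<pi> False \<in> umaps P Y"
      using product_cone_proj[OF P(2), of True] product_cone_proj[OF P(2), of False] by auto
    show "\<exists>z\<in>points P. \<pi> True z = x \<and> \<pi> False z = y" if xy: "x \<in> points X" "y \<in> points Y" for x y
    proof -
      obtain z where z: "z \<in> points P" "\<And>b. \<pi> b z = (if b then x else y)"
        by (rule product_cone_point[OF P(2), of "\<lambda>b. if b then x else y"]) (use xy in auto)
      then show ?thesis using z(2)[of True] z(2)[of False] by (intro bexI[of _ z]) auto
    qed
  qed
qed

lemma closed_under_products_Unif: "closed_under_products (Ob Unif :: 'u ustruct set)"
  unfolding closed_under_products_def
proof (intro allI impI, elim conjE)
  fix I :: "'u set" and X :: "'u \<Rightarrow> 'u ustruct"

  assume I: "small I" and X: "\<forall>i\<in>I. X i \<in> Ob Unif"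
  have u: "unif_space (uproduct I X)" by (rule unif_space_uproduct) (use X in \<open>simp add: Ob_Unif\<close>)
  have "points (uproduct I X) \<prec> (UNIV :: 'u set)"
    using PiE_lesspoll_universe[of I "\<lambda>i. points (X i)"] I X
    by (simp add: uproduct_eq_initial_structure small_def Ob_Unif)
  from small_copy[OF this] obtain f :: "('u \<Rightarrow> 'u) \<Rightarrow> 'u" where
    f: "inj_on f (points (uproduct I X))" "small (f ` points (uproduct I X))" .
  obtain Y where "unif_space Y" "points Y = f ` points (uproduct I X)" "uiso (uproduct I X) Y"
    using ustruct_copy[OF u f(1)] by metis
  then show "\<exists>Y\<in>Ob Unif :: 'u ustruct set. uiso (uproduct I X) Y"
    using f(2) by (auto simp: Ob_Unif)
qed

text \<open>\<open>Unif\<close> already contains a copy of every small product. Membership in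
  \<open>C\<close> thus has to be decided only for vertices of product cones, without handling the
  isomorphism.\<close>

lemma closed_under_productsI:
  fixes C :: "'u ustruct set"
  assumes C: "C \<subseteq> Ob Unif"
    and prod: "\<And>(I :: 'u set) X P \<pi>. (\<And>i. i \<in> I \<Longrightarrow> X i \<in> C) \<Longrightarrow> P \<in> Ob Unif \<Longrightarrow>
      product_cone I X P \<pi> \<Longrightarrow> P \<in> C"
  shows "closed_under_products C"
  unfolding closed_under_products_def
proof (intro allI impI, elim conjE)
  fix I :: "'u set" and X :: "'u \<Rightarrow> 'u ustruct"
  assume I: "small I" and X: "\<forall>i\<in>I. X i \<in> C"
  have XU: "\<forall>i\<in>I. X i \<in> Ob Unif" using X C by blast
  obtain P :: "'u ustruct" where P: "P \<in> Ob Unif" "uiso (uproduct I X) P"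
    using closed_under_products_Unif[unfolded closed_under_products_def, rule_format, of I X] I XU by auto
  have uP: "unif_space P" and uX: "\<And>i. i \<in> I \<Longrightarrow> unif_space (X i)"
    using P(1) XU by (simp_all add: Ob_Unif)
  obtain \<pi> where "product_cone I X P \<pi>" using product_cone_if_uiso_uproduct[OF uX uP P(2)] .
  then have "P \<in> C" using prod[of I X P \<pi>] X P(1) by blast
  then show "\<exists>Y\<in>C. uiso (uproduct I X) Y" using P(2) by blast
qed

lemma subcategory_Unif: "subcategory (Ob Unif :: 'u ustruct set)"
  by (simp add: subcategory_def)

text \<open>A point outside the image of \<open>f\<close> could be sent to either of two values
  \<open>s\<close> and \<open>t\<close> without changing the composite with \<open>f\<close>,
  against uniqueness of factors. Conversely a surjection is the coequalizer of its kernel pair,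
  which is copied into \<open>'u\<close> to become an object.\<close>

lemma regular_epi_SetCat_iff:
  fixes A B :: "'u set"
  assumes A: "small A" and f: "f \<in> A \<rightarrow>\<^sub>E B"
  shows "regular_epi SetCat A B f \<longleftrightarrow> f ` A = B \<and> small B"
proof
  assume "regular_epi SetCat A B f"
  then obtain X u v where uv: "u \<in> X \<rightarrow>\<^sub>E A" "v \<in> X \<rightarrow>\<^sub>E A" and co: "coequalizer SetCat X A u v B f"
    unfolding regular_epi_def by auto
  then have B: "small B" "compose X f u = compose X f v" unfolding coequalizer_def by simp_all
  obtain s t :: 'u where st: "s \<noteq> t"
    using infinite_universe by (metis (full_types) UNIV_eq_I finite.emptyI finite_insert insert_iff)
  have "b \<in> f ` A" if b: "b \<in> B" for b
  proof (rule ccontr)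
    assume nb: "b \<notin> f ` A"
    let ?h = "\<lambda>a\<in>A. s" and ?k = "\<lambda>y\<in>B. s" and ?l = "\<lambda>y\<in>B. if y = b then t else s"
    have "small {s, t}" unfolding small_def by (rule finite_lesspoll_universe) simp
    moreover have "compose X ?h u = compose X ?h v"
      using uv by (auto simp: compose_def fun_eq_iff PiE_iff)
    ultimately have "\<exists>!k. k \<in> B \<rightarrow>\<^sub>E {s, t} \<and> compose A k f = ?h"
      using coequalizer_factor[OF co, of "{s, t}" ?h] by auto
    moreover have "?k \<in> B \<rightarrow>\<^sub>E {s, t} \<and> compose A ?k f = ?h"
      using f by (auto simp: compose_def fun_eq_iff PiE_iff)
    moreover have "?l \<in> B \<rightarrow>\<^sub>E {s, t} \<and> compose A ?l f = ?h"
      using f nb by (auto simp: compose_def fun_eq_iff PiE_iff)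
    ultimately have "?k = ?l" by blast
    then have "?k b = ?l b" by simp
    then show False using b st by simp
  qed
  then show "f ` A = B \<and> small B" using f B by (auto simp: PiE_iff)
next
  assume B: "f ` A = B \<and> small B"
  let ?K = "{(a, a') \<in> A \<times> A. f a = f a'}"
  have "A \<times> A \<prec> (UNIV :: 'u set)"
    using A unfolding small_def by (intro Times_lesspoll_universe)
  then have "?K \<prec> (UNIV :: 'u set)"
    by (rule lesspoll_trans1[rotated]) (auto intro: subset_imp_lepoll)
  from small_copy[OF this] obtain c :: "'u \<times> 'u \<Rightarrow> 'u" where c: "inj_on c ?K" "small (c ` ?K)" .
  define u where "u = (\<lambda>x\<in>c ` ?K. fst (inv_into ?K c x))"
  define v where "v = (\<lambda>x\<in>c ` ?K. snd (inv_into ?K c x))"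
  have uv: "u (c (a, a')) = a" "v (c (a, a')) = a'" if "(a, a') \<in> ?K" for a a'
    using that inv_into_f_f[OF c(1) that] imageI[OF that, of c] unfolding u_def v_def by simp_all
  have "u \<in> c ` ?K \<rightarrow>\<^sub>E A" "v \<in> c ` ?K \<rightarrow>\<^sub>E A"
    using uv by (auto simp: u_def v_def)
  moreover have "coequalizer SetCat (c ` ?K) A u v B f"
    unfolding coequalizer_def
  proof (intro conjI ballI impI)
    show "B \<in> Ob SetCat" using B by simp
    show "f \<in> Hom SetCat A B" using f by simp
    show "Comp SetCat (c ` ?K) A B f u = Comp SetCat (c ` ?K) A B f v"
      using uv by (auto simp: compose_def fun_eq_iff)
    fix Z h assume Z: "Z \<in> Ob SetCat" and h: "h \<in> Hom SetCat A Z"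
      and eq: "Comp SetCat (c ` ?K) A Z h u = Comp SetCat (c ` ?K) A Z h v"
    have hf: "h a = h a'" if "a \<in> A" "a' \<in> A" "f a = f a'" for a a'
    proof -
      have m: "(a, a') \<in> ?K" using that by simp
      have "h (u (c (a, a'))) = h (v (c (a, a')))"
        using fun_cong[OF eq, of "c (a, a')"] imageI[OF m, of c] by (simp add: compose_def)
      then show ?thesis using uv[OF m] by simp
    qed
    let ?k = "\<lambda>b\<in>B. h (inv_into A f b)"
    have kf: "?k (f a) = h a" if "a \<in> A" for a
      using hf[of "inv_into A f (f a)" a] that B by (auto simp: inv_into_into f_inv_into_f)
    show "\<exists>!k. k \<in> Hom SetCat B Z \<and> Comp SetCat A B Z k f = h"
    proof (rule ex1I[of _ ?k])
      have "h (inv_into A f b) \<in> Z" if "b \<in> B" for b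
        using h that B inv_into_into[of b f A] by (auto simp: PiE_iff)
      moreover have "compose A ?k f = h"
        using kf h by (auto simp: compose_def fun_eq_iff PiE_iff extensional_def)
      ultimately show "?k \<in> Hom SetCat B Z \<and> Comp SetCat A B Z ?k f = h" by auto
      fix k assume k: "k \<in> Hom SetCat B Z \<and> Comp SetCat A B Z k f = h"
      have "k (f a) = h a" if "a \<in> A" for a
      proof -
        have "compose A k f a = h a" using k by simp
        then show ?thesis using that by (simp add: compose_def)
      qed
      then have "k b = ?k b" if "b \<in> B" for b using that B kf by force
      then show "k = ?k" using k by (auto simp: fun_eq_iff PiE_iff extensional_def)
    qed
  qed
  ultimately show "regular_epi SetCat A B f"
    unfolding regular_epi_def using c(2) by (intro bexI[of _ "c ` ?K"] bexI[of _ u] bexI[of _ v]) auto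
qed

text \<open>The parallel pair of which \<open>p\<close> is the coequalizer is unknown, but
  \<open>p\<close> identifies its two values at each point. These lie in a common fibre of
  \<open>p\<close>, so \<open>h\<close> identifies them too.\<close>

lemma algebraic_factor:
  assumes C: "subcategory (C :: 'u ustruct set)" "algebraic_category C"
    and obj: "G \<in> C" "B \<in> C" "W \<in> C"
    and p: "p \<in> umaps G B" "p ` points G = points B" and h: "h \<in> umaps G W"
    and fib: "\<And>x y. x \<in> points G \<Longrightarrow> y \<in> points G \<Longrightarrow> p x = p y \<Longrightarrow> h x = h y"
  obtains k where "k \<in> umaps B W" "\<And>x. x \<in> points G \<Longrightarrow> k (p x) = h x"
proof -
  have "regular_epi SetCat (points G) (points B) p"
    using regular_epi_SetCat_iff[OF subcategoryD(2)[OF C(1) obj(1)] umapsD(1)[OF p(1)]]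
      p(2) subcategoryD(2)[OF C(1) obj(2)] by simp
  then have "regular_epi (full_on Unif C) G B p"
    using C(2) obj p(1) unfolding algebraic_category_def reflects_regular_epis_def by simp
  then obtain X u v where X: "X \<in> C" "u \<in> umaps X G" "v \<in> umaps X G"
    and co: "coequalizer (full_on Unif C) X G u v B p"
    unfolding regular_epi_def by auto
  have eq: "compose (points X) p u = compose (points X) p v"
    using co unfolding coequalizer_def by simp
  have "compose (points X) h u = compose (points X) h v"
  proof
    fix x
    have "h (u x) = h (v x)" if "x \<in> points X"
      using fun_cong[OF eq, of x] that
      by (intro fib umapsD(2)[OF X(2)] umapsD(2)[OF X(3)]) (simp_all add: compose_def)
    then show "compose (points X) h u x = compose (points X) h v x" by (simp add: compose_def)
  qed
  then obtain k where k: "k \<in> umaps B W" "compose (points G) k p = h"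
    using coequalizer_factor[OF co, of W h] obj(3) h by auto
  have "k (p x) = h x" if "x \<in> points G" for x
    using fun_cong[OF k(2), of x] that by (simp add: compose_def)
  then show thesis using k(1) that by blast
qed

text \<open>The solution-set argument of the adjoint functor theorem. With \<open>S\<close> empty it
  gives reflections, and free objects when \<open>X\<close> is discrete; with \<open>S\<close> the
  set of pairs \<open>(f x, g x)\<close> it gives coequalizers.\<close>

lemma universal_arrow:
  fixes X :: "'u ustruct"
  assumes C: "subcategory (C :: 'u ustruct set)" "closed_under_products C"
      "closed_under_closed_subspaces C"
    and T2: "\<And>Y. Y \<in> C \<Longrightarrow> Hausdorff_space (utopology Y)"
    and X: "X \<in> Ob Unif" and S: "S \<subseteq> points X \<times> points X"
  shows "\<exists>Q\<in>C. \<exists>q\<in>umaps X Q. (\<forall>(a, b)\<in>S. q a = q b) \<and>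
    (\<forall>Y\<in>C. \<forall>f\<in>umaps X Y. (\<forall>(a, b)\<in>S. f a = f b) \<longrightarrow>
      (\<exists>!g. g \<in> umaps Q Y \<and> compose (points X) g q = f))"
proof -
  have uX: "unif_space X" and sX: "small (points X)" using X by (simp_all add: Ob_Unif)
  note uC = subcategoryD(1)[OF C(1)]
  obtain c :: "'u set set \<Rightarrow> 'u" where c: "inj_on c (Pow (Pow (points X)))" "small (c ` Pow (Pow (points X)))"
    using small_copy[OF small_PowPow[OF sX]] .
  define K where "K = c ` Pow (Pow (points X))"
  \<comment> \<open>By density, the closed image of any map has at most \<open>2 ^ (2 ^ |X|)\<close> points, so it has a copy on a
    subset of \<open>K\<close>.\<close>
  define I where "I = {(Y, f). Y \<in> C \<and> points Y \<subseteq> K \<and> f \<in> umaps X Y \<and> (\<forall>(a, b)\<in>S. f a = f b)}"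
  \<comment> \<open>A space with points in \<open>K\<close> is determined by its points and its
    entourages, and there are few choices for both.\<close>
  have "I \<prec> (UNIV :: 'u set)"
  proof -
    have "I \<lesssim> (Pow K \<times> Pow (Pow (K \<times> K))) \<times> (points X \<rightarrow>\<^sub>E K)"
      unfolding lepoll_def
    proof (intro exI conjI)
      show "inj_on (\<lambda>(Y, f). ((points Y, entourages Y), f)) I"
        by (rule inj_onI) (auto intro: ustruct.equality)
      show "(\<lambda>(Y, f). ((points Y, entourages Y), f)) ` I \<subseteq> (Pow K \<times> Pow (Pow (K \<times> K))) \<times> (points X \<rightarrow>\<^sub>E K)"
      proof (rule image_subsetI)
        fix i assume "i \<in> I"
        moreover obtain Y f where i: "i = (Y, f)" by (cases i)
        ultimately have Y: "Y \<in> C" "points Y \<subseteq> K" "f \<in> umaps X Y" unfolding I_def by auto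
        have "entourages Y \<in> Pow (Pow (K \<times> K))"
          using entourage_subset[OF uC[OF Y(1)]] Y(2) by blast
        moreover have "f \<in> points X \<rightarrow>\<^sub>E K" using umapsD(1)[OF Y(3)] Y(2) by auto
        ultimately show "(case i of (Y, f) \<Rightarrow> ((points Y, entourages Y), f)) \<in>
            (Pow K \<times> Pow (Pow (K \<times> K))) \<times> (points X \<rightarrow>\<^sub>E K)" using Y(2) i by simp
      qed
    qed
    moreover have "K \<prec> (UNIV :: 'u set)" using c(2) unfolding K_def small_def .
    moreover have "points X \<prec> (UNIV :: 'u set)" using sX unfolding small_def .
    ultimately show ?thesis
      by - (rule lesspoll_trans1, assumption,
        (intro Times_lesspoll_universe Pow_lesspoll_universe PiE_lesspoll_universe; assumption))
  qed
  moreover have "fst i \<in> C" if "i \<in> I" for i using that unfolding I_def by auto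
  ultimately obtain P \<pi> where P: "P \<in> C" "product_cone I fst P \<pi>"
    using product_cone_in[OF C(1,2), of I fst] by blast
  note uP = uC[OF P(1)]
  obtain r where r: "r \<in> umaps X P" "\<And>i x. i \<in> I \<Longrightarrow> x \<in> points X \<Longrightarrow> \<pi> i (r x) = snd i x"
    by (rule product_cone_tuple[OF P(2) uX, of snd]) (auto simp: I_def)
  have rS: "r a = r b" if ab: "(a, b) \<in> S" for a b
  proof -
    have ab': "a \<in> points X" "b \<in> points X" using ab S by auto
    show ?thesis
    proof (rule product_cone_eqI[OF P(2) umapsD(2)[OF r(1) ab'(1)] umapsD(2)[OF r(1) ab'(2)]])
      fix i assume i: "i \<in> I"
      then have "snd i a = snd i b" using ab unfolding I_def by auto
      then show "\<pi> i (r a) = \<pi> i (r b)" using r(2)[OF i] ab' by simp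
    qed
  qed
  define R where "R = utopology P closure_of (r ` points X)"
  have rsub: "r ` points X \<subseteq> points P" using umapsD(2)[OF r(1)] by blast
  have R: "R \<subseteq> points P" "r ` points X \<subseteq> R" "closedin (utopology P) R"
    using closure_of_subset_topspace[of "utopology P"] closure_of_subset[of "r ` points X" "utopology P"]
      rsub uP unfolding R_def by auto
  define Q where "Q = usubspace P R"
  have Q: "Q \<in> C" unfolding Q_def by (rule closed_subspace_in[OF C(3) P(1) R(3)])
  have [simp]: "points Q = R" by (simp add: Q_def)
  have rQ: "r \<in> umaps X Q" unfolding Q_def by (rule umaps_usubspace_codomain[OF uP R(1) r(1) R(2)])
  have dense: "utopology Q closure_of (r ` points X) = points Q"
    using R(2) unfolding Q_def utopology_usubspace[OF uP R(1)] closure_of_subtopology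
    by (simp add: Int_absorb1 flip: R_def)
  have univ: "\<exists>!g. g \<in> umaps Q Y \<and> compose (points X) g r = f"
    if Y: "Y \<in> C" and f: "f \<in> umaps X Y" and fS: "\<And>a b. (a, b) \<in> S \<Longrightarrow> f a = f b" for Y f
  proof -
    note uY = uC[OF Y]
    \<comment> \<open>\<open>Y\<close> itself may be too large to have a copy on a subset of
      \<open>K\<close>; the closure of the image of \<open>f\<close> is not.\<close>
    define T where "T = utopology Y closure_of (f ` points X)"
    have fsub: "f ` points X \<subseteq> points Y" using umapsD(2)[OF f] by blast
    have T: "T \<subseteq> points Y" "f ` points X \<subseteq> T" "closedin (utopology Y) T"
      using closure_of_subset_topspace[of "utopology Y"] closure_of_subset[of "f ` points X" "utopology Y"]
        fsub uY unfolding T_def by auto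
    let ?Y0 = "usubspace Y T"
    have Y0: "?Y0 \<in> C" by (rule closed_subspace_in[OF C(3) Y T(3)])
    have "utopology ?Y0 closure_of (f ` points X) = points ?Y0"
      using T(2) unfolding utopology_usubspace[OF uY T(1)] closure_of_subtopology
      by (simp add: Int_absorb1 flip: T_def)
    then have "points ?Y0 \<lesssim> Pow (Pow (points X))"
      by (rule dense_image_lepoll[OF uC[OF Y0] T2[OF Y0]])
    then obtain e where e: "inj_on e T" "e ` T \<subseteq> Pow (Pow (points X))"
      unfolding lepoll_def by auto
    define d where "d = c \<circ> e"
    have d: "inj_on d (points ?Y0)" "d ` T \<subseteq> K"
      using comp_inj_on[OF e(1) inj_on_subset[OF c(1) e(2)]] e(2) unfolding d_def K_def by auto
    obtain Y1 g1 where Y1: "unif_space Y1" "points Y1 = d ` points ?Y0"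
      "restrict d (points ?Y0) \<in> umaps ?Y0 Y1" "g1 \<in> umaps Y1 ?Y0"
      "\<And>x. x \<in> points ?Y0 \<Longrightarrow> g1 (d x) = x" "uiso ?Y0 Y1"
      by (rule ustruct_copy[OF uC[OF Y0] d(1)]) (rule that; assumption)
    have Y1K: "points Y1 \<subseteq> K" unfolding Y1(2) points_usubspace by (rule d(2))
    have "small (points Y1)" by (rule small_subset[OF _ Y1K]) (simp add: K_def c(2))
    then have Y1C: "Y1 \<in> C" using subcategoryD(3)[OF C(1) Y0 Y1(1) _ Y1(6)] by blast
    have f0: "f \<in> umaps X ?Y0" by (rule umaps_usubspace_codomain[OF uY T(1) f T(2)])
    define f1 where "f1 = compose (points X) (restrict d (points ?Y0)) f"
    have f1: "f1 \<in> umaps X Y1" unfolding f1_def by (rule umaps_compose[OF f0 Y1(3)])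
    have f1x: "f1 x = d (f x)" if "x \<in> points X" for x
      using that T(2) by (auto simp: f1_def compose_def)
    have "f1 a = f1 b" if ab: "(a, b) \<in> S" for a b
      using f1x[of a] f1x[of b] ab S fS by auto
    then have i: "(Y1, f1) \<in> I" unfolding I_def using Y1C f1 Y1K by auto
    have p: "\<pi> (Y1, f1) \<in> umaps P Y1" using product_cone_proj[OF P(2) i] by simp
    \<comment> \<open>The factor is the projection to the index \<open>(Y1, f1)\<close>, followed by
      the inverse of the copy and the inclusion of \<open>T\<close> into \<open>Y\<close>.\<close>
    define g where "g = restrict (compose (points P) (compose (points Y1) (\<lambda>x\<in>T. x) g1) (\<pi> (Y1, f1))) R"
    have g: "g \<in> umaps Q Y"
      unfolding g_def Q_def
      by (intro umaps_restrict[OF uP R(1)] umaps_compose[OF p] umaps_compose[OF Y1(4)]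
          umaps_usubspace_incl[OF uY T(1)])
    have "compose (points X) g r = f"
    proof
      fix x
      show "compose (points X) g r x = f x"
      proof (cases "x \<in> points X")
        case True
        then have rx: "r x \<in> R" "r x \<in> points P" using R(1,2) by auto
        have fT: "f x \<in> T" using T(2) True by blast
        have "\<pi> (Y1, f1) (r x) = d (f x)" using r(2)[OF i True] f1x[OF True] by simp
        moreover have "d (f x) \<in> points Y1" using Y1(2) fT by simp
        ultimately show ?thesis
          using True rx fT Y1(5)[of "f x"] by (simp add: compose_def g_def)
      qed (simp add: compose_def umapsD(3)[OF f])
    qed
    moreover have "g' = g" if g': "g' \<in> umaps Q Y" "compose (points X) g' r = f" for g'
    proof (rule umaps_eq_on_closure[OF uC[OF Q] uY T2[OF Y] g'(1) g dense])
      fix z assume "z \<in> r ` points X"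
      then obtain x where x: "x \<in> points X" "z = r x" by blast
      have "compose (points X) g' r x = compose (points X) g r x"
        using g'(2) \<open>compose (points X) g r = f\<close> by simp
      then show "g' z = g z" using x by (simp add: compose_def)
    qed
    ultimately show ?thesis using g by blast
  qed
  show ?thesis
  proof (intro bexI[OF _ Q] bexI[OF _ rQ] conjI ballI impI)
    show "\<And>ab. ab \<in> S \<Longrightarrow> case ab of (a, b) \<Rightarrow> r a = r b" using rS by auto
    fix Y f assume "Y \<in> C" "f \<in> umaps X Y" "\<forall>(a, b)\<in>S. f a = f b"
    then show "\<exists>!g. g \<in> umaps Q Y \<and> compose (points X) g r = f" by (intro univ) auto
  qed
qed

end

section \<open>Indiscrete spaces\<close>

lemma umaps_into_indiscrete:
  assumes X: "unif_space X" and Y: "uindiscrete Y" and f: "f \<in> points X \<rightarrow>\<^sub>E points Y"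
  shows "f \<in> umaps X Y"
proof (rule umapsI[OF X f])
  fix E assume "E \<in> entourages Y"
  then have "E = points Y \<times> points Y" using Y unfolding uindiscrete_def by simp
  then have "\<forall>x\<in>points X. \<forall>x'\<in>points X. (x, x') \<in> points X \<times> points X \<longrightarrow> (f x, f x') \<in> E"
    using f by auto
  then show "\<exists>D\<in>entourages X. \<forall>x\<in>points X. \<forall>x'\<in>points X. (x, x') \<in> D \<longrightarrow> (f x, f x') \<in> E"
    using entourage_UNIV[OF X] by (rule bexI)
qed

lemma uiso_indiscrete:
  assumes X: "unif_space X" "uindiscrete X" and Y: "unif_space Y" "uindiscrete Y"
    and b: "bij_betw b (points X) (points Y)"
  shows "uiso X Y"
proof -
  have f: "restrict b (points X) \<in> umaps X Y"
    by (rule umaps_into_indiscrete[OF X(1) Y(2)]) (use bij_betwE[OF b] in auto)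
  have g: "restrict (inv_into (points X) b) (points Y) \<in> umaps Y X"
    by (rule umaps_into_indiscrete[OF Y(1) X(2)]) (use bij_betwE[OF bij_betw_inv_into[OF b]] in auto)
  show ?thesis
    unfolding uiso_def
  proof (rule bexI[OF _ f], rule bexI[OF _ g])
    have "b x \<in> points Y" if "x \<in> points X" for x using bij_betwE[OF b] that by blast
    moreover have "inv_into (points X) b y \<in> points X" if "y \<in> points Y" for y
      using bij_betwE[OF bij_betw_inv_into[OF b]] that by blast
    ultimately show "(\<forall>x\<in>points X. restrict (inv_into (points X) b) (points Y) (restrict b (points X) x) = x) \<and>
      (\<forall>y\<in>points Y. restrict b (points X) (restrict (inv_into (points X) b) (points Y) y) = y)"
      using bij_betw_inv_into_left[OF b] bij_betw_inv_into_right[OF b] by simp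
  qed
qed

text \<open>The equivalence relation that a Hausdorff space makes trivial and an indiscrete one
  makes total. Its classes are the closures of the points.\<close>

definition inseparable :: "'a ustruct \<Rightarrow> ('a \<times> 'a) set" where
  "inseparable X = (points X \<times> points X) \<inter> \<Inter>(entourages X)"

lemma inseparable_iff: "(x, y) \<in> inseparable X \<longleftrightarrow>
    x \<in> points X \<and> y \<in> points X \<and> (\<forall>E\<in>entourages X. (x, y) \<in> E)"
  unfolding inseparable_def by blast

lemma inseparable_refl: "unif_space X \<Longrightarrow> x \<in> points X \<Longrightarrow> (x, x) \<in> inseparable X"
  by (simp add: inseparable_iff entourage_refl)

lemma inseparable_sym:
  assumes X: "unif_space X" and xy: "(x, y) \<in> inseparable X"
  shows "(y, x) \<in> inseparable X"
  unfolding inseparable_iff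
proof (intro conjI ballI)
  fix E assume "E \<in> entourages X"
  then have "(x, y) \<in> E\<inverse>" using xy entourage_converse[OF X] unfolding inseparable_iff by blast
  then show "(y, x) \<in> E" by simp
qed (use xy in \<open>simp_all add: inseparable_iff\<close>)

lemma inseparable_trans:
  assumes X: "unif_space X" and xy: "(x, y) \<in> inseparable X" "(y, z) \<in> inseparable X"
  shows "(x, z) \<in> inseparable X"
  unfolding inseparable_iff
proof (intro conjI ballI)
  fix E assume "E \<in> entourages X"
  then obtain F where F: "F \<in> entourages X" "F O F \<subseteq> E" using entourage_half[OF X] by blast
  then have "(x, y) \<in> F" "(y, z) \<in> F" using xy unfolding inseparable_iff by simp_all
  then show "(x, z) \<in> E" using F(2) by blast
qed (use xy in \<open>simp_all add: inseparable_iff\<close>)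

text \<open>If \<open>E\<close> separates \<open>x\<close> from \<open>y\<close> and
  \<open>F\<close> is a symmetric half of \<open>E\<close>, then a point of the class of
  \<open>x\<close> that is \<open>F\<close>-close to \<open>y\<close> would connect \<open>x\<close>
  to \<open>y\<close> within \<open>E\<close>.\<close>

lemma closedin_inseparable_class:
  assumes X: "unif_space X"
  shows "closedin (utopology X) (inseparable X `` {x})"
  unfolding closedin_def topspace_utopology[OF X]
proof
  show "inseparable X `` {x} \<subseteq> points X" by (auto simp: inseparable_iff)
  show "openin (utopology X) (points X - inseparable X `` {x})"
    unfolding openin_utopology[OF X]
  proof (intro conjI ballI)
    fix y assume y: "y \<in> points X - inseparable X `` {x}"
    show "\<exists>E\<in>entourages X. E `` {y} \<subseteq> points X - inseparable X `` {x}"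
    proof (cases "x \<in> points X")
      case True
      then obtain E where E: "E \<in> entourages X" "(x, y) \<notin> E"
        using y by (auto simp: inseparable_iff)
      obtain F where F: "F \<in> entourages X" "F O F \<subseteq> E" "F\<inverse> \<subseteq> F"
        using entourage_symmetric_half[OF X E(1)] by blast
      have "z \<notin> inseparable X `` {x}" if z: "(y, z) \<in> F" for z
      proof
        assume "z \<in> inseparable X `` {x}"
        then have "(x, z) \<in> F" using F(1) by (simp add: inseparable_iff)
        then show False using z F(2,3) E(2) by blast
      qed
      then show ?thesis using F(1) entourage_subset[OF X F(1)] by (intro bexI[of _ F]) auto
    next
      case False
      then have "inseparable X `` {x} = {}" by (auto simp: inseparable_iff)
      then show ?thesis using entourage_UNIV[OF X] by (intro bexI[of _ "points X \<times> points X"]) auto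
    qed
  qed auto
qed

lemma inseparable_usubspace:
  assumes "A \<subseteq> points X"
  shows "inseparable (usubspace X A) = inseparable X \<inter> (A \<times> A)"
  using assms unfolding inseparable_def entourages_usubspace by auto

text \<open>Entourages cannot see a change of values within inseparability classes: every pair of
  inseparable points lies in every entourage.\<close>

lemma umaps_perturb:
  assumes Z: "unif_space Z" and Y: "unif_space Y" and g: "g \<in> umaps Z Y"
    and f: "f \<in> points Z \<rightarrow>\<^sub>E points Y" and fg: "\<And>z. z \<in> points Z \<Longrightarrow> (f z, g z) \<in> inseparable Y"
  shows "f \<in> umaps Z Y"
proof (rule umapsI[OF Z f])
  fix E assume "E \<in> entourages Y"
  then obtain F where F: "F \<in> entourages Y" "F O F \<subseteq> E" using entourage_half[OF Y] by blast
  obtain G where G: "G \<in> entourages Y" "G O G \<subseteq> F" using entourage_half[OF Y F(1)] by blast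
  have "(f z, f z') \<in> E"
    if z: "z \<in> points Z" "z' \<in> points Z" "(z, z') \<in> {(x, x') \<in> points Z \<times> points Z. (g x, g x') \<in> G}" for z z'
  proof -
    have "(f z, g z) \<in> G" "(g z', f z') \<in> F"
      using fg[OF z(1)] inseparable_sym[OF Y fg[OF z(2)]] G(1) F(1) unfolding inseparable_iff by simp_all
    moreover have "(g z, g z') \<in> G" using z(3) by simp
    ultimately show ?thesis using G(2) F(2) by blast
  qed
  then show "\<exists>D\<in>entourages Z. \<forall>z\<in>points Z. \<forall>z'\<in>points Z. (z, z') \<in> D \<longrightarrow> (f z, f z') \<in> E"
    by (intro bexI[OF _ umapsD(4)[OF g G(1)]] ballI impI)
qed

lemma Hausdorff_iff_inseparable:
  assumes X: "unif_space X"
  shows "Hausdorff_space (utopology X) \<longleftrightarrow> (\<forall>x y. (x, y) \<in> inseparable X \<longrightarrow> x = y)"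
  unfolding Hausdorff_utopology_iff[OF X] inseparable_iff by blast

lemma uindiscrete_iff_inseparable:
  assumes X: "unif_space X"
  shows "uindiscrete X \<longleftrightarrow> inseparable X = points X \<times> points X"
proof
  assume "uindiscrete X"
  then show "inseparable X = points X \<times> points X" unfolding uindiscrete_def inseparable_def by simp
next
  assume "inseparable X = points X \<times> points X"
  then have "E = points X \<times> points X" if "E \<in> entourages X" for E
    using entourage_subset[OF X that] that unfolding inseparable_def by blast
  then show "uindiscrete X" unfolding uindiscrete_def using entourage_UNIV[OF X] by blast
qed

lemma uindiscrete_usubspace_class:
  assumes X: "unif_space X"
  shows "uindiscrete (usubspace X (inseparable X `` {x}))"
proof -
  let ?A = "inseparable X `` {x}"
  have "E \<inter> (?A \<times> ?A) = ?A \<times> ?A" if "E \<in> entourages X" for E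
  proof -
    have "(y, z) \<in> E" if "(x, y) \<in> inseparable X" "(x, z) \<in> inseparable X" for y z
      using inseparable_trans[OF X inseparable_sym[OF X that(1)] that(2)] \<open>E \<in> entourages X\<close>
      unfolding inseparable_iff by simp
    then show ?thesis by blast
  qed
  then have "entourages (usubspace X ?A) = {?A \<times> ?A}"
    unfolding entourages_usubspace using entourage_UNIV[OF X] by blast
  then show ?thesis unfolding uindiscrete_def by simp
qed

context universe begin

lemma algebraic_regular_epi_surj:
  assumes C: "subcategory (C :: 'u ustruct set)" "algebraic_category C"
    and Y: "Y \<in> C" and q: "coequalizer (full_on Unif C) X Y f g Q q"
    and X: "X \<in> C" "f \<in> umaps X Y" "g \<in> umaps X Y"
  shows "q ` points Y = points Q"
proof -
  have Q: "Q \<in> C" "q \<in> umaps Y Q" using q unfolding coequalizer_def by simp_all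
  have "regular_epi (full_on Unif C) Y Q q"
    unfolding regular_epi_def using X q by auto
  then have "regular_epi SetCat (points Y) (points Q) q"
    using C(2) Y Q unfolding algebraic_category_def preserves_regular_epis_def by simp
  then show ?thesis
    using regular_epi_SetCat_iff[OF subcategoryD(2)[OF C(1) Y] umapsD(1)[OF Q(2)]] by blast
qed

text \<open>The sum of \<open>?A\<close> and \<open>?B\<close> may have fewer points than
  \<open>N\<close>; multiplying it by \<open>N\<close> leaves room for a surjection onto
  \<open>N\<close> that separates the two parts. Continuity comes for free: \<open>p\<close> maps
  into an indiscrete space, and \<open>h\<close> moves the projection \<open>m\<close> only inside
  inseparability classes.\<close>

lemma algebraic_non_Hausdorff_imp_indiscrete:
  assumes C: "subcategory (C :: 'u ustruct set)" "closed_under_products C"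
      "closed_under_closed_subspaces C" "algebraic_category C"
    and X: "X \<in> C" "\<not> Hausdorff_space (utopology X)" and Y: "Y \<in> C"
  shows "uindiscrete Y"
proof (rule ccontr)
  assume "\<not> uindiscrete Y"
  note uC = subcategoryD(1)[OF C(1)]
  note uX = uC[OF X(1)] and uY = uC[OF Y]
  obtain n0 n1 where n: "(n0, n1) \<in> inseparable X" "n0 \<noteq> n1"
    using X(2) unfolding Hausdorff_iff_inseparable[OF uX] by blast
  have "inseparable Y \<subseteq> points Y \<times> points Y" unfolding inseparable_def by blast
  then obtain y0 y1 where y: "y0 \<in> points Y" "y1 \<in> points Y" "(y0, y1) \<notin> inseparable Y"
    using \<open>\<not> uindiscrete Y\<close> unfolding uindiscrete_iff_inseparable[OF uY] by blast
  let ?K = "inseparable X `` {n0}" and ?A = "inseparable Y `` {y0}" and ?B = "inseparable Y `` {y1}"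
  define N where "N = usubspace X ?K"
  have N: "N \<in> C" "uindiscrete N" and [simp]: "points N = ?K"
    unfolding N_def using closed_subspace_in[OF C(3) X(1) closedin_inseparable_class[OF uX]]
      uindiscrete_usubspace_class[OF uX] by simp_all
  have nN: "n0 \<in> points N" "n1 \<in> points N"
    using n inseparable_refl[OF uX] by (auto simp: inseparable_iff)
  define M where "M = usubspace Y (?A \<union> ?B)"
  have AB: "?A \<union> ?B \<subseteq> points Y" by (auto simp: inseparable_iff)
  have M: "M \<in> C" and [simp]: "points M = ?A \<union> ?B"
    unfolding M_def
    by (intro closed_subspace_in[OF C(3) Y] closedin_Un closedin_inseparable_class[OF uY]) simp
  have yAB: "y0 \<in> ?A" "y1 \<in> ?B" "y1 \<notin> ?A" using y inseparable_refl[OF uY] by auto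
  obtain P m r where P: "P \<in> C" "m \<in> umaps P M" "r \<in> umaps P N"
    "\<And>x y. x \<in> points M \<Longrightarrow> y \<in> points N \<Longrightarrow> \<exists>z\<in>points P. m z = x \<and> r z = y"
    using binary_product_in[OF C(1,2) M N(1)] by metis
  \<comment> \<open>The point \<open>n0\<close> is reserved for the part over \<open>?A\<close>.
    Over \<open>?B\<close> the second coordinate is kept, except that \<open>n0\<close> is diverted
    to \<open>n1\<close>; every point other than \<open>n0\<close> is still attained.\<close>
  define p where "p = (\<lambda>z\<in>points P. if m z \<in> ?A then n0 else if r z = n0 then n1 else r z)"
  define h where "h = (\<lambda>z\<in>points P. if m z \<in> ?A then y0 else y1)"
  have pp: "p \<in> umaps P N"
    by (rule umaps_into_indiscrete[OF uC[OF P(1)] N(2)])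
      (use nN umapsD(2)[OF P(3)] in \<open>auto simp: p_def\<close>)
  have hh: "h \<in> umaps P M"
  proof (rule umaps_perturb[OF uC[OF P(1)] uC[OF M] P(2)])
    show "h \<in> points P \<rightarrow>\<^sub>E points M" using yAB by (auto simp: h_def)
    fix z assume z: "z \<in> points P"
    have mz: "m z \<in> ?A \<union> ?B" using umapsD(2)[OF P(2) z] by simp
    then have "(h z, m z) \<in> inseparable Y" using z by (auto simp: h_def)
    moreover have "h z \<in> ?A \<union> ?B" using z yAB by (simp add: h_def)
    ultimately show "(h z, m z) \<in> inseparable M"
      using mz AB by (simp add: M_def inseparable_usubspace)
  qed
  have "p ` points P = points N"
  proof
    show "p ` points P \<subseteq> points N" using umapsD(2)[OF pp] by blast
    show "points N \<subseteq> p ` points P"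
    proof
      fix b assume b: "b \<in> points N"
      show "b \<in> p ` points P"
      proof (cases "b = n0")
        case True
        then show ?thesis using P(4)[of y0 n0] nN yAB by (force simp: p_def)
      next
        case False
        then show ?thesis using P(4)[of y1 b] b yAB by (force simp: p_def)
      qed
    qed
  qed
  moreover have "h x = h y" if "x \<in> points P" "y \<in> points P" "p x = p y" for x y
    using that n(2) by (auto simp: p_def h_def split: if_splits)
  ultimately obtain k where k: "k \<in> umaps N M" "\<And>x. x \<in> points P \<Longrightarrow> k (p x) = h x"
    using algebraic_factor[OF C(1,4) P(1) N(1) M pp _ hh] by blast
  obtain z0 where z0: "z0 \<in> points P" "m z0 = y0" "r z0 = n0" using P(4)[of y0 n0] nN yAB by auto
  obtain z1 where z1: "z1 \<in> points P" "m z1 = y1" "r z1 = n1" using P(4)[of y1 n1] nN yAB by auto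
  have k0: "k n0 = y0" using k(2)[OF z0(1)] z0 yAB by (simp add: p_def h_def)
  have k1: "k n1 = y1" using k(2)[OF z1(1)] z1 yAB n(2) by (simp add: p_def h_def)
  obtain E where E: "E \<in> entourages Y" "(y0, y1) \<notin> E" using y by (auto simp: inseparable_iff)
  \<comment> \<open>The only entourage of \<open>N\<close> is the full one, so the preimage of
    \<open>E\<close> under \<open>k\<close> must contain \<open>(n0, n1)\<close>, although
    \<open>E\<close> separates their images \<open>y0\<close> and \<open>y1\<close>.\<close>
  have "E \<inter> (?A \<union> ?B) \<times> (?A \<union> ?B) \<in> entourages M"
    using E(1) unfolding M_def entourages_usubspace by blast
  from umapsD(4)[OF k(1) this]
  have "{(x, x') \<in> points N \<times> points N. (k x, k x') \<in> E \<inter> (?A \<union> ?B) \<times> (?A \<union> ?B)} = points N \<times> points N"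
    using N(2) unfolding uindiscrete_def by (simp only: singleton_iff)
  then have "(n0, n1) \<in> {(x, x') \<in> points N \<times> points N. (k x, k x') \<in> E \<inter> (?A \<union> ?B) \<times> (?A \<union> ?B)}"
    using nN by simp
  then show False using k0 k1 E(2) by simp
qed

text \<open>The power \<open>Y\<close> of \<open>N\<close> indexed by the points of \<open>S\<close>
  is large enough: \<phi> embeds \<open>points S\<close> by indicators of singletons, and \<sigma>
  retracts onto it. Collapsing the fibres of \<sigma> by a coequalizer leaves exactly as many points
  as \<open>S\<close> has, and indiscrete spaces of equal size are isomorphic.\<close>

lemma algebraic_indiscrete_all:
  assumes C: "subcategory (C :: 'u ustruct set)" "closed_under_products C"
      "closed_under_closed_subspaces C" "algebraic_category C"
    and ind: "\<And>Y. Y \<in> C \<Longrightarrow> uindiscrete Y"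
    and N: "N \<in> C" "n0 \<in> points N" "n1 \<in> points N" "n0 \<noteq> n1"
    and S: "unif_space S" "small (points S)" "uindiscrete S"
  shows "S \<in> C"
proof (cases "points S = {}")
  \<comment> \<open>The retraction \<sigma> needs a default point \<open>s0\<close>. The empty space
    is instead a closed subspace of \<open>N\<close>.\<close>
  case True
  note uN = subcategoryD(1)[OF C(1) N(1)]
  have "entourages (usubspace N {}) = {{}}"
    unfolding entourages_usubspace using entourage_UNIV[OF uN] by auto
  then have "usubspace N {} = S"
    using True S(3) by (intro ustruct.equality) (simp_all add: uindiscrete_def)
  then show ?thesis using closed_subspace_in[OF C(3) N(1), of "{}"] by simp
next
  case False
  then obtain s0 where s0: "s0 \<in> points S" by blast
  note uC = subcategoryD(1)[OF C(1)]
  have "points S \<prec> (UNIV :: 'u set)" using S(2) unfolding small_def .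
  then obtain Y \<pi> where Y: "Y \<in> C" "product_cone (points S) (\<lambda>_. N) Y \<pi>"
    using product_cone_in[OF C(1,2), of "points S" "\<lambda>_. N"] N(1) by blast
  have "\<exists>y. y \<in> points Y \<and> (\<forall>t\<in>points S. \<pi> t y = (if t = s then n1 else n0))" for s
    by (rule ex1_implies_ex, rule product_cone_ex1[OF Y(2)]) (use N(2,3) in simp)
  then obtain \<phi> where \<phi>: "\<And>s. \<phi> s \<in> points Y"
    "\<And>s t. t \<in> points S \<Longrightarrow> \<pi> t (\<phi> s) = (if t = s then n1 else n0)" by metis
  have "inj_on \<phi> (points S)"
    by (rule inj_onI) (use \<phi>(2) N(4) in metis)
  define \<sigma> where "\<sigma> y = (if y \<in> \<phi> ` points S then inv_into (points S) \<phi> y else s0)" for y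
  have \<sigma>\<phi>: "\<sigma> (\<phi> s) = s" if "s \<in> points S" for s
    using that \<open>inj_on \<phi> (points S)\<close> by (simp add: \<sigma>_def)
  have \<sigma>S: "\<sigma> y \<in> points S" for y using s0 by (auto simp: \<sigma>_def inv_into_into)
  obtain P p r where P: "P \<in> C" "p \<in> umaps P Y" "r \<in> umaps P Y"
    "\<And>x y. x \<in> points Y \<Longrightarrow> y \<in> points Y \<Longrightarrow> \<exists>z\<in>points P. p z = x \<and> r z = y"
    using binary_product_in[OF C(1,2) Y(1) Y(1)] by metis
  \<comment> \<open>On a pair with equal \<sigma> the maps \<open>p\<close> and \<open>g\<close>
    give its two components, on any other pair they agree. Coequalizing them identifies precisely
    the points with equal \<sigma>.\<close>
  define g where "g = (\<lambda>z\<in>points P. if \<sigma> (p z) = \<sigma> (r z) then r z else p z)"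
  have g: "g \<in> umaps P Y"
    by (rule umaps_into_indiscrete[OF uC[OF P(1)] ind[OF Y(1)]])
      (use umapsD(2)[OF P(2)] umapsD(2)[OF P(3)] in \<open>auto simp: g_def\<close>)
  obtain Q q where q: "coequalizer (full_on Unif C) P Y p g Q q"
    using C(4)[unfolded algebraic_category_def, THEN conjunct1, unfolded has_coequalizers_def,
        rule_format, of P Y p g] P(1,2) Y(1) g by auto
  then have Q: "Q \<in> C" "q \<in> umaps Y Q" "compose (points P) q p = compose (points P) q g"
    unfolding coequalizer_def by simp_all
  have surj: "q ` points Y = points Q"
    using algebraic_regular_epi_surj[OF C(1,4) Y(1) q P(1,2) g] .
  have fib: "q y = q y'" if y: "y \<in> points Y" "y' \<in> points Y" "\<sigma> y = \<sigma> y'" for y y'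
  proof -
    obtain z where z: "z \<in> points P" "p z = y" "r z = y'" using P(4)[OF y(1,2)] by blast
    have "compose (points P) q p z = compose (points P) q g z" using Q(3) by simp
    then show ?thesis using z y(3) by (simp add: compose_def g_def)
  qed
  \<comment> \<open>Different fibres of \<sigma> stay apart because the indicator of a fibre, as a
    map into the indiscrete space \<open>N\<close>, is a morphism that equalizes \<open>p\<close>
    and \<open>g\<close> and so factors through \<open>q\<close>.\<close>
  have sep: "s = t" if st: "s \<in> points S" "t \<in> points S" "q (\<phi> s) = q (\<phi> t)" for s t
  proof -
    define h where "h = (\<lambda>y\<in>points Y. if \<sigma> y = s then n1 else n0)"
    have h: "h \<in> umaps Y N"
      by (rule umaps_into_indiscrete[OF uC[OF Y(1)] ind[OF N(1)]]) (use N in \<open>auto simp: h_def\<close>)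
    have "compose (points P) h p = compose (points P) h g"
      using umapsD(2)[OF P(2)] umapsD(2)[OF P(3)] by (auto simp: compose_def fun_eq_iff h_def g_def)
    then obtain k where k: "compose (points Y) k q = h"
      using coequalizer_factor[OF q, of N h] N(1) h by auto
    have "h (\<phi> s) = h (\<phi> t)"
      using fun_cong[OF k, of "\<phi> s"] fun_cong[OF k, of "\<phi> t"] \<phi>(1) st(3) by (simp add: compose_def)
    then show ?thesis using \<phi>(1) \<sigma>\<phi>[OF st(1)] \<sigma>\<phi>[OF st(2)] N(4) by (simp add: h_def split: if_splits)
  qed
  have "bij_betw (\<lambda>s. q (\<phi> s)) (points S) (points Q)"
    unfolding bij_betw_def
  proof
    show "inj_on (\<lambda>s. q (\<phi> s)) (points S)" using sep by (rule inj_onI)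
    show "(\<lambda>s. q (\<phi> s)) ` points S = points Q"
    proof
      show "(\<lambda>s. q (\<phi> s)) ` points S \<subseteq> points Q" using umapsD(2)[OF Q(2) \<phi>(1)] by blast
      show "points Q \<subseteq> (\<lambda>s. q (\<phi> s)) ` points S"
      proof
        fix x assume "x \<in> points Q"
        then obtain y where y: "y \<in> points Y" "x = q y" using surj by blast
        have "q y = q (\<phi> (\<sigma> y))" by (rule fib[OF y(1) \<phi>(1)]) (simp add: \<sigma>\<phi>[OF \<sigma>S])
        then show "x \<in> (\<lambda>s. q (\<phi> s)) ` points S" using y(2) \<sigma>S by blast
      qed
    qed
  qed
  from uiso_sym[OF uiso_indiscrete[OF S(1,3) uC[OF Q(1)] ind[OF Q(1)] this]]
  show ?thesis using subcategoryD(3)[OF C(1) Q(1) S(1,2)] by blast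
qed

lemma algebraic_non_Hausdorff_eq_indiscrete_spaces:
  assumes C: "subcategory (C :: 'u ustruct set)" "closed_under_products C"
      "closed_under_closed_subspaces C" "algebraic_category C"
    and X: "X \<in> C" "\<not> Hausdorff_space (utopology X)"
  shows "C = indiscrete_spaces"
proof
  note ind = algebraic_non_Hausdorff_imp_indiscrete[OF C X]
  show "C \<subseteq> indiscrete_spaces"
    by (rule subsetI) (simp add: indiscrete_spaces_def Ob_Unif subcategoryD(1,2)[OF C(1)] ind)
  obtain n0 n1 where n: "(n0, n1) \<in> inseparable X" "n0 \<noteq> n1"
    using X(2) unfolding Hausdorff_iff_inseparable[OF subcategoryD(1)[OF C(1) X(1)]] by blast
  then have "n0 \<in> points X" "n1 \<in> points X" by (simp_all add: inseparable_iff)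
  note all = algebraic_indiscrete_all[OF C ind X(1) this n(2)]
  show "indiscrete_spaces \<subseteq> C"
    by (rule subsetI, rule all) (simp_all add: indiscrete_spaces_def Ob_Unif)
qed

end

section \<open>Compactness\<close>

lemma closedin_Collect_ball:
  assumes "unif_space P" "\<And>i. i \<in> I \<Longrightarrow> closedin (utopology P) {p \<in> points P. Q i p}"
  shows "closedin (utopology P) {p \<in> points P. \<forall>i\<in>I. Q i p}"
proof (cases "I = {}")
  case True
  then show ?thesis using assms(1) closedin_topspace[of "utopology P"] by simp
next
  case False
  then have "{p \<in> points P. \<forall>i\<in>I. Q i p} = (\<Inter>i\<in>I. {p \<in> points P. Q i p})" by blast
  moreover have "closedin (utopology P) (\<Inter>i\<in>I. {p \<in> points P. Q i p})"
    using False assms(2) by (intro closedin_INT) auto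
  ultimately show ?thesis by simp
qed

lemma closedin_Collect_conj:
  "closedin T {p \<in> S. Q p} \<Longrightarrow> closedin T {p \<in> S. R p} \<Longrightarrow> closedin T {p \<in> S. Q p \<and> R p}"
  using closedin_Int[of T "{p \<in> S. Q p}" "{p \<in> S. R p}"] by (simp add: Collect_conj_eq Int_ac)

lemma closedin_Collect_disj:
  assumes "closedin T {p \<in> S. Q p}" "closedin T {p \<in> S. R p}"
  shows "closedin T {p \<in> S. Q p \<or> R p}"
proof -
  have "{p \<in> S. Q p \<or> R p} = {p \<in> S. Q p} \<union> {p \<in> S. R p}" by blast
  then show ?thesis using closedin_Un[OF assms] by simp
qed

lemma closedin_umap_preimage:
  assumes "unif_space P" "unif_space X" "f \<in> umaps P X" "closedin (utopology X) A"
  shows "closedin (utopology P) {p \<in> points P. f p \<in> A}"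
  using closedin_continuous_map_preimage[OF umaps_imp_continuous[OF assms(1-3)] assms(4)] assms(1)
  by simp

text \<open>In the cardinal order of \<U> every \<open>underS\<close> set has smaller cardinality
  than \<U>, so by minimality it is not a bad cover. It consists of open sets, and a finite subcover
  of it would be one of \<U>; hence it can only fail to cover.\<close>

lemma noncompact_minimal_cover:
  assumes "\<not> compact_space T"
  obtains \<U> where "\<And>V. V \<in> \<U> \<Longrightarrow> openin T V" "topspace T \<subseteq> \<Union>\<U>" "infinite \<U>"
    "\<And>V. V \<in> \<U> \<Longrightarrow> \<not> topspace T \<subseteq> \<Union>(underS (card_of \<U>) V)"
proof -
  define bad where "bad \<V> \<longleftrightarrow> (\<forall>V\<in>\<V>. openin T V) \<and> topspace T \<subseteq> \<Union>\<V> \<and>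
    \<not> (\<exists>\<F>. finite \<F> \<and> \<F> \<subseteq> \<V> \<and> topspace T \<subseteq> \<Union>\<F>)" for \<V>
  obtain \<V> where "bad \<V>" using assms unfolding compact_space_alt bad_def by meson
  moreover have "wf (inv_image ordLess card_of :: ('a set set \<times> 'a set set) set)"
    by (rule wf_inv_image[OF wf_ordLess])
  ultimately obtain \<U> where \<U>: "bad \<U>" "\<And>\<V>. (\<V>, \<U>) \<in> inv_image ordLess card_of \<Longrightarrow> \<not> bad \<V>"
    using wfE_min[of "inv_image ordLess card_of" \<V> "Collect bad"] by (metis mem_Collect_eq)
  show thesis
  proof (rule that)
    show "openin T V" if "V \<in> \<U>" for V using \<U>(1) that unfolding bad_def by blast
    show "topspace T \<subseteq> \<Union>\<U>" using \<U>(1) unfolding bad_def by blast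
    show "infinite \<U>" using \<U>(1) unfolding bad_def by blast
    fix V assume V: "V \<in> \<U>"
    have sub: "underS (card_of \<U>) V \<subseteq> \<U>"
      using Order_Relation.underS_Field[of "card_of \<U>" V] by (simp add: Field_card_of)
    have "(card_of (underS (card_of \<U>) V), card_of \<U>) \<in> ordLess"
      by (rule card_of_underS[OF card_of_Card_order]) (simp add: Field_card_of V)
    then have "\<not> bad (underS (card_of \<U>) V)" using \<U>(2) by simp
    then show "\<not> topspace T \<subseteq> \<Union>(underS (card_of \<U>) V)"
      using sub \<U>(1) unfolding bad_def by (meson subset_trans subsetD)
  qed
qed

context universe begin

text \<open>Inside the product \<open>H\<close> the map \<open>c\<close> gives the segment,
  \<open>y'\<close> a point of \<open>X\<close> and \<open>z'\<close> a label with value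
  \<open>a\<close> or \<open>b\<close>. The label is a function of the segment precisely because
  \<U> covers \<open>X\<close>, so it factors through the projection to segments; the factor is the
  indicator of the full segment.\<close>

lemma algebraic_Hausdorff_imp_compact:
  assumes C: "subcategory (C :: 'u ustruct set)" "closed_under_products C"
      "closed_under_closed_subspaces C" "algebraic_category C"
    and X: "X \<in> C" and T2: "Hausdorff_space (utopology X)"
  shows "compact_space (utopology X)"
proof (rule ccontr)
  assume nc: "\<not> compact_space (utopology X)"
  note uC = subcategoryD(1)[OF C(1)]
  note uX = uC[OF X]
  obtain \<U> where \<U>: "\<And>V. V \<in> \<U> \<Longrightarrow> openin (utopology X) V" "points X \<subseteq> \<Union>\<U>" "infinite \<U>"
    "\<And>V. V \<in> \<U> \<Longrightarrow> \<not> points X \<subseteq> \<Union>(underS (card_of \<U>) V)"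
    using noncompact_minimal_cover[OF nc] unfolding topspace_utopology[OF uX] by metis
  define r where "r = card_of \<U>"
  have r: "Card_order r" "Field r = \<U>" unfolding r_def by (simp_all add: Field_card_of card_of_card_order_on)
  \<comment> \<open>An infinite cardinal order has no last element, so the full segment has no
    immediate predecessor.\<close>
  have lim: "\<exists>j\<in>\<U>. i \<noteq> j \<and> (i, j) \<in> r" if "i \<in> \<U>" for i
    using infinite_Card_order_limit[OF r(1)] r(2) \<U>(3) that by simp
  have "linear_order_on \<U> r"
    using card_order_on_well_order_on[OF r(1)] unfolding r(2) well_order_on_def by (rule conjunct1)
  then have "partial_order_on \<U> r" and total: "total_on \<U> r"
    unfolding linear_order_on_def by (rule conjunct1, rule conjunct2)
  note wo = partial_order_onD(1-3)[OF this(1)]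
  have rtotal: "(i, j) \<in> r \<or> (j, i) \<in> r" if "i \<in> \<U>" "j \<in> \<U>" for i j
    using refl_onD[OF wo(1)] total that unfolding total_on_def by metis
  have underS_trans: "j \<in> underS r k" if "(j, i) \<in> r" "i \<in> underS r k" for i j k
  proof -
    have ik: "(i, k) \<in> r" "i \<noteq> k" using that(2) unfolding underS_def by simp_all
    then have "(j, k) \<in> r" "j \<noteq> k"
      using transD[OF wo(2) that(1)] antisymD[OF wo(3)] that(1) by blast+
    then show ?thesis unfolding underS_def by simp
  qed
  \<comment> \<open>Supplies a proper segment that contains any given finite set of indices, and so
    agrees with the full segment on them. In the induction \<open>m\<close> is the larger of
    \<open>i\<close> and \<open>k\<close>, and one more element \<open>n\<close> beyond
    \<open>m\<close> makes the bound strict.\<close>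
  have bound: "\<exists>k\<in>\<U>. \<forall>j\<in>J. j \<in> underS r k" if "finite J" "J \<subseteq> \<U>" for J
    using that
  proof (induction J)
    case empty
    then show ?case using \<U>(3) by (auto simp: ex_in_conv)
  next
    case (insert i J)
    then obtain k where k: "k \<in> \<U>" "\<forall>j\<in>J. j \<in> underS r k" by auto
    obtain m where m: "m \<in> \<U>" "(k, m) \<in> r" "(i, m) \<in> r"
      using rtotal[of i k] rtotal[of i i] rtotal[of k k] k(1) insert.prems by blast
    obtain n where n: "n \<in> \<U>" "m \<noteq> n" "(m, n) \<in> r" using lim[OF m(1)] by blast
    have "j \<in> underS r n" if "(j, m) \<in> r" for j
      by (rule underS_trans[OF that]) (use n in \<open>simp add: underS_def\<close>)
    moreover have "(j, m) \<in> r" if "j \<in> J" for j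
      using k(2) that transD[OF wo(2) _ m(2)] unfolding underS_def by blast
    ultimately show ?case using m(3) n(1) by blast
  qed
  \<comment> \<open>A finite space is compact, so \<open>X\<close> has two points \<open>a\<close>
    and \<open>b\<close> to serve as truth values and as labels.\<close>
  have "infinite (points X)"
    using nc uX by (metis compact_space_def finite_imp_compactin subset_refl topspace_utopology)
  then obtain a b where ab: "a \<in> points X" "b \<in> points X" "a \<noteq> b"
    by (metis finite.emptyI finite.insertI finite_subset insertI1 subsetI)
  have cl: "closedin (utopology X) {x}" if "x \<in> points X" for x
    using closedin_Hausdorff_singleton[OF T2] that uX by simp
  have "\<U> \<subseteq> Pow (points X)" using \<U>(1) openin_subset uX by fastforce
  moreover have "Pow (points X) \<prec> (UNIV :: 'u set)"
    using subcategoryD(2)[OF C(1) X] unfolding small_def by (rule Pow_lesspoll_universe)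
  ultimately have "\<U> \<prec> (UNIV :: 'u set)" using lesspoll_trans1 subset_imp_lepoll by blast
  then obtain P \<pi> where P: "P \<in> C" "product_cone \<U> (\<lambda>_. X) P \<pi>"
    using product_cone_in[OF C(1,2), of \<U> "\<lambda>_. X"] X by blast
  note uP = uC[OF P(1)] and \<pi> = product_cone_proj[OF P(2)]
  have \<pi>cl: "closedin (utopology P) {p \<in> points P. \<pi> i p = x}" if "i \<in> \<U>" "x \<in> points X" for i x
    using closedin_umap_preimage[OF uP uX \<pi>[OF that(1)] cl[OF that(2)]] by simp
  \<comment> \<open>A point \<open>p\<close> of \<open>B\<close> stands for the initial segment of all \<open>i \<in> \<U>\<close> with \<open>\<pi> i p = b\<close>.\<close>
  define B where "B = {p \<in> points P. (\<forall>i\<in>\<U>. \<pi> i p = a \<or> \<pi> i p = b) \<and>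
    (\<forall>i\<in>\<U>. \<forall>j\<in>underS r i. \<pi> i p = a \<or> \<pi> j p = b)}"
  have under: "underS r i \<subseteq> \<U>" for i using Order_Relation.underS_Field[of r i] r(2) by simp
  have Bcl: "closedin (utopology P) B"
    unfolding B_def
    by (intro closedin_Collect_conj closedin_Collect_ball[OF uP] closedin_Collect_disj \<pi>cl ab(1,2))
      (use under in blast)+
  obtain D y z where D: "D \<in> C" "y \<in> umaps D X" "z \<in> umaps D X"
    "\<And>u v. u \<in> points X \<Longrightarrow> v \<in> points X \<Longrightarrow> \<exists>d\<in>points D. y d = u \<and> z d = v"
    using binary_product_in[OF C(1,2) X X] by metis
  obtain H c d where H: "H \<in> C" "c \<in> umaps H P" "d \<in> umaps H D"
    "\<And>u v. u \<in> points P \<Longrightarrow> v \<in> points D \<Longrightarrow> \<exists>g\<in>points H. c g = u \<and> d g = v"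
    using binary_product_in[OF C(1,2) P(1) D(1)] by metis
  note uH = uC[OF H(1)] and uD = uC[OF D(1)]
  define y' where "y' = compose (points H) y d"
  define z' where "z' = compose (points H) z d"
  have y'z': "y' \<in> umaps H X" "z' \<in> umaps H X"
    unfolding y'_def z'_def using umaps_compose[OF H(3)] D(2,3) by blast+
  have H4: "\<exists>g\<in>points H. c g = p \<and> y' g = u \<and> z' g = v"
    if "p \<in> points P" "u \<in> points X" "v \<in> points X" for p u v
    using D(4)[OF that(2,3)] H(4)[OF that(1)] unfolding y'_def z'_def by (auto simp: compose_def)
  \<comment> \<open>Label \<open>a\<close> marks a segment with a point outside all its members, a
    closed condition because the members are open. Label \<open>b\<close> marks the extra summand
    over the full segment; there \<open>y'\<close> is free, so the summand is a copy of
    \<open>X\<close>, which does no harm because \<open>p\<close> and \<open>h\<close> ignore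
    \<open>y'\<close>.\<close>
  define G where "G = {g \<in> points H. c g \<in> B \<and>
    ((z' g = a \<and> (\<forall>i\<in>\<U>. \<pi> i (c g) = a \<or> y' g \<in> points X - i)) \<or>
     (z' g = b \<and> (\<forall>i\<in>\<U>. \<pi> i (c g) = b)))}"
  have eqcl: "closedin (utopology H) {g \<in> points H. f g = x}" if "f \<in> umaps H X" "x \<in> points X" for f x
    using closedin_umap_preimage[OF uH uX that(1) cl[OF that(2)]] by simp
  have \<pi>ccl: "closedin (utopology H) {g \<in> points H. \<pi> i (c g) = x}" if "i \<in> \<U>" "x \<in> points X" for i x
  proof -
    have "c g \<in> points P" if "g \<in> points H" for g using umapsD(2)[OF H(2) that] .
    then have "{g \<in> points H. \<pi> i (c g) = x} = {g \<in> points H. c g \<in> {p \<in> points P. \<pi> i p = x}}" by auto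
    then show ?thesis using closedin_umap_preimage[OF uH uP H(2) \<pi>cl[OF that]] by simp
  qed
  have y'cl: "closedin (utopology H) {g \<in> points H. y' g \<in> points X - i}" if "i \<in> \<U>" for i
    by (rule closedin_umap_preimage[OF uH uX y'z'(1)])
      (use closedin_diff[OF closedin_topspace \<U>(1)[OF that]] uX in simp)
  have Gcl: "closedin (utopology H) G"
    unfolding G_def
    by (intro closedin_Collect_conj closedin_Collect_ball[OF uH] closedin_Collect_disj \<pi>ccl y'cl
        eqcl y'z' ab(1,2) closedin_umap_preimage[OF uH uP H(2) Bcl])
  have sub: "B \<subseteq> points P" "G \<subseteq> points H" by (auto simp: B_def G_def)
  define BS where "BS = usubspace P B"
  define GS where "GS = usubspace H G"
  have BS: "BS \<in> C" and GS: "GS \<in> C"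
    unfolding BS_def GS_def using closed_subspace_in[OF C(3)] P(1) H(1) Bcl Gcl by blast+
  have [simp]: "points BS = B" "points GS = G" by (simp_all add: BS_def GS_def)
  define p where "p = restrict c G"
  define h where "h = restrict z' G"
  have p: "p \<in> umaps GS BS"
    unfolding p_def GS_def BS_def
    by (intro umaps_usubspace_codomain[OF uP sub(1)] umaps_restrict[OF uH sub(2) H(2)])
      (auto simp: G_def)
  have h: "h \<in> umaps GS X"
    unfolding h_def GS_def by (rule umaps_restrict[OF uH sub(2) y'z'(2)])
  have surj: "p ` points GS = points BS"
  proof
    show "p ` points GS \<subseteq> points BS" using umapsD(2)[OF p] by blast
    show "points BS \<subseteq> p ` points GS"
    proof
      fix x assume "x \<in> points BS"
      then have x: "x \<in> B" "x \<in> points P" by (auto simp: B_def)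
      have "\<exists>g\<in>G. c g = x"
      proof (cases "\<forall>i\<in>\<U>. \<pi> i x = b")
        case True
        obtain g where g: "g \<in> points H" "c g = x" "y' g = a" "z' g = b"
          using H4[OF x(2) ab(1,2)] by blast
        then have "g \<in> G" unfolding G_def using x(1) True by simp
        then show ?thesis using g(2) by blast
      next
        case False
        then obtain k where k: "k \<in> \<U>" "\<pi> k x \<noteq> b" by blast
        \<comment> \<open>The index \<open>k\<close> lies outside the segment coded by
          \<open>x\<close>, so this segment is contained in \<open>underS r k\<close>. By minimality
          of the cover some point \<open>u\<close> is missed by all members of
          \<open>underS r k\<close>.\<close>
        obtain u where u: "u \<in> points X" "u \<notin> \<Union>(underS r k)" using \<U>(4)[OF k(1)] unfolding r_def by blast
        obtain g where g: "g \<in> points H" "c g = x" "y' g = u" "z' g = a"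
          using H4[OF x(2) u(1) ab(1)] by blast
        have "\<pi> i x = a \<or> u \<in> points X - i" if i: "i \<in> \<U>" for i
        proof (cases "i \<in> underS r k")
          case True
          then show ?thesis using u by blast
        next
          case False
          then have "i = k \<or> k \<in> underS r i" using rtotal[OF i k(1)] unfolding underS_def by auto
          moreover have "\<pi> i x = a" if "k \<in> underS r i" using x(1) i k that unfolding B_def by blast
          moreover have "\<pi> k x = a" using x(1) k unfolding B_def by blast
          ultimately show ?thesis by blast
        qed
        then have "g \<in> G" unfolding G_def using x(1) g by simp
        then show ?thesis using g(2) by blast
      qed
      then show "x \<in> p ` points GS" unfolding p_def by force
    qed
  qed
  \<comment> \<open>Over the full segment label \<open>a\<close> would require a point of
    \<open>X\<close> that no member of \<U> contains; over a proper segment label \<open>b\<close>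
    is excluded by definition.\<close>
  have zb: "z' g = (if \<forall>i\<in>\<U>. \<pi> i (c g) = b then b else a)" if g: "g \<in> G" for g
  proof (cases "\<forall>i\<in>\<U>. \<pi> i (c g) = b")
    case True
    have "y' g \<in> points X" using umapsD(2)[OF y'z'(1)] g sub(2) by blast
    then obtain i where "i \<in> \<U>" "y' g \<in> i" using \<U>(2) by blast
    then have "\<not> (\<forall>i\<in>\<U>. \<pi> i (c g) = a \<or> y' g \<in> points X - i)" using True ab(3) by force
    then show ?thesis using g True unfolding G_def by auto
  next
    case False
    then show ?thesis using g unfolding G_def by auto
  qed
  have "h u = h v" if "u \<in> points GS" "v \<in> points GS" "p u = p v" for u v
    using that zb by (simp add: h_def p_def)
  then obtain k where k: "k \<in> umaps BS X" "\<And>g. g \<in> points GS \<Longrightarrow> k (p g) = h g"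
    using algebraic_factor[OF C(1,4) GS BS X p surj h] by blast
  have kx: "k x = (if \<forall>i\<in>\<U>. \<pi> i x = b then b else a)" if x: "x \<in> B" for x
  proof -
    obtain g where g: "g \<in> G" "x = p g" using surj x by auto
    then show ?thesis using k(2)[of g] zb[OF g(1)] by (simp add: h_def p_def)
  qed
  \<comment> \<open>The indicator \<open>k\<close> would isolate the full segment in
    \<open>B\<close>. A basic entourage tests only finitely many coordinates \<open>J\<close>, and
    there the full segment \<open>s\<close> and the proper segment \<open>t\<close> below
    \<open>n\<close> agree.\<close>
  obtain E where E: "E \<in> entourages X" "(b, a) \<notin> E"
    using T2 ab unfolding Hausdorff_utopology_iff[OF uX] by metis
  obtain F where F: "F \<in> entourages P" "{(x, x') \<in> B \<times> B. (k x, k x') \<in> E} = F \<inter> (B \<times> B)"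
    using umapsD(4)[OF k(1) E(1)] unfolding BS_def entourages_usubspace by auto
  obtain J K where JK: "finite J" "J \<subseteq> \<U>" "\<forall>j\<in>J. K j \<in> entourages X"
    "{(p, q) \<in> points P \<times> points P. \<forall>j\<in>J. (\<pi> j p, \<pi> j q) \<in> K j} \<subseteq> F"
    using P(2) F(1) unfolding product_cone_def initial_source_def by blast
  obtain n where n: "n \<in> \<U>" "\<forall>j\<in>J. j \<in> underS r n" using bound[OF JK(1,2)] by blast
  obtain s where s: "s \<in> points P" "\<And>i. i \<in> \<U> \<Longrightarrow> \<pi> i s = b"
    using product_cone_point[OF P(2), of "\<lambda>_. b"] ab(2) by blast
  obtain t where t: "t \<in> points P" "\<And>i. i \<in> \<U> \<Longrightarrow> \<pi> i t = (if i \<in> underS r n then b else a)"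
    by (rule product_cone_point[OF P(2), of "\<lambda>i. if i \<in> underS r n then b else a"]) (use ab in auto)
  have sB: "s \<in> B" unfolding B_def using s under by auto
  have "j \<in> underS r n" if "j \<in> underS r i" "i \<in> underS r n" for i j
    using that underS_trans[of j i n] unfolding underS_def by simp
  then have tB: "t \<in> B" unfolding B_def using t under by (auto simp: subset_iff)
  have "(\<pi> j s, \<pi> j t) \<in> K j" if "j \<in> J" for j
    using s(2)[of j] t(2)[of j] n(2) JK(2,3) that entourage_refl[OF uX _ ab(2)] by auto
  then have "(s, t) \<in> F" using JK(4) s(1) t(1) by blast
  then have "(s, t) \<in> {(x, x') \<in> B \<times> B. (k x, k x') \<in> E}" unfolding F(2) using sB tB by blast
  then have "(k s, k t) \<in> E" by simp
  moreover have "k s = b" using kx[OF sB] s(2) by simp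
  moreover have "n \<notin> underS r n" unfolding underS_def by blast
  then have "k t = a" using kx[OF tB] t(2)[OF n(1)] n(1) ab(3) by auto
  ultimately show False using E(2) by simp
qed

end

section \<open>A criterion for algebraicity\<close>

text \<open>The functor acts on maps by unique lifting along \<eta>, so its laws follow from
  uniqueness of lifts. Both naturality conditions then reduce to associativity of
  \<open>compose\<close>, which for extensional maps needs the inner map to land in the middle
  domain.\<close>

lemma left_adjoint_if_universal_arrows:
  fixes C :: "'a ustruct set" and F :: "'a set \<Rightarrow> 'a ustruct" and \<eta> :: "'a set \<Rightarrow> 'a \<Rightarrow> 'a"
  assumes C: "subcategory C"
    and F: "\<And>A. small A \<Longrightarrow> F A \<in> C" "\<And>A. small A \<Longrightarrow> \<eta> A \<in> A \<rightarrow>\<^sub>E points (F A)"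
    and univ: "\<And>A Y f. small A \<Longrightarrow> Y \<in> C \<Longrightarrow> f \<in> A \<rightarrow>\<^sub>E points Y \<Longrightarrow>
      \<exists>!g. g \<in> umaps (F A) Y \<and> compose A g (\<eta> A) = f"
  shows "\<exists>L. left_adjoint (full_on Unif C) SetCat L forget"
proof -
  define lift where "lift A Y f = (THE g. g \<in> umaps (F A) Y \<and> compose A g (\<eta> A) = f)"
    for A and Y :: "'a ustruct" and f :: "'a \<Rightarrow> 'a"
  have lift: "lift A Y f \<in> umaps (F A) Y" "compose A (lift A Y f) (\<eta> A) = f"
    if "small A" "Y \<in> C" "f \<in> A \<rightarrow>\<^sub>E points Y" for A Y f
    using theI'[OF univ[OF that]] unfolding lift_def by simp_all
  have uniq: "g = h" if "small A" "Y \<in> C" "g \<in> umaps (F A) Y" "h \<in> umaps (F A) Y"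
    "compose A g (\<eta> A) = compose A h (\<eta> A)" for A Y g h
  proof -
    have "compose A h (\<eta> A) \<in> A \<rightarrow>\<^sub>E points Y"
      using F(2)[OF that(1)] umapsD(2)[OF that(4)] by (auto simp: compose_def PiE_iff)
    from univ[OF that(1,2) this] show ?thesis using that(3-5) by blast
  qed
  have comp_in: "compose A g f \<in> A \<rightarrow>\<^sub>E D" if "f \<in> A \<rightarrow>\<^sub>E B" "\<And>b. b \<in> B \<Longrightarrow> g b \<in> D"
    for A B D :: "'a set" and f g :: "'a \<Rightarrow> 'a"
    using that by (auto simp: compose_def PiE_iff)
  have comp_assoc: "compose A h (compose A g f) = compose A (compose B h g) f" if "f \<in> A \<rightarrow>\<^sub>E B"
    for A B :: "'a set" and f g h :: "'a \<Rightarrow> 'a"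
    using that by (auto simp: compose_def PiE_iff fun_eq_iff)
  have idl: "compose A (\<lambda>x\<in>B. x) f = f" if "f \<in> A \<rightarrow>\<^sub>E B" for A B :: "'a set" and f :: "'a \<Rightarrow> 'a"
    using that by (auto simp: compose_def PiE_iff fun_eq_iff extensional_def)
  have idr: "compose A f (\<lambda>x\<in>A. x) = f" if "f \<in> A \<rightarrow>\<^sub>E B" for A B :: "'a set" and f :: "'a \<Rightarrow> 'a"
    using that by (auto simp: compose_def PiE_iff fun_eq_iff extensional_def)
  define L where "L = \<lparr>obmap = F, homap = (\<lambda>A B h. lift A (F B) (compose A (\<eta> B) h))\<rparr>"
  have [simp]: "obmap L = F" and Lh: "homap L A B h = lift A (F B) (compose A (\<eta> B) h)" for A B h
    by (simp_all add: L_def)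
  have \<eta>h: "compose A (\<eta> B) h \<in> A \<rightarrow>\<^sub>E points (F B)" if "small B" "h \<in> A \<rightarrow>\<^sub>E B" for A B :: "'a set" and h :: "'a \<Rightarrow> 'a"
    using F(2)[OF that(1)] that(2) by (intro comp_in[of h A B]) auto
  have homap: "homap L A B h \<in> umaps (F A) (F B)"
    "compose A (homap L A B h) (\<eta> A) = compose A (\<eta> B) h"
    if "small A" "small B" "h \<in> A \<rightarrow>\<^sub>E B" for A B :: "'a set" and h :: "'a \<Rightarrow> 'a"
    unfolding Lh using lift[OF that(1) F(1)[OF that(2)] \<eta>h[OF that(2,3)]] by blast+
  have uF: "unif_space (F A)" if "small A" for A using subcategoryD(1)[OF C F(1)[OF that]] .
  have "is_functor SetCat (full_on Unif C) L"
    unfolding is_functor_def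
  proof (intro conjI ballI)
    fix A :: "'a set" assume "A \<in> Ob SetCat"
    then have A: "small A" by simp
    show "obmap L A \<in> Ob (full_on Unif C)" using F(1)[OF A] by simp
    have id: "(\<lambda>x\<in>A. x) \<in> A \<rightarrow>\<^sub>E A" by auto
    have "homap L A A (\<lambda>x\<in>A. x) = (\<lambda>x\<in>points (F A). x)"
      by (rule uniq[OF A F(1)[OF A] homap(1)[OF A A id] umaps_id[OF uF[OF A]]])
        (simp add: homap(2)[OF A A id] idl[OF F(2)[OF A]] idr[OF F(2)[OF A]])
    then show "homap L A A (Ident SetCat A) = Ident (full_on Unif C) (obmap L A)" by simp
    fix B :: "'a set" assume "B \<in> Ob SetCat"
    then have B: "small B" by simp
    show "homap L A B f \<in> Hom (full_on Unif C) (obmap L A) (obmap L B)" if "f \<in> Hom SetCat A B" for f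
      using homap(1)[OF A B] that by simp
    fix D :: "'a set" and f g assume "D \<in> Ob SetCat" "f \<in> Hom SetCat A B" "g \<in> Hom SetCat B D"
    then have D: "small D" and f: "f \<in> A \<rightarrow>\<^sub>E B" and g: "g \<in> B \<rightarrow>\<^sub>E D" by simp_all
    have gf: "compose A g f \<in> A \<rightarrow>\<^sub>E D" using f g by (intro comp_in[OF f]) auto
    have "homap L A D (compose A g f) = compose (points (F A)) (homap L B D g) (homap L A B f)"
    proof (rule uniq[OF A F(1)[OF D] homap(1)[OF A D gf] umaps_compose[OF homap(1)[OF A B f] homap(1)[OF B D g]]])
      have "compose A (compose (points (F A)) (homap L B D g) (homap L A B f)) (\<eta> A)
          = compose A (homap L B D g) (compose A (\<eta> B) f)"
        unfolding homap(2)[OF A B f, symmetric] by (rule comp_assoc[OF F(2)[OF A], symmetric])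
      also have "\<dots> = compose A (compose B (\<eta> D) g) f"
        unfolding homap(2)[OF B D g, symmetric] by (rule comp_assoc[OF f])
      also have "\<dots> = compose A (\<eta> D) (compose A g f)" by (rule comp_assoc[OF f, symmetric])
      finally show "compose A (homap L A D (compose A g f)) (\<eta> A) =
          compose A (compose (points (F A)) (homap L B D g) (homap L A B f)) (\<eta> A)"
        using homap(2)[OF A D gf] by simp
    qed
    then show "homap L A D (Comp SetCat A B D g f) =
        Comp (full_on Unif C) (obmap L A) (obmap L B) (obmap L D) (homap L B D g) (homap L A B f)"
      by simp
  qed
  show ?thesis
    unfolding left_adjoint_def
  proof (intro exI[of _ L] conjI exI[of _ "\<lambda>A Y g. compose A g (\<eta> A)"] ballI)
    show "is_functor SetCat (full_on Unif C) L" by fact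
  next
    fix A :: "'a set" and Y :: "'a ustruct" assume "A \<in> Ob SetCat" "Y \<in> Ob (full_on Unif C)"
    then have A: "small A" and Y: "Y \<in> C" by simp_all
    have "bij_betw (\<lambda>g. compose A g (\<eta> A)) (umaps (F A) Y) (A \<rightarrow>\<^sub>E points Y)"
      unfolding bij_betw_def
    proof
      show "inj_on (\<lambda>g. compose A g (\<eta> A)) (umaps (F A) Y)"
        by (rule inj_onI) (rule uniq[OF A Y])
      show "(\<lambda>g. compose A g (\<eta> A)) ` umaps (F A) Y = A \<rightarrow>\<^sub>E points Y"
      proof
        show "(\<lambda>g. compose A g (\<eta> A)) ` umaps (F A) Y \<subseteq> A \<rightarrow>\<^sub>E points Y"
          by (rule image_subsetI, rule comp_in[OF F(2)[OF A]]) (rule umapsD(2))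
        show "A \<rightarrow>\<^sub>E points Y \<subseteq> (\<lambda>g. compose A g (\<eta> A)) ` umaps (F A) Y"
        proof
          fix f assume "f \<in> A \<rightarrow>\<^sub>E points Y"
          from lift[OF A Y this] show "f \<in> (\<lambda>g. compose A g (\<eta> A)) ` umaps (F A) Y" by force
        qed
      qed
    qed
    then show "bij_betw (\<lambda>g. compose A g (\<eta> A)) (Hom (full_on Unif C) (obmap L A) Y)
        (Hom SetCat A (obmap forget Y))" by simp
  next
    fix A A' :: "'a set" and Y :: "'a ustruct" and h f :: "'a \<Rightarrow> 'a"
    assume "A \<in> Ob SetCat" "A' \<in> Ob SetCat" "h \<in> Hom SetCat A' A"
    then have A: "small A" "small A'" and h: "h \<in> A' \<rightarrow>\<^sub>E A" by simp_all
    have "compose A' (compose (points (F A')) f (homap L A' A h)) (\<eta> A')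
        = compose A' f (compose A' (\<eta> A) h)"
      unfolding homap(2)[OF A(2,1) h, symmetric] by (rule comp_assoc[OF F(2)[OF A(2)], symmetric])
    also have "\<dots> = compose A' (compose A f (\<eta> A)) h" by (rule comp_assoc[OF h])
    finally show "compose A' (Comp (full_on Unif C) (obmap L A') (obmap L A) Y f (homap L A' A h)) (\<eta> A')
        = Comp SetCat A' A (obmap forget Y) (compose A f (\<eta> A)) h" by simp
  next
    fix A :: "'a set" and Y Y' :: "'a ustruct" and k f :: "'a \<Rightarrow> 'a" assume "A \<in> Ob SetCat"
    then have A: "small A" by simp
    show "compose A (Comp (full_on Unif C) (obmap L A) Y Y' k f) (\<eta> A) =
        Comp SetCat A (obmap forget Y) (obmap forget Y') (homap forget Y Y' k) (compose A f (\<eta> A))"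
      using comp_assoc[OF F(2)[OF A], of k f] by simp
  qed
qed

context universe begin

text \<open>Condition \<open>img\<close> forces regular epimorphisms to be onto, since the image
  absorbs the factor; \<open>ker\<close> and \<open>quot\<close> make a surjection the coequalizer
  of its kernel pair, the factor existing as a function and being a morphism by
  \<open>quot\<close>.\<close>

lemma algebraic_categoryI:
  assumes C: "subcategory (C :: 'u ustruct set)"
    and coeq: "\<And>X Y f g. X \<in> C \<Longrightarrow> Y \<in> C \<Longrightarrow> f \<in> umaps X Y \<Longrightarrow> g \<in> umaps X Y \<Longrightarrow>
      \<exists>Q q. coequalizer (full_on Unif C) X Y f g Q q"
    and img: "\<And>X Y f. X \<in> C \<Longrightarrow> Y \<in> C \<Longrightarrow> f \<in> umaps X Y \<Longrightarrow>
      \<exists>Z\<in>C. points Z = f ` points X \<and> f \<in> umaps X Z \<and> (\<lambda>z\<in>points Z. z) \<in> umaps Z Y"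
    and ker: "\<And>X Y f. X \<in> C \<Longrightarrow> Y \<in> C \<Longrightarrow> f \<in> umaps X Y \<Longrightarrow>
      \<exists>P\<in>C. \<exists>u\<in>umaps P X. \<exists>v\<in>umaps P X. (\<forall>z\<in>points P. f (u z) = f (v z)) \<and>
        (\<forall>x\<in>points X. \<forall>y\<in>points X. f x = f y \<longrightarrow> (\<exists>z\<in>points P. u z = x \<and> v z = y))"
    and quot: "\<And>X Y Z f k. X \<in> C \<Longrightarrow> Y \<in> C \<Longrightarrow> Z \<in> C \<Longrightarrow> f \<in> umaps X Y \<Longrightarrow> f ` points X = points Y \<Longrightarrow>
      k \<in> extensional (points Y) \<Longrightarrow> compose (points X) k f \<in> umaps X Z \<Longrightarrow> k \<in> umaps Y Z"
    and free: "\<And>A :: 'u set. small A \<Longrightarrow> \<exists>F\<in>C. \<exists>\<eta>\<in>A \<rightarrow>\<^sub>E points F. \<forall>Y\<in>C. \<forall>f\<in>A \<rightarrow>\<^sub>E points Y.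
      \<exists>!g. g \<in> umaps F Y \<and> compose A g \<eta> = f"
  shows "algebraic_category C"
  unfolding algebraic_category_def
proof (intro conjI)
  show "has_coequalizers (full_on Unif C)"
    unfolding has_coequalizers_def using coeq by simp
  define univ where "univ A F \<eta> \<longleftrightarrow> F \<in> C \<and> \<eta> \<in> A \<rightarrow>\<^sub>E points F \<and> (\<forall>Y\<in>C. \<forall>f\<in>A \<rightarrow>\<^sub>E points Y.
      \<exists>!g. g \<in> umaps F Y \<and> compose A g \<eta> = f)" for A :: "'u set" and F \<eta>
  have "\<exists>F \<eta>. univ A F \<eta>" if "small A" for A
    using free[OF that] unfolding univ_def by (elim bexE) (intro exI conjI)
  then obtain F \<eta> where F: "\<And>A. small A \<Longrightarrow> univ A (F A) (\<eta> A)" by metis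
  show "\<exists>L. left_adjoint (full_on Unif C) SetCat L forget"
  proof (rule left_adjoint_if_universal_arrows[OF C, of F \<eta>])
    fix A :: "'u set" assume "small A"
    note FA = F[OF this, unfolded univ_def]
    then show "F A \<in> C" "\<eta> A \<in> A \<rightarrow>\<^sub>E points (F A)" by simp_all
    show "\<exists>!g. g \<in> umaps (F A) Y \<and> compose A g (\<eta> A) = f" if "Y \<in> C" "f \<in> A \<rightarrow>\<^sub>E points Y" for Y f
      using FA that by simp
  qed
  show "preserves_regular_epis (full_on Unif C) SetCat forget"
    unfolding preserves_regular_epis_def
  proof (intro ballI impI)
    fix X Y f assume "X \<in> Ob (full_on Unif C)" "Y \<in> Ob (full_on Unif C)"
      "f \<in> Hom (full_on Unif C) X Y" "regular_epi (full_on Unif C) X Y f"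
    then obtain W u v where X: "X \<in> C" and Y: "Y \<in> C" and f: "f \<in> umaps X Y"
      and co: "coequalizer (full_on Unif C) W X u v Y f"
      unfolding regular_epi_def by auto
    obtain Z where Z: "Z \<in> C" "points Z = f ` points X" "f \<in> umaps X Z" "(\<lambda>z\<in>points Z. z) \<in> umaps Z Y"
      using img[OF X Y f] by blast
    have eq: "compose (points W) f u = compose (points W) f v" using co unfolding coequalizer_def by simp
    \<comment> \<open>The coequalizer \<open>f\<close> factors through its own image. The factor
      followed by the inclusion fixes \<open>f\<close>, hence is the identity, and the image is
      everything.\<close>
    obtain k where k: "k \<in> umaps Y Z" "compose (points X) k f = f"
      using coequalizer_factor[OF co, of Z f] Z eq by auto
    have "\<exists>!k. k \<in> umaps Y Y \<and> compose (points X) k f = f"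
      using coequalizer_factor[OF co, of Y f] Y f eq by simp
    moreover have "(\<lambda>y\<in>points Y. y) \<in> umaps Y Y" "compose (points X) (\<lambda>y\<in>points Y. y) f = f"
      using umaps_id[OF subcategoryD(1)[OF C Y]] umapsD(2,3)[OF f] by (auto simp: compose_def fun_eq_iff)
    moreover have "compose (points Y) (\<lambda>z\<in>points Z. z) k \<in> umaps Y Y"
      by (rule umaps_compose[OF k(1) Z(4)])
    moreover have "compose (points X) (compose (points Y) (\<lambda>z\<in>points Z. z) k) f = f"
    proof
      fix x
      have "k (f x) = f x" if "x \<in> points X" using fun_cong[OF k(2), of x] that by (simp add: compose_def)
      then show "compose (points X) (compose (points Y) (\<lambda>z\<in>points Z. z) k) f x = f x"
        using umapsD(2,3)[OF f, of x] Z(2) by (auto simp: compose_def)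
    qed
    ultimately have id: "compose (points Y) (\<lambda>z\<in>points Z. z) k = (\<lambda>y\<in>points Y. y)" by blast
    have "y \<in> f ` points X" if "y \<in> points Y" for y
      using fun_cong[OF id, of y] that umapsD(2)[OF k(1) that] Z(2) by (auto simp: compose_def)
    then have "f ` points X = points Y" using umapsD(2)[OF f] by blast
    then show "regular_epi SetCat (obmap forget X) (obmap forget Y) (homap forget X Y f)"
      using regular_epi_SetCat_iff[OF subcategoryD(2)[OF C X] umapsD(1)[OF f]] subcategoryD(2)[OF C Y]
      by simp
  qed
  show "reflects_regular_epis (full_on Unif C) SetCat forget"
    unfolding reflects_regular_epis_def
  proof (intro ballI impI)
    fix X Y f assume "X \<in> Ob (full_on Unif C)" "Y \<in> Ob (full_on Unif C)"
      "f \<in> Hom (full_on Unif C) X Y"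
      and reg: "regular_epi SetCat (obmap forget X) (obmap forget Y) (homap forget X Y f)"
    then have X: "X \<in> C" and Y: "Y \<in> C" and f: "f \<in> umaps X Y" by simp_all
    have surj: "f ` points X = points Y"
      using reg regular_epi_SetCat_iff[OF subcategoryD(2)[OF C X] umapsD(1)[OF f]] by simp
    obtain P u v where P: "P \<in> C" "u \<in> umaps P X" "v \<in> umaps P X"
      "\<forall>z\<in>points P. f (u z) = f (v z)"
      "\<forall>x\<in>points X. \<forall>y\<in>points X. f x = f y \<longrightarrow> (\<exists>z\<in>points P. u z = x \<and> v z = y)"
      using ker[OF X Y f] by (elim bexE conjE)
    have "coequalizer (full_on Unif C) P X u v Y f"
      unfolding coequalizer_Unif_iff
    proof (intro conjI ballI impI Y f)
      show "compose (points P) f u = compose (points P) f v"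
        using P(4) by (auto simp: compose_def fun_eq_iff)
      fix Z h assume Z: "Z \<in> C" and h: "h \<in> umaps X Z"
        and eq: "compose (points P) h u = compose (points P) h v"
      have hf: "h x = h y" if xy: "x \<in> points X" "y \<in> points X" "f x = f y" for x y
      proof -
        obtain z where "z \<in> points P" "u z = x" "v z = y" using P(5)[rule_format, OF xy] by blast
        then show ?thesis using fun_cong[OF eq, of z] by (simp add: compose_def)
      qed
      define k where "k = (\<lambda>y\<in>points Y. h (inv_into (points X) f y))"
      have kf: "k (f x) = h x" if x: "x \<in> points X" for x
      proof -
        have fx: "f x \<in> f ` points X" using x by blast
        have "h (inv_into (points X) f (f x)) = h x"
          by (rule hf[OF inv_into_into[OF fx] x f_inv_into_f[OF fx]])
        then show ?thesis using umapsD(2)[OF f x] by (simp add: k_def)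
      qed
      have kh: "compose (points X) k f = h"
        using kf umapsD(3)[OF h] by (auto simp: compose_def fun_eq_iff)
      then have "k \<in> umaps Y Z" using quot[OF X Y Z f surj, of k] h by (simp add: k_def)
      moreover have "k' = k" if k': "k' \<in> umaps Y Z" "compose (points X) k' f = h" for k'
      proof (rule umaps_eqI[OF k'(1) \<open>k \<in> umaps Y Z\<close>])
        fix y assume "y \<in> points Y"
        then obtain x where x: "x \<in> points X" "y = f x" using surj by blast
        have "compose (points X) k' f x = compose (points X) k f x" using k'(2) kh by simp
        then show "k' y = k y" using x by (simp add: compose_def)
      qed
      ultimately show "\<exists>!k. k \<in> umaps Y Z \<and> compose (points X) k f = h"
        using kh by auto
    qed
    then show "regular_epi (full_on Unif C) X Y f"
      unfolding regular_epi_def using P(1-3) by auto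
  qed
qed

text \<open>Under these conditions the forgetful functor is full and every small set is a carrier,
  so all constructions are those of sets. This covers the indiscrete and the discrete spaces
  alike.\<close>

lemma algebraic_if_like_Set:
  assumes C: "subcategory (C :: 'u ustruct set)"
    and maps: "\<And>X Y. X \<in> C \<Longrightarrow> Y \<in> C \<Longrightarrow> umaps X Y = points X \<rightarrow>\<^sub>E points Y"
    and sets: "\<And>A :: 'u set. small A \<Longrightarrow> \<exists>X\<in>C. points X = A"
  shows "algebraic_category C"
proof (rule algebraic_categoryI[OF C])
  note sC = subcategoryD(2)[OF C]
  fix X Y f g assume X: "X \<in> C" and Y: "Y \<in> C" and f: "f \<in> umaps X Y" and g: "g \<in> umaps X Y"
  \<comment> \<open>The relation to be divided out, given by all functions that equalize
    \<open>f\<close> and \<open>g\<close>. Choosing a representative \<open>q0 y\<close> of each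
    class realises the quotient on a subset of \<open>points Y\<close>.\<close>
  define R where "R y y' \<longleftrightarrow> (\<forall>h :: 'u \<Rightarrow> 'u. (\<forall>x\<in>points X. h (f x) = h (g x)) \<longrightarrow> h y = h y')" for y y'
  define q0 where "q0 y = (SOME y'. y' \<in> points Y \<and> R y y')" for y
  have q0: "q0 y \<in> points Y \<and> R y (q0 y)" if "y \<in> points Y" for y
    unfolding q0_def by (rule someI[of _ y]) (use that in \<open>simp add: R_def\<close>)
  have q0_eq: "q0 y = q0 y'" if "R y y'" for y y'
  proof -
    have "R y z = R y' z" for z using that unfolding R_def by metis
    then show ?thesis unfolding q0_def by simp
  qed
  obtain Q where Q: "Q \<in> C" "points Q = q0 ` points Y"
    using sets[OF small_subset[OF sC[OF Y]], of "q0 ` points Y"] q0 by blast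
  have "coequalizer (full_on Unif C) X Y f g Q (restrict q0 (points Y))"
    unfolding coequalizer_Unif_iff
  proof (intro conjI ballI impI Q(1))
    show "restrict q0 (points Y) \<in> umaps Y Q" using maps[OF Y Q(1)] Q(2) by auto
    have "q0 (f x) = q0 (g x)" if "x \<in> points X" for x
      by (rule q0_eq) (use that in \<open>simp add: R_def\<close>)
    then show "compose (points X) (restrict q0 (points Y)) f = compose (points X) (restrict q0 (points Y)) g"
      using umapsD(2)[OF f] umapsD(2)[OF g] by (auto simp: compose_def fun_eq_iff)
    fix Z h assume Z: "Z \<in> C" and h: "h \<in> umaps Y Z"
      and eq: "compose (points X) h f = compose (points X) h g"
    have "h (f x) = h (g x)" if "x \<in> points X" for x
      using fun_cong[OF eq, of x] that by (simp add: compose_def)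
    then have hq: "h (q0 y) = h y" if "y \<in> points Y" for y
      using q0[OF that] unfolding R_def by metis
    show "\<exists>!k. k \<in> umaps Q Z \<and> compose (points Y) k (restrict q0 (points Y)) = h"
    proof (rule ex1I[of _ "restrict h (points Q)"])
      have "restrict h (points Q) \<in> umaps Q Z"
        using maps[OF Q(1) Z] umapsD(2)[OF h] q0 Q(2) by auto
      moreover have "compose (points Y) (restrict h (points Q)) (restrict q0 (points Y)) = h"
        using hq Q(2) umapsD(3)[OF h] by (auto simp: compose_def fun_eq_iff)
      ultimately show "restrict h (points Q) \<in> umaps Q Z \<and>
          compose (points Y) (restrict h (points Q)) (restrict q0 (points Y)) = h" by simp
      fix k assume "k \<in> umaps Q Z \<and> compose (points Y) k (restrict q0 (points Y)) = h"
      then have k: "k \<in> umaps Q Z" "compose (points Y) k (restrict q0 (points Y)) = h" by simp_all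
      show "k = restrict h (points Q)"
      proof
        fix z
        have "k (q0 y) = h (q0 y)" if "y \<in> points Y" for y
          using fun_cong[OF k(2), of y] that hq[OF that] by (simp add: compose_def)
        then show "k z = restrict h (points Q) z"
          using Q(2) umapsD(3)[OF k(1), of z] by auto
      qed
    qed
  qed
  then show "\<exists>Q q. coequalizer (full_on Unif C) X Y f g Q q" by blast
next
  fix X Y f assume X: "X \<in> C" and Y: "Y \<in> C" and f: "f \<in> umaps X Y"
  have fY: "f ` points X \<subseteq> points Y" using umapsD(2)[OF f] by blast
  obtain Z where Z: "Z \<in> C" "points Z = f ` points X"
    using sets[OF small_subset[OF subcategoryD(2)[OF C Y] fY]] by blast
  have "f \<in> umaps X Z" "(\<lambda>z\<in>points Z. z) \<in> umaps Z Y"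
    using maps[OF X Z(1)] maps[OF Z(1) Y] umapsD(1)[OF f] Z(2) fY by (auto simp: PiE_iff)
  then show "\<exists>Z\<in>C. points Z = f ` points X \<and> f \<in> umaps X Z \<and> (\<lambda>z\<in>points Z. z) \<in> umaps Z Y"
    using Z by blast
  define K where "K = {(x, y) \<in> points X \<times> points X. f x = f y}"
  have "points X \<prec> (UNIV :: 'u set)" using subcategoryD(2)[OF C X] unfolding small_def .
  then have "points X \<times> points X \<prec> (UNIV :: 'u set)" by (intro Times_lesspoll_universe)
  then have "K \<prec> (UNIV :: 'u set)"
    by (rule lesspoll_trans1[rotated]) (auto simp: K_def intro: subset_imp_lepoll)
  from small_copy[OF this] obtain c :: "'u \<times> 'u \<Rightarrow> 'u" where c: "inj_on c K" "small (c ` K)" .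
  obtain P where P: "P \<in> C" "points P = c ` K" using sets[OF c(2)] by blast
  define u where "u = (\<lambda>z\<in>points P. fst (inv_into K c z))"
  define v where "v = (\<lambda>z\<in>points P. snd (inv_into K c z))"
  have uv: "u (c (x, y)) = x" "v (c (x, y)) = y" if "(x, y) \<in> K" for x y
    using inv_into_f_f[OF c(1) that] imageI[OF that, of c] P(2) unfolding u_def v_def by simp_all
  have cP: "\<exists>x y. (x, y) \<in> K \<and> z = c (x, y)" if "z \<in> points P" for z using that P(2) by auto
  have "u z \<in> points X \<and> v z \<in> points X \<and> f (u z) = f (v z)" if "z \<in> points P" for z
    using cP[OF that] uv unfolding K_def by auto
  moreover from this have "u \<in> umaps P X" "v \<in> umaps P X"
    unfolding maps[OF P(1) X] by (auto simp: u_def v_def)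
  moreover have "\<exists>z\<in>points P. u z = x \<and> v z = y"
    if "x \<in> points X" "y \<in> points X" "f x = f y" for x y
    using uv[of x y] that P(2) by (intro bexI[of _ "c (x, y)"]) (auto simp: K_def)
  ultimately show "\<exists>P\<in>C. \<exists>u\<in>umaps P X. \<exists>v\<in>umaps P X. (\<forall>z\<in>points P. f (u z) = f (v z)) \<and>
        (\<forall>x\<in>points X. \<forall>y\<in>points X. f x = f y \<longrightarrow> (\<exists>z\<in>points P. u z = x \<and> v z = y))"
    using P(1) by (intro bexI[of _ P] bexI[of _ u] bexI[of _ v]) auto
next
  fix X Y Z f k
  assume "X \<in> C" and YZ: "Y \<in> C" "Z \<in> C" and "f \<in> umaps X Y" and f: "f ` points X = points Y"
    and k: "k \<in> extensional (points Y)" "compose (points X) k f \<in> umaps X Z"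
  have "k (f x) \<in> points Z" if "x \<in> points X" for x
    using umapsD(2)[OF k(2) that] that by (simp add: compose_def)
  then have "k y \<in> points Z" if "y \<in> points Y" for y using that f by force
  then show "k \<in> umaps Y Z" unfolding maps[OF YZ] using k(1) by (auto simp: PiE_iff)
next
  fix A :: "'u set" assume "small A"
  then obtain F where F: "F \<in> C" "points F = A" using sets by blast
  have "\<exists>!g. g \<in> umaps F Y \<and> compose A g (\<lambda>x\<in>A. x) = f" if "Y \<in> C" "f \<in> A \<rightarrow>\<^sub>E points Y" for Y f
  proof (rule ex1I[of _ f])
    have eq: "compose A g (\<lambda>x\<in>A. x) = g" if "g \<in> A \<rightarrow>\<^sub>E points Y" for g
      using that by (auto simp: compose_def fun_eq_iff PiE_iff extensional_def)
    show "f \<in> umaps F Y \<and> compose A f (\<lambda>x\<in>A. x) = f"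
      using maps[OF F(1) that(1)] that(2) F(2) eq by simp
    show "g = f" if "g \<in> umaps F Y \<and> compose A g (\<lambda>x\<in>A. x) = f" for g
      using that eq[of g] maps[OF F(1) \<open>Y \<in> C\<close>] F(2) by simp
  qed
  moreover have "(\<lambda>x\<in>A. x) \<in> A \<rightarrow>\<^sub>E points F" using F(2) by auto
  ultimately show "\<exists>F\<in>C. \<exists>\<eta>\<in>A \<rightarrow>\<^sub>E points F. \<forall>Y\<in>C. \<forall>f\<in>A \<rightarrow>\<^sub>E points Y.
      \<exists>!g. g \<in> umaps F Y \<and> compose A g \<eta> = f"
    using F(1) by blast
qed

end

section \<open>Epireflective subcategories of compact Hausdorff spaces\<close>

lemma compact_T2_iff: "X \<in> compact_T2_spaces \<longleftrightarrow> unif_space X \<and> small (points X) \<and>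
    compact_space (utopology X) \<and> Hausdorff_space (utopology X)"
  by (auto simp: compact_T2_spaces_def Ob_Unif)

lemma closedin_umap_image:
  assumes X: "unif_space X" "compact_space (utopology X)"
    and Y: "unif_space Y" "Hausdorff_space (utopology Y)" and f: "f \<in> umaps X Y"
  shows "closedin (utopology Y) (f ` points X)"
proof -
  have "compactin (utopology X) (points X)"
    using X topspace_utopology[OF X(1)] unfolding compact_space_def by simp
  then show ?thesis
    by (intro compactin_imp_closedin[OF Y(2)] image_compactin[OF _ umaps_imp_continuous[OF X(1) Y(1) f]])
qed

lemma compact_T2_closed_subspace:
  assumes X: "X \<in> compact_T2_spaces" and A: "closedin (utopology X) A"
  shows "usubspace X A \<in> compact_T2_spaces"
proof -
  have uX: "unif_space X" and sX: "small (points X)" using X by (simp_all add: compact_T2_iff)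
  have sub: "A \<subseteq> points X" using closedin_subset[OF A] uX by simp
  show ?thesis
    unfolding compact_T2_iff utopology_usubspace[OF uX sub]
    using X A unif_space_usubspace[OF uX sub] small_subset[OF sX sub]
    by (auto simp: compact_T2_iff intro: compact_space_subtopology closedin_compact_space
        Hausdorff_space_subtopology)
qed

text \<open>The metric uniformity of [0,1], written with the ball of radius \<open>e\<close> as
  basic entourage.\<close>

definition unit_interval :: "real ustruct" where
  "unit_interval = \<lparr>points = {0..1}, entourages = {E. E \<subseteq> {0..1} \<times> {0..1} \<and>
     (\<exists>e>0. \<forall>x\<in>{0..1}. \<forall>y\<in>{0..1}. dist x y < e \<longrightarrow> (x, y) \<in> E)}\<rparr>"

lemma points_unit_interval [simp]: "points unit_interval = {0..1}"
  by (simp add: unit_interval_def)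

lemma entourages_unit_interval: "E \<in> entourages unit_interval \<longleftrightarrow> E \<subseteq> {0..1} \<times> {0..1} \<and>
     (\<exists>e>0. \<forall>x\<in>{0..1}. \<forall>y\<in>{0..1}. dist x y < e \<longrightarrow> (x, y) \<in> E)"
  by (simp add: unit_interval_def)

lemma unif_space_unit_interval: "unif_space unit_interval"
  unfolding unif_space_def points_unit_interval
proof (intro conjI ballI allI impI)
  let ?S = "{0..1::real}"
  show "?S \<times> ?S \<in> entourages unit_interval"
    unfolding entourages_unit_interval by (intro conjI exI[of _ 1]) auto
  fix E assume E: "E \<in> entourages unit_interval"
  then obtain e where e: "e > 0" "\<And>x y. x \<in> ?S \<Longrightarrow> y \<in> ?S \<Longrightarrow> dist x y < e \<Longrightarrow> (x, y) \<in> E"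
    unfolding entourages_unit_interval by blast
  show ES: "E \<subseteq> ?S \<times> ?S" using E unfolding entourages_unit_interval by blast
  show "Id_on ?S \<subseteq> E" using e by (auto simp: Id_on_def)
  show "E\<inverse> \<in> entourages unit_interval"
    unfolding entourages_unit_interval
    using ES e(1) e(2)[of y x for x y] by (intro conjI exI[of _ e]) (auto simp: dist_commute)
  show "\<exists>F\<in>entourages unit_interval. F O F \<subseteq> E"
  proof (rule bexI[of _ "{(x, y) \<in> ?S \<times> ?S. dist x y < e / 2}"])
    show "{(x, y) \<in> ?S \<times> ?S. dist x y < e / 2} O {(x, y) \<in> ?S \<times> ?S. dist x y < e / 2} \<subseteq> E"
    proof clarify
      fix x y z assume "x \<in> ?S" "z \<in> ?S" "dist x y < e / 2" "dist y z < e / 2"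
      then show "(x, z) \<in> E" using dist_triangle[of x z y] by (intro e(2)) auto
    qed
    show "{(x, y) \<in> ?S \<times> ?S. dist x y < e / 2} \<in> entourages unit_interval"
      unfolding entourages_unit_interval using e(1) by (intro conjI exI[of _ "e / 2"]) auto
  qed
  fix F
  { assume "E \<subseteq> F \<and> F \<subseteq> ?S \<times> ?S"
    then show "F \<in> entourages unit_interval"
      unfolding entourages_unit_interval using e by (intro conjI exI[of _ e]) auto }
  { assume "F \<in> entourages unit_interval"
    then obtain d where d: "d > 0" "\<And>x y. x \<in> ?S \<Longrightarrow> y \<in> ?S \<Longrightarrow> dist x y < d \<Longrightarrow> (x, y) \<in> F"
      unfolding entourages_unit_interval by blast
    show "E \<inter> F \<in> entourages unit_interval"
      unfolding entourages_unit_interval using ES e d by (intro conjI exI[of _ "min d e"]) auto }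
qed

lemma continuous_map_unit_interval:
  "continuous_map (top_of_set {0..1}) (utopology unit_interval) (\<lambda>x. x)"
  unfolding continuous_map_def topspace_utopology[OF unif_space_unit_interval]
proof (intro conjI allI impI)
  fix V assume V: "openin (utopology unit_interval) V"
  have V01: "V \<subseteq> {0..1}" using openin_subset[OF V] unif_space_unit_interval by simp
  have "openin (top_of_set {0..1}) V"
    unfolding openin_euclidean_subtopology_iff
  proof (intro conjI ballI V01)
    fix x assume x: "x \<in> V"
    then obtain E where E: "E \<in> entourages unit_interval" "E `` {x} \<subseteq> V"
      using V unfolding openin_utopology[OF unif_space_unit_interval] by blast
    then obtain e where e: "e > 0" "\<And>x y. x \<in> {0..1} \<Longrightarrow> y \<in> {0..1} \<Longrightarrow> dist x y < e \<Longrightarrow> (x, y) \<in> E"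
      unfolding entourages_unit_interval by blast
    show "\<exists>e>0. \<forall>x'\<in>{0..1}. dist x' x < e \<longrightarrow> x' \<in> V"
    proof (intro exI[of _ e] conjI ballI impI e(1))
      fix x' :: real assume "x' \<in> {0..1}" "dist x' x < e"
      then have "(x, x') \<in> E" using e(2)[of x x'] x V01 by (auto simp: dist_commute)
      then show "x' \<in> V" using E(2) by blast
    qed
  qed
  moreover have "{x \<in> topspace (top_of_set {0..1}). x \<in> V} = V" using V01 by auto
  ultimately show "openin (top_of_set {0..1}) {x \<in> topspace (top_of_set {0..1}). x \<in> V}" by simp
qed auto

lemma compact_unit_interval: "compact_space (utopology unit_interval)"
proof -
  have "compactin (top_of_set {0..1::real}) {0..1}" by (simp add: compactin_subtopology)
  from image_compactin[OF this continuous_map_unit_interval]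
  show ?thesis unfolding compact_space_def using unif_space_unit_interval by simp
qed

lemma Hausdorff_unit_interval: "Hausdorff_space (utopology unit_interval)"
  unfolding Hausdorff_utopology_iff[OF unif_space_unit_interval] points_unit_interval
proof (intro ballI impI)
  fix x y :: real assume xy: "x \<in> {0..1}" "y \<in> {0..1}" "x \<noteq> y"
  show "\<exists>E\<in>entourages unit_interval. (x, y) \<notin> E"
  proof (rule bexI[of _ "{(u, v) \<in> {0..1} \<times> {0..1}. dist u v < dist x y}"])
    show "{(u, v) \<in> {0..1} \<times> {0..1}. dist u v < dist x y} \<in> entourages unit_interval"
      unfolding entourages_unit_interval using xy(3) by (intro conjI exI[of _ "dist x y"]) auto
  qed simp
qed

definition discrete_ustruct :: "'b set \<Rightarrow> 'b ustruct" where
  "discrete_ustruct A = \<lparr>points = A, entourages = {E. Id_on A \<subseteq> E \<and> E \<subseteq> A \<times> A}\<rparr>"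

lemma points_discrete [simp]: "points (discrete_ustruct A) = A"
  by (simp add: discrete_ustruct_def)

lemma unif_space_discrete: "unif_space (discrete_ustruct A)"
proof -
  have "Id_on A O Id_on A \<subseteq> E" if "Id_on A \<subseteq> E" for E using that by auto
  then show ?thesis unfolding unif_space_def discrete_ustruct_def
    by (auto simp: Id_on_def intro!: exI[of _ "Id_on A"])
qed

text \<open>Consequently a universal arrow from the discrete space on \<open>A\<close> is a free
  object over the set \<open>A\<close>.\<close>

lemma umaps_discrete: "umaps (discrete_ustruct A) Y = A \<rightarrow>\<^sub>E points Y" if "unif_space Y"
proof
  show "umaps (discrete_ustruct A) Y \<subseteq> A \<rightarrow>\<^sub>E points Y" using umapsD(1) by fastforce
  show "A \<rightarrow>\<^sub>E points Y \<subseteq> umaps (discrete_ustruct A) Y"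
  proof
    fix f assume f: "f \<in> A \<rightarrow>\<^sub>E points Y"
    have I: "Id_on A \<in> entourages (discrete_ustruct A)" by (auto simp: discrete_ustruct_def)
    show "f \<in> umaps (discrete_ustruct A) Y"
    proof (rule umapsI[OF unif_space_discrete])
      fix E assume "E \<in> entourages Y"
      then show "\<exists>D\<in>entourages (discrete_ustruct A). \<forall>x\<in>points (discrete_ustruct A).
          \<forall>x'\<in>points (discrete_ustruct A). (x, x') \<in> D \<longrightarrow> (f x, f x') \<in> E"
        using f entourage_refl[OF that] by (intro bexI[OF _ I]) auto
    qed (use f in simp)
  qed
qed

context universe begin

text \<open>The image is closed, so a missed point \<open>y\<close> is separated from it by a
  continuous function into [0,1]. This function and the constant 0 agree after \<open>e\<close> but
  differ at \<open>y\<close>.\<close>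

lemma compact_T2_epi_surj:
  assumes X: "X \<in> compact_T2_spaces" and Y: "Y \<in> (compact_T2_spaces :: 'u ustruct set)"
    and e: "epi (full_on Unif compact_T2_spaces) X Y e"
  shows "e ` points X = points Y"
proof (rule ccontr)
  assume ns: "e ` points X \<noteq> points Y"
  have em: "e \<in> umaps X Y" using e unfolding epi_def by simp
  have uX: "unif_space X" "compact_space (utopology X)" using X by (simp_all add: compact_T2_iff)
  have uY: "unif_space Y" "compact_space (utopology Y)" "Hausdorff_space (utopology Y)"
    using Y by (simp_all add: compact_T2_iff)
  obtain y where y: "y \<in> points Y" "y \<notin> e ` points X" using ns umapsD(2)[OF em] by blast
  have cl: "closedin (utopology Y) (e ` points X)" by (rule closedin_umap_image[OF uX uY(1,3) em])
  have cly: "closedin (utopology Y) {y}" using closedin_Hausdorff_singleton[OF uY(3)] y(1) uY(1) by simp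
  have "normal_space (utopology Y)"
    using compact_Hausdorff_or_regular_imp_normal_space uY(2,3) by blast
  then obtain f :: "'u \<Rightarrow> real" where f: "continuous_map (utopology Y) (top_of_set {0..1}) f"
    "f ` (e ` points X) \<subseteq> {0}" "f ` {y} \<subseteq> {1}"
    using Urysohn_lemma[OF _ cl cly, of 0 1] y(2) by (auto simp: disjnt_def)
  \<comment> \<open>Test objects must be spaces over \<open>'u\<close>, so the unit interval is
    replaced by the copy \<open>J\<close>.\<close>
  have "{0..1::real} \<prec> (UNIV :: 'u set)"
    using real_lesspoll_universe by (rule lesspoll_trans1[rotated]) (simp add: subset_imp_lepoll)
  from small_copy[OF this] obtain c :: "real \<Rightarrow> 'u" where c: "inj_on c {0..1}" "small (c ` {0..1})" .
  from ustruct_copy[OF unif_space_unit_interval, of c] c(1)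
  obtain J where J: "unif_space J" "points J = c ` {0..1}" "restrict c {0..1} \<in> umaps unit_interval J"
    "uiso unit_interval J" by (metis points_unit_interval)
  have hJ: "utopology unit_interval homeomorphic_space utopology J"
    by (rule utopology_homeomorphic[OF unif_space_unit_interval J(1,4)])
  have JC: "J \<in> compact_T2_spaces"
    using J(1,2) c(2) homeomorphic_compact_space[OF hJ] homeomorphic_Hausdorff_space[OF hJ]
      compact_unit_interval Hausdorff_unit_interval by (simp add: compact_T2_iff)
  define g where "g = (\<lambda>z\<in>points Y. c (f z))"
  have f01: "f z \<in> {0..1}" if "z \<in> points Y" for z
    using f(1) that uY(1) by (auto simp: continuous_map_def Pi_iff)
  have "continuous_map (utopology Y) (utopology J) (restrict c {0..1} \<circ> ((\<lambda>x. x) \<circ> f))"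
    by (intro continuous_map_compose[OF continuous_map_compose[OF f(1) continuous_map_unit_interval]]
        umaps_imp_continuous[OF unif_space_unit_interval J(1,3)])
  then have "continuous_map (utopology Y) (utopology J) g"
    by (rule continuous_map_eq) (use f01 uY(1) in \<open>simp add: g_def\<close>)
  then have g: "g \<in> umaps Y J"
    by (rule continuous_on_compact_imp_umaps[OF uY(1) J(1) uY(2)]) (simp add: g_def)
  define h where "h = (\<lambda>z\<in>points Y. c 0)"
  have h: "h \<in> umaps Y J" unfolding h_def by (rule umaps_const[OF uY(1) J(1)]) (simp add: J(2))
  have "f (e x) = 0" if "x \<in> points X" for x using f(2) that by blast
  then have "compose (points X) g e = compose (points X) h e"
    using umapsD(2)[OF em] by (auto simp: compose_def fun_eq_iff g_def h_def)
  then have "g = h" using e JC g h unfolding epi_def by simp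
  then have "g y = h y" by simp
  then have "c 1 = c 0" using f(3) y(1) by (simp add: g_def h_def)
  then show False using inj_onD[OF c(1), of 1 0] by simp
qed

text \<open>Every reflection arrow has to be shown epi, not just the constructed one, so the
  argument uses only the universal property: the image is closed by compactness, hence in
  \<open>C\<close>, and the arrow is onto.\<close>

lemma epireflective_compact_T2I:
  assumes C: "subcategory (C :: 'u ustruct set)" "closed_under_products C"
      "closed_under_closed_subspaces C" and sub: "C \<subseteq> compact_T2_spaces"
  shows "epireflective (full_on Unif compact_T2_spaces) C"
  unfolding epireflective_def
proof (intro conjI ballI allI impI)
  show "C \<subseteq> Ob (full_on Unif compact_T2_spaces)" using sub by simp
  have T2: "Hausdorff_space (utopology Y)" if "Y \<in> C" for Y using that sub by (auto simp: compact_T2_iff)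
  fix X :: "'u ustruct" assume "X \<in> Ob (full_on Unif compact_T2_spaces)"
  then have X: "unif_space X" "small (points X)" "compact_space (utopology X)"
    by (simp_all add: compact_T2_iff)
  then have "X \<in> Ob Unif" by (simp add: Ob_Unif)
  then obtain Q q where "Q \<in> C" "q \<in> umaps X Q"
    "\<forall>Y\<in>C. \<forall>f\<in>umaps X Y. \<exists>!g. g \<in> umaps Q Y \<and> compose (points X) g q = f"
    using universal_arrow[OF C T2, of X "{}"] by auto
  then show "\<exists>R r. reflection_arrow (full_on Unif compact_T2_spaces) C X R r"
    unfolding reflection_arrow_def by (intro exI[of _ Q] exI[of _ q]) simp
  fix R r assume "reflection_arrow (full_on Unif compact_T2_spaces) C X R r"
  then have R: "R \<in> C" "r \<in> umaps X R"
    and univ: "\<forall>Y\<in>C. \<forall>f\<in>umaps X Y. \<exists>!g. g \<in> umaps R Y \<and> compose (points X) g r = f"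
    unfolding reflection_arrow_def by simp_all
  note uR = subcategoryD(1)[OF C(1) R(1)]
  have cl: "closedin (utopology R) (r ` points X)"
    by (rule closedin_umap_image[OF X(1,3) uR T2[OF R(1)] R(2)])
  have rsub: "r ` points X \<subseteq> points R" using umapsD(2)[OF R(2)] by blast
  have "usubspace R (r ` points X) \<in> C" by (rule closed_subspace_in[OF C(3) R(1) cl])
  moreover have "r \<in> umaps X (usubspace R (r ` points X))"
    by (rule umaps_usubspace_codomain[OF uR rsub R(2)]) simp
  ultimately obtain k where k: "k \<in> umaps R (usubspace R (r ` points X))" "compose (points X) k r = r"
    using univ by blast
  have idR: "compose (points X) (\<lambda>x\<in>points R. x) r = r"
    using umapsD(2,3)[OF R(2)] by (auto simp: compose_def fun_eq_iff)
  have "r ` points X = points R"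
  proof (rule surj_umap_if_universal[OF uR R(2) k])
    fix l assume "l \<in> umaps R R" "compose (points X) l r = r"
    then show "l = (\<lambda>x\<in>points R. x)"
      using univ[rule_format, OF R] umaps_id[OF uR] idR by blast
  qed
  show "epi (full_on Unif compact_T2_spaces) X R r"
    unfolding epi_def
  proof (intro conjI ballI impI)
    show "r \<in> Hom (full_on Unif compact_T2_spaces) X R" using R(2) by simp
    fix Z g h assume "g \<in> Hom (full_on Unif compact_T2_spaces) R Z" "h \<in> Hom (full_on Unif compact_T2_spaces) R Z"
      and "Comp (full_on Unif compact_T2_spaces) X R Z g r = Comp (full_on Unif compact_T2_spaces) X R Z h r"
    then have gh: "g \<in> umaps R Z" "h \<in> umaps R Z" and eq: "compose (points X) g r = compose (points X) h r"
      by simp_all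
    show "g = h"
    proof (rule umaps_eqI[OF gh])
      fix y assume "y \<in> points R"
      then obtain x where "x \<in> points X" "y = r x" using \<open>r ` points X = points R\<close> by blast
      then show "g y = h y" using fun_cong[OF eq, of x] by (simp add: compose_def)
    qed
  qed
qed

section \<open>Closure properties of an epireflective subcategory\<close>

context
  fixes C :: "'u ustruct set"
  assumes C: "subcategory C" and epir: "epireflective (full_on Unif compact_T2_spaces) C"
begin

lemma epireflective_subset: "C \<subseteq> compact_T2_spaces"
  using epir unfolding epireflective_def by simp

lemma epireflective_reflection:
  assumes "X \<in> compact_T2_spaces"
  obtains R r where "R \<in> C" "r \<in> umaps X R" "epi (full_on Unif compact_T2_spaces) X R r"
    "\<And>Y f. Y \<in> C \<Longrightarrow> f \<in> umaps X Y \<Longrightarrow> \<exists>g\<in>umaps R Y. compose (points X) g r = f"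
proof -
  obtain R r where r: "reflection_arrow (full_on Unif compact_T2_spaces) C X R r"
    using epir assms unfolding epireflective_def by (metis Ob_full_on)
  moreover have "epi (full_on Unif compact_T2_spaces) X R r"
    using epir assms r unfolding epireflective_def by simp
  ultimately show thesis
    using that[of R r] unfolding reflection_arrow_def by (simp add: Bex_def) blast
qed

text \<open>The projections to members of \<open>C\<close> extend over the reflection
  \<open>r\<close> of the product, and the extensions combine into a left inverse \<open>h\<close>
  of \<open>r\<close>.\<close>

lemma epireflective_closed_products: "closed_under_products C"
proof (rule closed_under_productsI)
  show "C \<subseteq> Ob Unif" using C unfolding subcategory_def by blast
  fix I :: "'u set" and X and P :: "'u ustruct" and \<pi>
  assume X: "\<And>i. i \<in> I \<Longrightarrow> X i \<in> C" and P: "P \<in> Ob Unif" and \<pi>: "product_cone I X P \<pi>"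
  have XC: "X i \<in> compact_T2_spaces" if "i \<in> I" for i using X[OF that] epireflective_subset by blast
  have uP: "unif_space P" using P by (simp add: Ob_Unif)
  have uX: "unif_space (X i)" if "i \<in> I" for i using XC[OF that] by (simp add: compact_T2_iff)
  have PC: "P \<in> compact_T2_spaces"
    using P compact_product_cone[OF \<pi> uP uX] Hausdorff_product_cone[OF \<pi> uP uX] XC
    by (simp add: compact_T2_iff Ob_Unif)
  obtain R r where R: "R \<in> C" "r \<in> umaps P R" "epi (full_on Unif compact_T2_spaces) P R r"
    "\<And>Y f. Y \<in> C \<Longrightarrow> f \<in> umaps P Y \<Longrightarrow> \<exists>g\<in>umaps R Y. compose (points P) g r = f"
    using epireflective_reflection[OF PC] by metis
  have RC: "R \<in> compact_T2_spaces" using R(1) epireflective_subset by blast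
  then have uR: "unif_space R" by (simp add: compact_T2_iff)
  have "\<exists>g. g \<in> umaps R (X i) \<and> compose (points P) g r = \<pi> i" if "i \<in> I" for i
    using R(4)[OF X[OF that] product_cone_proj[OF \<pi> that]] by blast
  then obtain g where g: "\<And>i. i \<in> I \<Longrightarrow> g i \<in> umaps R (X i)"
    "\<And>i. i \<in> I \<Longrightarrow> compose (points P) (g i) r = \<pi> i" by metis
  obtain h where h: "h \<in> umaps R P" "\<And>i z. i \<in> I \<Longrightarrow> z \<in> points R \<Longrightarrow> \<pi> i (h z) = g i z"
    using product_cone_tuple[OF \<pi> uR, of g] g(1) by blast
  have hr: "h (r p) = p" if p: "p \<in> points P" for p
  proof (rule product_cone_eqI[OF \<pi> umapsD(2)[OF h(1) umapsD(2)[OF R(2) p]] p])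
    fix i assume i: "i \<in> I"
    show "\<pi> i (h (r p)) = \<pi> i p"
      using h(2)[OF i umapsD(2)[OF R(2) p]] fun_cong[OF g(2)[OF i], of p] p by (simp add: compose_def)
  qed
  \<comment> \<open>Both sides equal \<open>r\<close>; cancelling the epimorphism \<open>r\<close>
    turns the left inverse into a two-sided one.\<close>
  have "compose (points P) (compose (points R) r h) r = compose (points P) (\<lambda>z\<in>points R. z) r"
    using hr umapsD(2)[OF R(2)] by (auto simp: compose_def fun_eq_iff)
  then have "compose (points R) r h = (\<lambda>z\<in>points R. z)"
    using R(3) RC umaps_compose[OF h(1) R(2)] umaps_id[OF uR] unfolding epi_def by simp
  then have "r (h z) = z" if "z \<in> points R" for z
    using that by (metis compose_eq restrict_apply')
  then have "uiso R P" unfolding uiso_def using R(2) h(1) hr by blast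
  then show "P \<in> C" using subcategoryD(3)[OF C R(1)] P by (simp add: Ob_Unif)
qed

text \<open>The inclusion extends over the reflection only as a map \<open>g\<close> into
  \<open>X\<close>. It takes its values in \<open>A\<close> because \<open>r\<close> is onto, which
  is where Urysohn's lemma enters.\<close>

lemma epireflective_closed_subspaces: "closed_under_closed_subspaces C"
  unfolding closed_under_closed_subspaces_def
proof (intro ballI allI impI)
  fix X A assume X: "X \<in> C" and A: "closedin (utopology X) A"
  have XC: "X \<in> compact_T2_spaces" using X epireflective_subset by blast
  then have uX: "unif_space X" by (simp add: compact_T2_iff)
  have sub: "A \<subseteq> points X" using closedin_subset[OF A] uX by simp
  let ?A = "usubspace X A"
  have AC: "?A \<in> compact_T2_spaces" by (rule compact_T2_closed_subspace[OF XC A])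
  then have uA: "unif_space ?A" "compact_space (utopology ?A)" by (simp_all add: compact_T2_iff)
  obtain R r where R: "R \<in> C" "r \<in> umaps ?A R" "epi (full_on Unif compact_T2_spaces) ?A R r"
    "\<And>Y f. Y \<in> C \<Longrightarrow> f \<in> umaps ?A Y \<Longrightarrow> \<exists>g\<in>umaps R Y. compose (points ?A) g r = f"
    using epireflective_reflection[OF AC] by metis
  have RC: "R \<in> compact_T2_spaces" using R(1) epireflective_subset by blast
  then have uR: "unif_space R" "Hausdorff_space (utopology R)" by (simp_all add: compact_T2_iff)
  obtain g where g: "compose A g r = (\<lambda>x\<in>A. x)"
    using R(4)[OF X umaps_usubspace_incl[OF uX sub]] by auto
  have gr: "g (r x) = x" if "x \<in> A" for x using fun_cong[OF g, of x] that by (simp add: compose_def)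
  have surj: "r ` points ?A = points R" by (rule compact_T2_epi_surj[OF AC RC R(3)])
  have eq: "compose (points ?A) (restrict g (points R)) r = (\<lambda>x\<in>points ?A. x)"
    using gr umapsD(2)[OF R(2)] by (auto simp: compose_def fun_eq_iff)
  \<comment> \<open>Composed with the quotient map \<open>r\<close> it is the identity of the
    subspace, which is uniformly continuous.\<close>
  have "restrict g (points R) \<in> umaps R ?A"
    by (rule umaps_factor_compact_surj[OF uA uR uA(1) R(2) surj]) (use eq umaps_id[OF uA(1)] in auto)
  moreover have "\<forall>x\<in>points R. r (restrict g (points R) x) = x"
    using surj gr by force
  moreover have "\<forall>x\<in>points ?A. restrict g (points R) (r x) = x"
    using gr umapsD(2)[OF R(2)] by simp
  ultimately have "uiso R ?A" unfolding uiso_def using R(2) by blast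
  then show "?A \<in> C"
    using subcategoryD(3)[OF C R(1)] AC by (simp add: compact_T2_iff)
qed

end

text \<open>Images are closed by compactness, kernel pairs are closed by separation, and factors
  along surjections are uniformly continuous by Heine-Cantor. Coequalizers and free objects are
  universal arrows.\<close>

lemma algebraic_compact_T2:
  assumes C: "subcategory (C :: 'u ustruct set)" "closed_under_products C"
      "closed_under_closed_subspaces C" and sub: "C \<subseteq> compact_T2_spaces"
  shows "algebraic_category C"
proof (rule algebraic_categoryI[OF C(1)])
  note uC = subcategoryD(1)[OF C(1)]
  have comp: "compact_space (utopology Y)" and T2: "Hausdorff_space (utopology Y)" if "Y \<in> C" for Y
    using that sub by (auto simp: compact_T2_iff)
  {
    fix X Y f g assume X: "X \<in> C" and Y: "Y \<in> C" and fg: "f \<in> umaps X Y" "g \<in> umaps X Y"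
    define S where "S = (\<lambda>x. (f x, g x)) ` points X"
    have S: "S \<subseteq> points Y \<times> points Y" unfolding S_def using umapsD(2)[OF fg(1)] umapsD(2)[OF fg(2)] by blast
    have resp: "(\<forall>(a, b)\<in>S. h a = h b) \<longleftrightarrow> compose (points X) h f = compose (points X) h g" for h :: "'u \<Rightarrow> 'u"
      by (auto simp: S_def compose_def fun_eq_iff)
    have YU: "Y \<in> Ob Unif" using subcategoryD(1,2)[OF C(1) Y] by (simp add: Ob_Unif)
    have "\<exists>Q\<in>C. \<exists>q\<in>umaps Y Q. (\<forall>(a, b)\<in>S. q a = q b) \<and>
      (\<forall>Z\<in>C. \<forall>h\<in>umaps Y Z. (\<forall>(a, b)\<in>S. h a = h b) \<longrightarrow>
        (\<exists>!k. k \<in> umaps Q Z \<and> compose (points Y) k q = h))"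
      by (rule universal_arrow[OF C T2 YU S])
    then obtain Q q where Q: "Q \<in> C" "q \<in> umaps Y Q" "\<forall>(a, b)\<in>S. q a = q b"
      "\<forall>Z\<in>C. \<forall>h\<in>umaps Y Z. (\<forall>(a, b)\<in>S. h a = h b) \<longrightarrow>
        (\<exists>!k. k \<in> umaps Q Z \<and> compose (points Y) k q = h)"
      by (elim bexE conjE)
    have "coequalizer (full_on Unif C) X Y f g Q q"
      unfolding coequalizer_Unif_iff using Q unfolding resp by simp
    then show "\<exists>Q q. coequalizer (full_on Unif C) X Y f g Q q" by blast
  next
    fix X Y f assume X: "X \<in> C" and Y: "Y \<in> C" and f: "f \<in> umaps X Y"
    have fsub: "f ` points X \<subseteq> points Y" using umapsD(2)[OF f] by blast
    have "closedin (utopology Y) (f ` points X)"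
      by (rule closedin_umap_image[OF uC[OF X] comp[OF X] uC[OF Y] T2[OF Y] f])
    from closed_subspace_in[OF C(3) Y this]
    show "\<exists>Z\<in>C. points Z = f ` points X \<and> f \<in> umaps X Z \<and> (\<lambda>z\<in>points Z. z) \<in> umaps Z Y"
      by (rule bexI[rotated])
        (simp add: umaps_usubspace_codomain[OF uC[OF Y] fsub f] umaps_usubspace_incl[OF uC[OF Y] fsub])
    obtain P p q where P: "P \<in> C" "p \<in> umaps P X" "q \<in> umaps P X"
      "\<And>x y. x \<in> points X \<Longrightarrow> y \<in> points X \<Longrightarrow> \<exists>z\<in>points P. p z = x \<and> q z = y"
      using binary_product_in[OF C(1,2) X X] by metis
    \<comment> \<open>The kernel pair of \<open>f\<close> as an equalizer inside the square of
      \<open>X\<close>; it is closed because \<open>Y\<close> is Hausdorff.\<close>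
    let ?K = "{z \<in> points P. compose (points P) f p z = compose (points P) f q z}"
    have "closedin (utopology P) ?K"
      using closedin_continuous_maps_eq[OF T2[OF Y]
          umaps_imp_continuous[OF uC[OF P(1)] uC[OF Y] umaps_compose[OF P(2) f]]
          umaps_imp_continuous[OF uC[OF P(1)] uC[OF Y] umaps_compose[OF P(3) f]]] uC[OF P(1)] by simp
    then have K: "usubspace P ?K \<in> C" by (rule closed_subspace_in[OF C(3) P(1)])
    have Ksub: "?K \<subseteq> points P" by blast
    have "restrict p ?K \<in> umaps (usubspace P ?K) X" "restrict q ?K \<in> umaps (usubspace P ?K) X"
      using umaps_restrict[OF uC[OF P(1)] Ksub] P(2,3) by blast+
    moreover have "\<forall>z\<in>?K. f (restrict p ?K z) = f (restrict q ?K z)" by (simp add: compose_def)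
    moreover have "\<forall>x\<in>points X. \<forall>y\<in>points X. f x = f y \<longrightarrow>
        (\<exists>z\<in>?K. restrict p ?K z = x \<and> restrict q ?K z = y)"
    proof (intro ballI impI)
      fix x y assume xy: "x \<in> points X" "y \<in> points X" "f x = f y"
      obtain z where z: "z \<in> points P" "p z = x" "q z = y" using P(4)[OF xy(1,2)] by blast
      then have "z \<in> ?K" using xy(3) by (simp add: compose_def)
      then show "\<exists>z\<in>?K. restrict p ?K z = x \<and> restrict q ?K z = y"
        using z by (intro bexI[of _ z]) simp_all
    qed
    ultimately show "\<exists>P\<in>C. \<exists>u\<in>umaps P X. \<exists>v\<in>umaps P X. (\<forall>z\<in>points P. f (u z) = f (v z)) \<and>
        (\<forall>x\<in>points X. \<forall>y\<in>points X. f x = f y \<longrightarrow> (\<exists>z\<in>points P. u z = x \<and> v z = y))"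
      by (intro bexI[OF _ K] bexI[of _ "restrict p ?K"] bexI[of _ "restrict q ?K"] conjI)
        (simp_all only: points_usubspace)
  next
    fix X Y Z f k
    assume "X \<in> C" "Y \<in> C" "Z \<in> C" "f \<in> umaps X Y" "f ` points X = points Y"
      "k \<in> extensional (points Y)" "compose (points X) k f \<in> umaps X Z"
    then show "k \<in> umaps Y Z" by (intro umaps_factor_compact_surj[of X Y Z f k] uC comp T2)
  next
    fix A :: "'u set" assume "small A"
    then have "discrete_ustruct A \<in> Ob Unif" by (simp add: Ob_Unif unif_space_discrete)
    then obtain F \<eta> where F: "F \<in> C" "\<eta> \<in> umaps (discrete_ustruct A) F"
      "\<forall>Y\<in>C. \<forall>f\<in>umaps (discrete_ustruct A) Y. \<exists>!g. g \<in> umaps F Y \<and> compose A g \<eta> = f"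
      using universal_arrow[OF C T2, of "discrete_ustruct A" "{}"] by auto
    show "\<exists>F\<in>C. \<exists>\<eta>\<in>A \<rightarrow>\<^sub>E points F. \<forall>Y\<in>C. \<forall>f\<in>A \<rightarrow>\<^sub>E points Y.
        \<exists>!g. g \<in> umaps F Y \<and> compose A g \<eta> = f"
    proof (intro bexI[OF _ F(1)] bexI[of _ \<eta>] ballI)
      show "\<eta> \<in> A \<rightarrow>\<^sub>E points F" using F(2) by (simp add: umaps_discrete uC[OF F(1)])
      fix Y f assume "Y \<in> C" "f \<in> A \<rightarrow>\<^sub>E points Y"
      then show "\<exists>!g. g \<in> umaps F Y \<and> compose A g \<eta> = f"
        using F(3) by (simp add: umaps_discrete uC)
    qed
  }
qed

end

section \<open>Examples\<close>

definition indiscrete_ustruct :: "'a set \<Rightarrow> 'a ustruct" where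
  "indiscrete_ustruct A = \<lparr>points = A, entourages = {A \<times> A}\<rparr>"

lemma points_indiscrete [simp]: "points (indiscrete_ustruct A) = A"
  by (simp add: indiscrete_ustruct_def)

lemma unif_space_indiscrete: "unif_space (indiscrete_ustruct A)"
  unfolding unif_space_def indiscrete_ustruct_def by (auto simp: Id_on_def)

lemma uindiscrete_indiscrete: "uindiscrete (indiscrete_ustruct A)"
  by (simp add: uindiscrete_def indiscrete_ustruct_def)

lemma uindiscrete_uiso:
  assumes X: "unif_space X" and Y: "unif_space Y" and "uiso X Y" "uindiscrete X"
  shows "uindiscrete Y"
proof -
  obtain f g where fg: "f \<in> umaps X Y" "g \<in> umaps Y X" "\<And>y. y \<in> points Y \<Longrightarrow> f (g y) = y"
    using uisoE[OF assms(3)] by metis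
  have "E = points Y \<times> points Y" if E: "E \<in> entourages Y" for E
  proof
    show "points Y \<times> points Y \<subseteq> E"
    proof clarify
      fix y y' assume y: "y \<in> points Y" "y' \<in> points Y"
      have "{(x, x') \<in> points X \<times> points X. (f x, f x') \<in> E} = points X \<times> points X"
        using umapsD(4)[OF fg(1) E] assms(4) unfolding uindiscrete_def by (simp only: singleton_iff)
      then have "(g y, g y') \<in> {(x, x') \<in> points X \<times> points X. (f x, f x') \<in> E}"
        using umapsD(2)[OF fg(2)] y by simp
      then show "(y, y') \<in> E" using fg(3) y by simp
    qed
  qed (rule entourage_subset[OF Y E])
  then show ?thesis unfolding uindiscrete_def using entourage_UNIV[OF Y] by blast
qed

lemma subcategoryI:
  assumes "\<And>X. X \<in> C \<Longrightarrow> unif_space X" "\<And>X. X \<in> C \<Longrightarrow> small (points X)"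
    and "\<And>X Y. X \<in> C \<Longrightarrow> unif_space Y \<Longrightarrow> small (points Y) \<Longrightarrow> uiso X Y \<Longrightarrow> Y \<in> C"
  shows "subcategory C"
  unfolding subcategory_def
proof (intro conjI ballI impI subsetI)
  show "X \<in> Ob Unif" if "X \<in> C" for X using assms(1,2)[OF that] by (simp add: Ob_Unif)
  show "Y \<in> C" if "X \<in> C" "Y \<in> Ob Unif" "uiso X Y" for X Y
    using assms(3)[OF that(1) _ _ that(3)] that(2) by (simp add: Ob_Unif)
qed

lemma mem_indiscrete_spaces:
  "X \<in> indiscrete_spaces \<longleftrightarrow> unif_space X \<and> small (points X) \<and> uindiscrete X"
  by (auto simp: indiscrete_spaces_def Ob_Unif)

lemma subcategory_indiscrete: "subcategory indiscrete_spaces"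
  by (rule subcategoryI) (auto simp: mem_indiscrete_spaces intro: uindiscrete_uiso)

lemma closed_subspaces_indiscrete: "closed_under_closed_subspaces indiscrete_spaces"
  unfolding closed_under_closed_subspaces_def
proof (intro ballI allI impI)
  fix X :: "'a ustruct" and A assume X: "X \<in> indiscrete_spaces" and A: "closedin (utopology X) A"
  have uX: "unif_space X" "small (points X)" "entourages X = {points X \<times> points X}"
    using X by (auto simp: mem_indiscrete_spaces uindiscrete_def)
  have sub: "A \<subseteq> points X" using closedin_subset[OF A] uX(1) by simp
  then have "entourages (usubspace X A) = {A \<times> A}"
    unfolding entourages_usubspace uX(3) by (auto simp: Int_absorb1 Sigma_mono)
  then show "usubspace X A \<in> indiscrete_spaces"
    using unif_space_usubspace[OF uX(1) sub] small_subset[OF uX(2) sub]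
    by (simp add: mem_indiscrete_spaces uindiscrete_def)
qed

text \<open>The example that lacks closed subspaces: the empty space is excluded, although the empty
  set is closed in every space.\<close>

definition one_point_spaces :: "'a ustruct set" where
  "one_point_spaces = {X. unif_space X \<and> (\<exists>x. points X = {x})}"

text \<open>The example that lacks products: an infinite power of a two-point space is not
  discrete.\<close>

definition discrete_spaces :: "'a ustruct set" where
  "discrete_spaces = {X. unif_space X \<and> small (points X) \<and> Id_on (points X) \<in> entourages X}"

lemma subcategory_discrete: "subcategory discrete_spaces"
proof (rule subcategoryI)
  fix X Y :: "'a ustruct"
  assume X: "X \<in> discrete_spaces" and Y: "unif_space Y" "small (points Y)" "uiso X Y"
  obtain f g where fg: "g \<in> umaps Y X" "\<And>y. y \<in> points Y \<Longrightarrow> f (g y) = y"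
    using uisoE[OF Y(3)] by metis
  have "{(y, y') \<in> points Y \<times> points Y. (g y, g y') \<in> Id_on (points X)} \<in> entourages Y"
    using umapsD(4)[OF fg(1)] X by (simp add: discrete_spaces_def)
  moreover have "{(y, y') \<in> points Y \<times> points Y. (g y, g y') \<in> Id_on (points X)} = Id_on (points Y)"
    using fg umapsD(2)[OF fg(1)] by (auto simp: Id_on_def) metis
  ultimately show "Y \<in> discrete_spaces" using Y by (simp add: discrete_spaces_def)
qed (auto simp: discrete_spaces_def)

lemma closed_subspaces_discrete: "closed_under_closed_subspaces discrete_spaces"
  unfolding closed_under_closed_subspaces_def
proof (intro ballI allI impI)
  fix X :: "'a ustruct" and A assume X: "X \<in> discrete_spaces" and A: "closedin (utopology X) A"
  have uX: "unif_space X" "small (points X)" "Id_on (points X) \<in> entourages X"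
    using X by (auto simp: discrete_spaces_def)
  have sub: "A \<subseteq> points X" using closedin_subset[OF A] uX(1) by simp
  then have "Id_on A = Id_on (points X) \<inter> (A \<times> A)" by auto
  then have "Id_on A \<in> entourages (usubspace X A)"
    unfolding entourages_usubspace using uX(3) by blast
  then show "usubspace X A \<in> discrete_spaces"
    using unif_space_usubspace[OF uX(1) sub] small_subset[OF uX(2) sub]
    by (simp add: discrete_spaces_def)
qed

lemma discrete_ustruct_in_discrete_spaces: "small A \<Longrightarrow> discrete_ustruct A \<in> discrete_spaces"
  unfolding discrete_spaces_def by (simp add: unif_space_discrete) (auto simp: discrete_ustruct_def)

lemma umaps_discrete_spaces:
  assumes X: "X \<in> discrete_spaces" and Y: "unif_space Y"
  shows "umaps X Y = points X \<rightarrow>\<^sub>E points Y"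
proof
  have uX: "unif_space X" and I: "Id_on (points X) \<in> entourages X"
    using X by (simp_all add: discrete_spaces_def)
  show "umaps X Y \<subseteq> points X \<rightarrow>\<^sub>E points Y" using umapsD(1) by blast
  show "points X \<rightarrow>\<^sub>E points Y \<subseteq> umaps X Y"
  proof
    fix f assume f: "f \<in> points X \<rightarrow>\<^sub>E points Y"
    show "f \<in> umaps X Y"
      by (rule umapsI[OF uX f], rule bexI[OF _ I]) (use f entourage_refl[OF Y] in auto)
  qed
qed

lemma compact_discrete_finite:
  assumes "compact_space (utopology (discrete_ustruct A))"
  shows "finite A"
proof -
  have op: "openin (utopology (discrete_ustruct A)) {x}" if "x \<in> A" for x
    unfolding openin_utopology[OF unif_space_discrete]
    using that by (auto simp: discrete_ustruct_def intro!: exI[of _ "Id_on A"])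
  have "(\<forall>U\<in>(\<lambda>x. {x}) ` A. openin (utopology (discrete_ustruct A)) U) \<and> A \<subseteq> \<Union>((\<lambda>x. {x}) ` A)"
    using op by auto
  then have "\<exists>\<F>. finite \<F> \<and> \<F> \<subseteq> (\<lambda>x. {x}) ` A \<and> A \<subseteq> \<Union>\<F>"
    using assms unfolding compact_space_alt topspace_utopology[OF unif_space_discrete] points_discrete
    by (elim allE[of _ "(\<lambda>x. {x}) ` A"] impE)
  then obtain \<F> where \<F>: "finite \<F>" "\<F> \<subseteq> (\<lambda>x. {x}) ` A" "A \<subseteq> \<Union>\<F>"
    by (elim exE conjE)
  have "finite B" if "B \<in> \<F>" for B using \<F>(2) that by auto
  with \<F>(1) have "finite (\<Union>\<F>)" by (rule finite_Union)
  then show ?thesis using \<F>(3) finite_subset by blast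
qed

lemma finite_discrete_compact_T2:
  assumes "finite A" "small A"
  shows "discrete_ustruct A \<in> compact_T2_spaces"
proof -
  have "compact_space (utopology (discrete_ustruct A))"
    unfolding compact_space_def using assms(1) unif_space_discrete[of A]
    by (intro finite_imp_compactin) auto
  moreover have "Hausdorff_space (utopology (discrete_ustruct A))"
    unfolding Hausdorff_utopology_iff[OF unif_space_discrete]
    by (auto simp: discrete_ustruct_def intro!: exI[of _ "Id_on A"])
  ultimately show ?thesis using assms(2) by (simp add: compact_T2_iff unif_space_discrete)
qed

context universe begin

lemma closed_products_indiscrete: "closed_under_products (indiscrete_spaces :: 'u ustruct set)"
proof (rule closed_under_productsI)
  show "indiscrete_spaces \<subseteq> (Ob Unif :: 'u ustruct set)" by (auto simp: indiscrete_spaces_def)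
  fix I :: "'u set" and X P \<pi>
  assume X: "\<And>i. i \<in> I \<Longrightarrow> X i \<in> (indiscrete_spaces :: 'u ustruct set)"
    and P: "P \<in> (Ob Unif :: 'u ustruct set)" "product_cone I X P \<pi>"
  have uP: "unif_space P" using P(1) by (simp add: Ob_Unif)
  have "E = points P \<times> points P" if E: "E \<in> entourages P" for E
  proof
    obtain J F where JF: "J \<subseteq> I" "\<forall>j\<in>J. F j \<in> entourages (X j)"
      "{(p, q) \<in> points P \<times> points P. \<forall>j\<in>J. (\<pi> j p, \<pi> j q) \<in> F j} \<subseteq> E"
      using P(2) E unfolding product_cone_def initial_source_def by blast
    have "(\<pi> j p, \<pi> j q) \<in> F j" if "j \<in> J" "p \<in> points P" "q \<in> points P" for j p q
    proof -
      have j: "j \<in> I" using that(1) JF(1) by blast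
      have "entourages (X j) = {points (X j) \<times> points (X j)}"
        using X[OF j] by (simp add: mem_indiscrete_spaces uindiscrete_def)
      then have "F j = points (X j) \<times> points (X j)" using JF(2) that(1) by blast
      then show ?thesis using umapsD(2)[OF product_cone_proj[OF P(2) j]] that(2,3) by simp
    qed
    then show "points P \<times> points P \<subseteq> E" using JF(3) by blast
  qed (rule entourage_subset[OF uP E])
  then have "uindiscrete P" unfolding uindiscrete_def using entourage_UNIV[OF uP] by blast
  then show "P \<in> indiscrete_spaces" using P(1) by (simp add: indiscrete_spaces_def)
qed

lemma algebraic_indiscrete: "algebraic_category (indiscrete_spaces :: 'u ustruct set)"
proof (rule algebraic_if_like_Set[OF subcategory_indiscrete])
  fix X Y :: "'u ustruct" assume XY: "X \<in> indiscrete_spaces" "Y \<in> indiscrete_spaces"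
  show "umaps X Y = points X \<rightarrow>\<^sub>E points Y"
    using umapsD(1)[of _ X Y] umaps_into_indiscrete[of X Y] XY
    by (auto simp: mem_indiscrete_spaces simp del: PiE_iff)
next
  fix A :: "'u set" assume "small A"
  then show "\<exists>X\<in>indiscrete_spaces. points X = A"
    by (intro bexI[of _ "indiscrete_ustruct A"])
      (simp_all add: mem_indiscrete_spaces unif_space_indiscrete uindiscrete_indiscrete)
qed

lemma algebraic_discrete: "algebraic_category (discrete_spaces :: 'u ustruct set)"
proof (rule algebraic_if_like_Set[OF subcategory_discrete])
  fix X Y :: "'u ustruct" assume XY: "X \<in> discrete_spaces" "Y \<in> discrete_spaces"
  then show "umaps X Y = points X \<rightarrow>\<^sub>E points Y"
    by (intro umaps_discrete_spaces) (simp_all add: discrete_spaces_def)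
next
  fix A :: "'u set" assume "small A"
  then show "\<exists>X\<in>discrete_spaces. points X = A"
    by (intro bexI[of _ "discrete_ustruct A"]) (simp_all add: discrete_ustruct_in_discrete_spaces)
qed

lemma infinite_small_set: obtains A :: "'u set" where "infinite A" "small A"
proof -
  obtain f :: "nat \<Rightarrow> 'u" where f: "inj_on f UNIV" "small (f ` UNIV)"
    using small_copy[OF nat_lesspoll_universe] .
  then show thesis using that[of "range f"] range_inj_infinite by blast
qed

text \<open>An infinite discrete space is neither indiscrete nor compact. The criterion serves two
  of the three examples.\<close>

lemma not_indiscrete_or_epireflective_if_discrete:
  assumes "\<And>A :: 'u set. small A \<Longrightarrow> discrete_ustruct A \<in> C"
  shows "\<not> indiscrete_or_epireflective C"
proof
  assume C: "indiscrete_or_epireflective C"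
  obtain A :: "'u set" where A: "infinite A" "small A" using infinite_small_set .
  have AC: "discrete_ustruct A \<in> C" by (rule assms[OF A(2)])
  from C consider "C = indiscrete_spaces" | "C \<subseteq> compact_T2_spaces"
    unfolding indiscrete_or_epireflective_def epireflective_def by auto
  then show False
  proof cases
    case 1
    then have "entourages (discrete_ustruct A) = {A \<times> A}"
      using AC by (simp add: mem_indiscrete_spaces uindiscrete_def)
    moreover have "Id_on A \<in> entourages (discrete_ustruct A)" by (auto simp: discrete_ustruct_def)
    ultimately have "Id_on A = A \<times> A" by simp
    then have "x = y" if "x \<in> A" "y \<in> A" for x y using that by (auto simp: Id_on_def)
    then have "A \<subseteq> {SOME x. x \<in> A}" by (metis singletonI someI subsetI)
    then show False using A(1) finite_subset by blast
  next
    case 2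
    then have "compact_space (utopology (discrete_ustruct A))"
      using AC by (auto simp: compact_T2_iff)
    then show False using compact_discrete_finite A(1) by blast
  qed
qed

lemma subcategory_one_point: "subcategory (one_point_spaces :: 'u ustruct set)"
proof (rule subcategoryI)
  fix X Y :: "'u ustruct"
  assume X: "X \<in> one_point_spaces" and Y: "unif_space Y" "small (points Y)" "uiso X Y"
  obtain f g where fg: "f \<in> umaps X Y" "g \<in> umaps Y X" "\<And>y. y \<in> points Y \<Longrightarrow> f (g y) = y"
    using uisoE[OF Y(3)] by metis
  obtain x where x: "points X = {x}" using X unfolding one_point_spaces_def by blast
  have "y = f x" if "y \<in> points Y" for y using fg(3)[OF that] umapsD(2)[OF fg(2) that] x by simp
  then have "points Y = {f x}" using umapsD(2)[OF fg(1)] x by blast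
  then show "Y \<in> one_point_spaces" using Y(1) by (simp add: one_point_spaces_def)
qed (auto simp: one_point_spaces_def small_def intro!: finite_lesspoll_universe)

lemma closed_products_one_point: "closed_under_products (one_point_spaces :: 'u ustruct set)"
proof (rule closed_under_productsI)
  show "one_point_spaces \<subseteq> (Ob Unif :: 'u ustruct set)"
    using subcategory_one_point unfolding subcategory_def by blast
  fix I :: "'u set" and X P \<pi>
  assume X: "\<And>i. i \<in> I \<Longrightarrow> X i \<in> (one_point_spaces :: 'u ustruct set)"
    and P: "P \<in> (Ob Unif :: 'u ustruct set)" "product_cone I X P \<pi>"
  have "\<exists>x. points (X i) = {x}" if "i \<in> I" for i using X[OF that] by (simp add: one_point_spaces_def)
  then obtain x where x: "\<And>i. i \<in> I \<Longrightarrow> points (X i) = {x i}" by metis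
  obtain p where p: "p \<in> points P" using product_cone_point[OF P(2), of x] x by blast
  have "q = p" if "q \<in> points P" for q
  proof (rule product_cone_eqI[OF P(2) that p])
    show "\<pi> i q = \<pi> i p" if "i \<in> I" for i
      using umapsD(2)[OF product_cone_proj[OF P(2) that] p] x[OF that]
        umapsD(2)[OF product_cone_proj[OF P(2) that] \<open>q \<in> points P\<close>] by simp
  qed
  then have "points P = {p}" using p by blast
  then show "P \<in> one_point_spaces" using P(1) by (simp add: one_point_spaces_def Ob_Unif)
qed

lemma umaps_one_point:
  assumes X: "unif_space X" and Y: "Y \<in> one_point_spaces" "points Y = {y}"
  shows "umaps X Y = {\<lambda>x\<in>points X. y}"
proof -
  have uY: "unif_space Y" using Y by (simp add: one_point_spaces_def)
  have "f = (\<lambda>x\<in>points X. y)" if "f \<in> umaps X Y" for f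
    using umapsD(2,3)[OF that] Y(2) by (auto simp: fun_eq_iff)
  then show ?thesis using umaps_const[OF X uY, of y] Y(2) by blast
qed

text \<open>Every hom-set is a singleton, so all universal properties hold trivially. The criterion
  for categories like \<open>Set\<close> does not apply, because only singletons are
  carriers.\<close>

lemma algebraic_one_point: "algebraic_category (one_point_spaces :: 'u ustruct set)"
proof (rule algebraic_categoryI[OF subcategory_one_point])
  note uC = subcategoryD(1)[OF subcategory_one_point]
  have one: "\<exists>y. points Y = {y} \<and> (\<forall>X :: 'u ustruct. unif_space X \<longrightarrow> umaps X Y = {\<lambda>x\<in>points X. y})"
    if "Y \<in> one_point_spaces" for Y :: "'u ustruct"
    using that umaps_one_point[OF _ that] by (auto simp: one_point_spaces_def)
  {
    fix X Y :: "'u ustruct" and f g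
    assume X: "X \<in> one_point_spaces" and Y: "Y \<in> one_point_spaces" and fg: "f \<in> umaps X Y" "g \<in> umaps X Y"
    have "f = g" using one[OF Y] fg uC[OF X] by auto
    have "coequalizer (full_on Unif one_point_spaces) X Y f g Y (\<lambda>y\<in>points Y. y)"
      unfolding coequalizer_Unif_iff
    proof (intro conjI ballI impI Y umaps_id uC)
      show "compose (points X) (\<lambda>y\<in>points Y. y) f = compose (points X) (\<lambda>y\<in>points Y. y) g"
        using \<open>f = g\<close> by simp
      fix Z :: "'u ustruct" and h assume Z: "Z \<in> one_point_spaces" and h: "h \<in> umaps Y Z"
      have "compose (points Y) h (\<lambda>y\<in>points Y. y) \<in> umaps Y Z"
        by (rule umaps_compose[OF umaps_id[OF uC[OF Y]] h])
      then show "\<exists>!k. k \<in> umaps Y Z \<and> compose (points Y) k (\<lambda>y\<in>points Y. y) = h"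
        using one[OF Z] h uC[OF Y] by auto
    qed
    then show "\<exists>Q q. coequalizer (full_on Unif one_point_spaces) X Y f g Q q" by blast
  next
    fix X Y :: "'u ustruct" and f
    assume X: "X \<in> one_point_spaces" and Y: "Y \<in> one_point_spaces" and f: "f \<in> umaps X Y"
    obtain x y where xy: "points X = {x}" "points Y = {y}" using one X Y by metis
    have "points Y = f ` points X" using umapsD(2)[OF f] xy by auto
    then show "\<exists>Z\<in>one_point_spaces :: 'u ustruct set. points Z = f ` points X \<and> f \<in> umaps X Z \<and> (\<lambda>z\<in>points Z. z) \<in> umaps Z Y"
      using Y f umaps_id[OF uC[OF Y]] by (intro bexI[OF _ Y] conjI)
    show "\<exists>P\<in>one_point_spaces :: 'u ustruct set. \<exists>u\<in>umaps P X. \<exists>v\<in>umaps P X. (\<forall>z\<in>points P. f (u z) = f (v z)) \<and>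
        (\<forall>x\<in>points X. \<forall>y\<in>points X. f x = f y \<longrightarrow> (\<exists>z\<in>points P. u z = x \<and> v z = y))"
      by (intro bexI[OF _ X] bexI[OF _ umaps_id[OF uC[OF X]]]) (simp add: xy)
  next
    fix X Y Z :: "'u ustruct" and f k
    assume X: "X \<in> one_point_spaces" and Y: "Y \<in> one_point_spaces" and Z: "Z \<in> one_point_spaces"
      and f: "f ` points X = points Y"
      and k: "k \<in> extensional (points Y)" "compose (points X) k f \<in> umaps X Z"
    obtain z where z: "points Z = {z}" "\<forall>X :: 'u ustruct. unif_space X \<longrightarrow> umaps X Z = {\<lambda>x\<in>points X. z}"
      using one[OF Z] by blast
    have "k (f x) = z" if "x \<in> points X" for x
      using umapsD(2)[OF k(2) that] that z(1) by (simp add: compose_def)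
    then have "k y = z" if "y \<in> points Y" for y using that f by force
    then have "k = (\<lambda>y\<in>points Y. z)" using k(1) by (auto simp: fun_eq_iff extensional_def)
    then show "k \<in> umaps Y Z" using z(2) uC[OF Y] by simp
  next
    fix A :: "'u set"
    \<comment> \<open>A one-point space is free over every set, the empty one included.\<close>
    define F where "F = indiscrete_ustruct {undefined :: 'u}"
    have F: "F \<in> one_point_spaces" and uF: "unif_space F"
      by (simp_all add: F_def one_point_spaces_def unif_space_indiscrete)
    have "\<exists>!g. g \<in> umaps F Y \<and> compose A g (\<lambda>a\<in>A. undefined) = f"
      if Y: "Y \<in> one_point_spaces" and f: "f \<in> A \<rightarrow>\<^sub>E points Y" for Y :: "'u ustruct" and f
    proof -
      obtain y where y: "points Y = {y}" "\<forall>X :: 'u ustruct. unif_space X \<longrightarrow> umaps X Y = {\<lambda>x\<in>points X. y}"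
        using one[OF Y] by blast
      have "compose A (\<lambda>x\<in>points F. y) (\<lambda>a\<in>A. undefined) = f"
        using f y(1) by (auto simp: compose_def fun_eq_iff F_def PiE_iff extensional_def)
      then show ?thesis using y(2) uF by auto
    qed
    moreover have "(\<lambda>a\<in>A. undefined) \<in> A \<rightarrow>\<^sub>E points F" by (auto simp: F_def)
    ultimately show "\<exists>F\<in>one_point_spaces :: 'u ustruct set. \<exists>\<eta>\<in>A \<rightarrow>\<^sub>E points F. \<forall>Y\<in>one_point_spaces :: 'u ustruct set. \<forall>f\<in>A \<rightarrow>\<^sub>E points Y.
        \<exists>!g. g \<in> umaps F Y \<and> compose A g \<eta> = f"
      by (intro bexI[OF _ F] bexI[of _ "\<lambda>a\<in>A. undefined"] ballI)
  }
qed

text \<open>The empty space is indiscrete but has more than one map's worth of ambiguity as a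
  source: its reflection would be a one-point space, and the arrow from the empty space is not epi,
  since two different constants into a two-point space agree on it.\<close>

lemma not_indiscrete_or_epireflective_one_point:
  "\<not> indiscrete_or_epireflective (one_point_spaces :: 'u ustruct set)"
proof
  have small: "small A" if "finite A" for A :: "'u set"
    using finite_lesspoll_universe[OF that] by (simp add: small_def)
  assume io: "indiscrete_or_epireflective (one_point_spaces :: 'u ustruct set)"
  have "indiscrete_ustruct {} \<in> (indiscrete_spaces :: 'u ustruct set)"
    by (simp add: mem_indiscrete_spaces unif_space_indiscrete uindiscrete_indiscrete small)
  moreover have "indiscrete_ustruct {} \<notin> (one_point_spaces :: 'u ustruct set)"
    by (simp add: one_point_spaces_def)
  ultimately have "one_point_spaces \<noteq> (indiscrete_spaces :: 'u ustruct set)" by metis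
  then have epir: "epireflective (full_on Unif compact_T2_spaces) (one_point_spaces :: 'u ustruct set)"
    using io unfolding indiscrete_or_epireflective_def by simp
  let ?E = "discrete_ustruct ({} :: 'u set)"
  have E: "?E \<in> compact_T2_spaces" by (rule finite_discrete_compact_T2) (simp_all add: small)
  obtain R r where R: "R \<in> one_point_spaces" "epi (full_on Unif compact_T2_spaces) ?E R r"
    using epireflective_reflection[OF subcategory_one_point epir E] by metis
  obtain s t :: 'u where st: "s \<noteq> t"
    using infinite_universe by (metis (full_types) UNIV_eq_I finite.emptyI finite_insert insert_iff)
  let ?Z = "discrete_ustruct {s, t}"
  have Z: "?Z \<in> compact_T2_spaces" by (rule finite_discrete_compact_T2) (simp_all add: small)
  obtain x where x: "points R = {x}" and uR: "unif_space R" using R(1) by (auto simp: one_point_spaces_def)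
  have "(\<lambda>x\<in>points R. s) \<in> umaps R ?Z" "(\<lambda>x\<in>points R. t) \<in> umaps R ?Z"
    by (rule umaps_const[OF uR unif_space_discrete], simp)+
  moreover have "compose (points ?E) (\<lambda>x\<in>points R. s) r = compose (points ?E) (\<lambda>x\<in>points R. t) r"
    by (simp add: compose_def restrict_def)
  ultimately have "(\<lambda>x\<in>points R. s) = (\<lambda>x\<in>points R. t)"
    using R(2) Z unfolding epi_def by simp
  then have "(\<lambda>x\<in>points R. s) x = (\<lambda>x\<in>points R. t) x" by simp
  then show False using x st by simp
qed

lemma algebraic_iff:
  assumes C: "subcategory (C :: 'u ustruct set)"
  shows "closed_under_products C \<and> closed_under_closed_subspaces C \<and> algebraic_category C \<longleftrightarrow>
    indiscrete_or_epireflective C"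
proof
  assume cl: "closed_under_products C \<and> closed_under_closed_subspaces C \<and> algebraic_category C"
  show "indiscrete_or_epireflective C"
  proof (cases "\<exists>X\<in>C. \<not> Hausdorff_space (utopology X)")
    case True
    then show ?thesis
      using algebraic_non_Hausdorff_eq_indiscrete_spaces[OF C] cl
      unfolding indiscrete_or_epireflective_def by blast
  next
    case False
    have "X \<in> compact_T2_spaces" if X: "X \<in> C" for X
    proof -
      have "Hausdorff_space (utopology X)" using False X by blast
      moreover have "compact_space (utopology X)"
        using algebraic_Hausdorff_imp_compact[OF C _ _ _ X] cl \<open>Hausdorff_space (utopology X)\<close> by blast
      ultimately show ?thesis using subcategoryD(1,2)[OF C X] by (simp add: compact_T2_iff)
    qed
    then show ?thesis
      using epireflective_compact_T2I[OF C] cl unfolding indiscrete_or_epireflective_def by blast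
  qed
next
  assume "indiscrete_or_epireflective C"
  then consider "C = indiscrete_spaces" | "epireflective (full_on Unif compact_T2_spaces) C"
    unfolding indiscrete_or_epireflective_def by blast
  then show "closed_under_products C \<and> closed_under_closed_subspaces C \<and> algebraic_category C"
  proof cases
    case 1
    then show ?thesis
      using closed_products_indiscrete closed_subspaces_indiscrete algebraic_indiscrete by simp
  next
    case 2
    note cl = epireflective_closed_products[OF C 2] epireflective_closed_subspaces[OF C 2]
    then show ?thesis using algebraic_compact_T2[OF C cl epireflective_subset[OF C 2]] by blast
  qed
qed

end

theorem theorem5:
  assumes "inaccessible_universe TYPE('u)"
  shows "(\<forall>C :: 'u ustruct set. subcategory C \<longrightarrow>
            (closed_under_products C \<and> closed_under_closed_subspaces C \<and> algebraic_category C \<longleftrightarrow>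
             indiscrete_or_epireflective C)) \<and>
         (\<exists>C :: 'u ustruct set. subcategory C \<and>
            closed_under_closed_subspaces C \<and> algebraic_category C \<and>
            \<not> indiscrete_or_epireflective C) \<and>
         (\<exists>C :: 'u ustruct set. subcategory C \<and>
            closed_under_products C \<and> algebraic_category C \<and>
            \<not> indiscrete_or_epireflective C) \<and>
         (\<exists>C :: 'u ustruct set. subcategory C \<and>
            closed_under_products C \<and> closed_under_closed_subspaces C \<and>
            \<not> indiscrete_or_epireflective C)"
proof -
  interpret universe "TYPE('u)" by unfold_locales (rule assms)
  show ?thesis
  proof (intro conjI allI impI)
    fix C :: "'u ustruct set" assume "subcategory C"
    then show "closed_under_products C \<and> closed_under_closed_subspaces C \<and> algebraic_category C \<longleftrightarrow>
        indiscrete_or_epireflective C" by (rule algebraic_iff)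
  next
    \<comment> \<open>Products omitted: the discrete spaces.\<close>
    have "\<not> indiscrete_or_epireflective (discrete_spaces :: 'u ustruct set)"
      by (rule not_indiscrete_or_epireflective_if_discrete) (rule discrete_ustruct_in_discrete_spaces)
    then show "\<exists>C :: 'u ustruct set. subcategory C \<and> closed_under_closed_subspaces C \<and>
        algebraic_category C \<and> \<not> indiscrete_or_epireflective C"
      using subcategory_discrete closed_subspaces_discrete algebraic_discrete by blast
  next
    \<comment> \<open>Closed subspaces omitted: the one-point spaces.\<close>
    show "\<exists>C :: 'u ustruct set. subcategory C \<and> closed_under_products C \<and>
        algebraic_category C \<and> \<not> indiscrete_or_epireflective C"
      using subcategory_one_point closed_products_one_point algebraic_one_point
        not_indiscrete_or_epireflective_one_point by blast
  next
    \<comment> \<open>Algebraicity omitted: all of \<open>Unif\<close>, whose closure properties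
      only require that products and subspaces stay small.\<close>
    have "\<not> indiscrete_or_epireflective (Ob Unif :: 'u ustruct set)"
      by (rule not_indiscrete_or_epireflective_if_discrete) (simp add: Ob_Unif unif_space_discrete)
    moreover have "closed_under_closed_subspaces (Ob Unif :: 'u ustruct set)"
      unfolding closed_under_closed_subspaces_def
    proof (intro ballI allI impI)
      fix X :: "'u ustruct" and A assume X: "X \<in> Ob Unif" and A: "closedin (utopology X) A"
      have "A \<subseteq> points X" using closedin_subset[OF A] X by (simp add: Ob_Unif)
      then show "usubspace X A \<in> Ob Unif"
        using X unif_space_usubspace small_subset by (auto simp: Ob_Unif)
    qed
    ultimately show "\<exists>C :: 'u ustruct set. subcategory C \<and> closed_under_products C \<and>
        closed_under_closed_subspaces C \<and> \<not> indiscrete_or_epireflective C"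
      using subcategory_Unif closed_under_products_Unif by blast
  qed
qed

end
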